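(* Let $p$ be a prime, let $F$ be a field of characteristic $p$, and let $r\geq 1$ and $m\geq 2$ be integers. Suppose that $A=\omega_1\otimes\beta_1+\cdots+\omega_r\otimes\beta_r\in H_{p^m}^2(F)$, with $\omega_1,\dots,\omega_r\in W_mF$ and $\beta_1,\dots,\beta_r\in F^\times$, satisfies $\exp(A)\mid p^{m-1}$. Then the symbol length of $A$ in $H_{p^{m-1}}^2(F)$ is at most $p^r+r-1$.
   Context: Let $F$ be a field of characteristic $p>0$, and for $k\ge 1$ let $W_kF$ be the ring of ($p$-typical) truncated Witt vectors of length $k$ over $F$. The group $H_{p^k}^{2}(F)$ is the quotient of the abelian group $W_kF\otimes_{\mathbb Z} F^\times$ by the relations: (1) $(0,\dots,0,\beta,0,\dots,0)\otimes\beta=0$ for $\beta\in F^\times$ (where $\beta$ may stand in any slot of the Witt vector); (2) $(\omega^p-\omega)\otimes\beta=0$, where for $\omega=(\omega_1,\dots,\omega_k)$ one sets $\omega^p=(\omega_1^p,\dots,\omega_k^p)$ and the subtraction is that of Witt vectors. (It is isomorphic to the $p^k$-torsion of the Brauer group of $F$.) The class of an element $\omega\otimes\beta$ is called a symbol. The symbol length of a class in $H_{p^k}^{2}(F)$ is the minimal number of symbols in $H_{p^k}^{2}(F)$ whose sum is that class. The exponent $\exp(A)$ of a class $A$ is its order in the (additively written) group. There is a known injective homomorphism $H_{p^{m-1}}^{2}(F)\to H_{p^m}^{2}(F)$ sending $(\omega_1,\dots,\omega_{m-1})\otimes\beta$ to $(0,\omega_1,\dots,\omega_{m-1})\otimes\beta$.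 Its image is the kernel of the map $H_{p^m}^{2}(F)\to H_p^{2}(F)$, $(\omega_1,\dots,\omega_m)\otimes\beta\mapsto \omega_1\otimes\beta$, and this image is exactly the set of classes of exponent dividing $p^{m-1}$. Via this injection $H_{p^{m-1}}^{2}(F)$ is regarded as a subgroup of $H_{p^m}^{2}(F)$, and for a class $A\in H_{p^m}^{2}(F)$ with $\exp(A)\mid p^{m-1}$, the symbol length of $A$ in $H_{p^{m-1}}^{2}(F)$ means the symbol length of its unique preimage. *)

theory Defs
  imports
    "HOL-Algebra.Algebra"
    "HOL-Algebra.Algebraic_Closure_Type"
    "HOL-Library.Poly_Mapping"
begin

section \<open>Integer polynomials in several variables\<close>

text \<open>Monomials are finitely supported exponent functions; the ring structure on the
  polynomials is the convolution ring of \<^theory>\<open>HOL-Library.Poly_Mapping\<close>.\<close>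

type_synonym 'v int_poly = "('v \<Rightarrow>\<^sub>0 nat) \<Rightarrow>\<^sub>0 int"

definition var :: "'v \<Rightarrow> 'v int_poly" where
  "var v = Poly_Mapping.single (Poly_Mapping.single v 1) 1"

definition eval_poly_at :: "'v int_poly \<Rightarrow> ('v \<Rightarrow> 'a::comm_ring_1) \<Rightarrow> 'a" where
  "eval_poly_at P f =
     (\<Sum>M\<in>Poly_Mapping.keys P. of_int (Poly_Mapping.lookup P M) *
        (\<Prod>v\<in>Poly_Mapping.keys M. f v ^ Poly_Mapping.lookup M v))"

section \<open>Truncated p-typical Witt vectors\<close>

text \<open>The Witt polynomial \<open>w_n(X_0, \<dots>, X_n) = \<Sum>_i p^i X_i^(p^(n-i))\<close>.\<close>

definition ghost :: "nat \<Rightarrow> nat \<Rightarrow> (nat \<Rightarrow> 'b) \<Rightarrow> 'b::comm_ring_1" where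
  "ghost p n x = (\<Sum>i\<le>n. of_nat p ^ i * x i ^ (p ^ (n - i)))"

text \<open>For \<open>\<Phi>\<close> one of \<open>(+)\<close> and \<open>(*)\<close>, the structure polynomials \<open>S_n\<close> in the variables
  \<open>X_i\<close> (\<open>Inl i\<close>) and \<open>Y_i\<close> (\<open>Inr i\<close>) are determined by
  \<open>w_n(S_0, \<dots>, S_n) = \<Phi> (w_n(X)) (w_n(Y))\<close>. Solving for \<open>S_n\<close> requires a division by \<open>p^n\<close>,
  which for prime \<open>p\<close> is exact (Witt), so dividing the integer coefficients with \<open>div\<close> is
  correct.\<close>

function witt_poly ::
  "nat \<Rightarrow> ((nat + nat) int_poly \<Rightarrow> (nat + nat) int_poly \<Rightarrow> (nat + nat) int_poly) \<Rightarrow> nat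
    \<Rightarrow> (nat + nat) int_poly" where
  "witt_poly p \<Phi> n = Poly_Mapping.map (\<lambda>c. c div int p ^ n)
     (\<Phi> (ghost p n (\<lambda>i. var (Inl i))) (ghost p n (\<lambda>i. var (Inr i)))
       - (\<Sum>i<n. of_nat p ^ i * witt_poly p \<Phi> i ^ (p ^ (n - i))))"
  by pat_completeness auto
termination by (relation "measure (\<lambda>(p, \<Phi>, n). n)") auto

declare witt_poly.simps [simp del]

text \<open>A Witt vector \<open>(\<omega>_1, \<dots>, \<omega>_k)\<close> is a list of length \<open>k\<close>, so \<open>\<omega>_1\<close> is its entry number 0.
  Only the entries of index at most \<open>n\<close> enter into the \<open>n\<close>-th component of a sum or product.\<close>

definition witt_op ::
  "nat \<Rightarrow> nat \<Rightarrow> ((nat + nat) int_poly \<Rightarrow> (nat + nat) int_poly \<Rightarrow> (nat + nat) int_poly)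
    \<Rightarrow> 'a::comm_ring_1 list \<Rightarrow> 'a list \<Rightarrow> 'a list" where
  "witt_op p k \<Phi> x y =
     map (\<lambda>n. eval_poly_at (witt_poly p \<Phi> n) (case_sum (\<lambda>i. x ! i) (\<lambda>i. y ! i))) [0..<k]"

definition witt_ring :: "nat \<Rightarrow> nat \<Rightarrow> 'a::comm_ring_1 list ring" where
  "witt_ring p k =
     \<lparr>carrier = {\<omega>. length \<omega> = k},
      monoid.mult = witt_op p k (*),
      one = (replicate k 0)[0 := 1],
      ring.zero = replicate k 0,
      add = witt_op p k (+)\<rparr>"

section \<open>Tensor products of abelian groups\<close>

definition bilinear_relations ::
  "('a, 'm) monoid_scheme \<Rightarrow> ('b, 'n) monoid_scheme \<Rightarrow> ('a \<times> 'b \<Rightarrow>\<^sub>0 int) set" where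
  "bilinear_relations G K =
     {frag_of (x \<otimes>\<^bsub>G\<^esub> x', y) - frag_of (x, y) - frag_of (x', y) | x x' y.
        x \<in> carrier G \<and> x' \<in> carrier G \<and> y \<in> carrier K} \<union>
     {frag_of (x, y \<otimes>\<^bsub>K\<^esub> y') - frag_of (x, y) - frag_of (x, y') | x y y'.
        x \<in> carrier G \<and> y \<in> carrier K \<and> y' \<in> carrier K}"

definition bilinear_subgroup ::
  "('a, 'm) monoid_scheme \<Rightarrow> ('b, 'n) monoid_scheme \<Rightarrow> ('a \<times> 'b \<Rightarrow>\<^sub>0 int) set" where
  "bilinear_subgroup G K =
     generate (free_Abelian_group (carrier G \<times> carrier K)) (bilinear_relations G K)"

definition tensor_group ::
  "('a, 'm) monoid_scheme \<Rightarrow> ('b, 'n) monoid_scheme \<Rightarrow> ('a \<times> 'b \<Rightarrow>\<^sub>0 int) set monoid" where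
  "tensor_group G K =
     free_Abelian_group (carrier G \<times> carrier K) Mod bilinear_subgroup G K"

definition pure_tensor ::
  "('a, 'm) monoid_scheme \<Rightarrow> ('b, 'n) monoid_scheme \<Rightarrow> 'a \<Rightarrow> 'b \<Rightarrow> ('a \<times> 'b \<Rightarrow>\<^sub>0 int) set" where
  "pure_tensor G K x y =
     bilinear_subgroup G K #>\<^bsub>free_Abelian_group (carrier G \<times> carrier K)\<^esub> frag_of (x, y)"

section \<open>The groups of symbols, symbol length and the shift embedding\<close>

text \<open>The groups below are HOL-Algebra groups and hence written multiplicatively, although
  the mathematics writes them additively.\<close>

abbreviation witt_group :: "nat \<Rightarrow> nat \<Rightarrow> 'a::field list monoid" where
  "witt_group p k \<equiv> add_monoid (witt_ring p k)"

abbreviation field_units :: "'a::field monoid" where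
  "field_units \<equiv> mult_of ring_of_type_algebra"

type_synonym 'a tensor = "('a list \<times> 'a \<Rightarrow>\<^sub>0 int) set"

abbreviation witt_tensor_group :: "nat \<Rightarrow> nat \<Rightarrow> 'a::field tensor monoid" where
  "witt_tensor_group p k \<equiv> tensor_group (witt_group p k) field_units"

abbreviation witt_tensor :: "nat \<Rightarrow> nat \<Rightarrow> 'a::field list \<Rightarrow> 'a \<Rightarrow> 'a tensor" where
  "witt_tensor p k \<equiv> pure_tensor (witt_group p k) field_units"

definition H2_relations :: "nat \<Rightarrow> nat \<Rightarrow> 'a::field tensor set" where
  "H2_relations p k =
     {witt_tensor p k ((replicate k 0)[i := \<beta>]) \<beta> | i \<beta>.
        i < k \<and> \<beta> \<in> carrier field_units} \<union>
     {witt_tensor p k (map (\<lambda>x. x ^ p) \<omega> \<ominus>\<^bsub>witt_ring p k\<^esub> \<omega>) \<beta> | \<omega> \<beta>.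
        \<omega> \<in> carrier (witt_ring p k) \<and> \<beta> \<in> carrier field_units}"

definition H2_subgroup :: "nat \<Rightarrow> nat \<Rightarrow> 'a::field tensor set" where
  "H2_subgroup p k = generate (witt_tensor_group p k) (H2_relations p k)"

definition H2 :: "nat \<Rightarrow> nat \<Rightarrow> 'a::field tensor set monoid" where
  "H2 p k = witt_tensor_group p k Mod H2_subgroup p k"

definition symbol :: "nat \<Rightarrow> nat \<Rightarrow> 'a::field list \<Rightarrow> 'a \<Rightarrow> 'a tensor set" where
  "symbol p k \<omega> \<beta> = H2_subgroup p k #>\<^bsub>witt_tensor_group p k\<^esub> witt_tensor p k \<omega> \<beta>"

definition is_symbol :: "nat \<Rightarrow> nat \<Rightarrow> 'a::field tensor set \<Rightarrow> bool" where
  "is_symbol p k s \<longleftrightarrow>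
     (\<exists>\<omega>\<in>carrier (witt_ring p k). \<exists>\<beta>\<in>carrier field_units. s = symbol p k \<omega> \<beta>)"

text \<open>The empty sum is allowed, so the trivial class has symbol length 0. Every class is a
  finite sum of symbols, as \<open>-(\<omega> \<otimes> \<beta>) = \<omega> \<otimes> \<beta>\<^sup>-\<^sup>1\<close>, so the minimum exists.\<close>

definition symbol_length :: "nat \<Rightarrow> nat \<Rightarrow> 'a::field tensor set \<Rightarrow> nat" where
  "symbol_length p k A =
     (LEAST n. \<exists>s. (\<forall>i<n. is_symbol p k (s i)) \<and> A = finprod (H2 p k) s {..<n})"

text \<open>The homomorphism \<open>\<omega> \<otimes> \<beta> \<mapsto> (0, \<omega>) \<otimes> \<beta>\<close> between the groups for \<open>k\<close> and \<open>k + 1\<close>.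
  It is unique since the symbols generate; extensionality fixes its values
  outside the carrier.\<close>

definition H2_shift :: "nat \<Rightarrow> nat \<Rightarrow> 'a::field tensor set \<Rightarrow> 'a tensor set" where
  "H2_shift p k =
     (THE f. f \<in> hom (H2 p k) (H2 p (k + 1)) \<inter> extensional (carrier (H2 p k)) \<and>
        (\<forall>\<omega>\<in>carrier (witt_ring p k). \<forall>\<beta>\<in>carrier field_units.
           f (symbol p k \<omega> \<beta>) = symbol p (k + 1) (0 # \<omega>) \<beta>))"

text \<open>For a class \<open>A\<close> in \<^term>\<open>H2 p (k + 1)\<close> of exponent dividing \<open>p ^ k\<close>: the symbol length
  in \<^term>\<open>H2 p k\<close> of its unique preimage under the injection \<^const>\<open>H2_shift\<close>.\<close>

definition symbol_length_of_preimage :: "nat \<Rightarrow> nat \<Rightarrow> 'a::field tensor set \<Rightarrow> nat" where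
  "symbol_length_of_preimage p k A =
     symbol_length p k (the_inv_into (carrier (H2 p k)) (H2_shift p k) A)"

end

theory Submission imports Defs begin

text \<open>Write \<open>V\<close>, \<open>F\<close> and \<open>[a]\<close> for the Verschiebung, the Frobenius and the Teichmueller
  representative, and \<open>\<omega> \<otimes> \<beta>\<close> for a symbol. The relations give \<open>F \<omega> \<otimes> \<beta> = \<omega> \<otimes> \<beta>\<close>, and \<open>p = V F\<close>;
  hence multiplication by \<open>p\<close> is the same as the shift \<open>\<omega> \<otimes> \<beta> \<mapsto> V \<omega> \<otimes> \<beta>\<close>. If \<open>A = \<Sum>_i \<omega>_i \<otimes> \<beta>_i\<close>
  is killed by \<open>p^(m-1)\<close> and \<open>a_i\<close> denotes the first component of \<open>\<omega>_i\<close>, then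
  \<open>\<Sum>_i V^(m-1) [a_i] \<otimes> \<beta>_i = 0\<close> in the group of length \<open>m\<close> (\<open>frag_cmul_p_power\<close>,
  \<open>first_components\<close>).

  The heart of the proof is that such a relation forces \<open>a_i = x_i^p - x_i + \<Sum>_e e_i c_e^p \<beta>^e\<close>,
  where \<open>e\<close> runs over the exponents in \<open>{0..p-1}^r\<close> and \<open>\<beta>^e\<close> is the monomial in the \<open>\<beta>_i\<close>
  (\<open>trivial_family_exists\<close>). Given this, the summand \<open>x_i^p - x_i\<close> is removed from \<open>\<omega>_i\<close> by an
  Artin-Schreier relation. For a fixed \<open>e\<close> put \<open>t = [c_e^p \<beta>^e]\<close>; then
  \<open>\<Sum>_i e_i t \<otimes> \<beta>_i = t \<otimes> \<beta>^e = - (t \<otimes> c_e^p) = V t \<otimes> c_e^-1\<close>, because \<open>t \<otimes> c_e^p \<beta>^e = 0\<close>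
  (\<open>monomial_symbol\<close>). So every \<open>e \<noteq> 0\<close> contributes a single symbol that is shifted, and \<open>e = 0\<close>
  contributes nothing. What is left of each \<open>\<omega>_i\<close> has first component \<open>0\<close> and contributes a
  shifted symbol \<open>V w_i \<otimes> \<beta>_i\<close>. Altogether \<open>A\<close> is the shift of a sum of \<open>(p^r - 1) + r\<close> symbols
  (\<open>shifted_representative\<close>).

  The form of the \<open>a_i\<close> is found with differential forms. Let \<open>B\<close> be a \<open>p\<close>-basis of the field.
  Polynomials over the Witt vectors in variables indexed by \<open>B\<close>, evaluated at the Teichmueller
  representatives of \<open>B\<close> with coefficients twisted by a power of \<open>F\<close>, provide a flat lift of the
  field modulo \<open>p^n\<close> that carries the derivations \<open>b d/db\<close> and a lift \<open>phi\<close> of the Frobenius. On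
  it a symbol \<open>\<omega> \<otimes> \<beta>\<close> of length \<open>n\<close> becomes the form \<open>\<omega> dlog \<beta>\<close>; all relations between symbols go
  to forms \<open>phi \<theta> - \<theta> + d g\<close> modulo \<open>p^n\<close> (\<open>log_form_Rel\<close>). By the theorem of Jacobson and
  Cartier that a form fixed by the Cartier operator is logarithmic (\<open>jacobson_cartier\<close>), forms of
  this type can be divided by \<open>p\<close> (\<open>trivial_forms_divide\<close>). The relation above therefore yields
  \<open>\<Sum>_i a_i dlog \<beta>_i = \<theta>^p - \<theta> + d g\<close> over the field itself (\<open>log_form_trivial\<close>), where \<open>\<theta>^p\<close>
  stands for the inverse Cartier operator applied to \<open>\<theta>\<close>. If \<open>B\<close> contains a maximal
  \<open>p\<close>-independent subset of the \<open>\<beta>_i\<close>, this identity can be read as a statement about the \<open>a_i\<close>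
  (\<open>trivial_family\<close>).

  The injectivity of the shift comes from the same argument applied to arbitrarily many symbols
  (\<open>shift_symbols_funpow_injective\<close>), so the class found is the preimage of \<open>A\<close>. Formal sums of
  symbols with Witt vectors of infinite length are used throughout; \<open>H2_class_eq_iff\<close> compares
  them with the groups of symbols.\<close>

section \<open>Ring homomorphisms and evaluation of polynomials\<close>

text \<open>A predicate rather than a locale: evaluations of polynomials, Frobenius maps, residues and
  their compositions all occur as terms, and an identity between two of them needs to be checked
  on generators only.\<close>

definition ringmap :: "('a::comm_ring_1 \<Rightarrow> 'b::comm_ring_1) \<Rightarrow> bool" where
  "ringmap h \<longleftrightarrow> h 1 = 1 \<and> (\<forall>a b. h (a + b) = h a + h b) \<and> (\<forall>a b. h (a * b) = h a * h b)"

lemma ringmapI: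
  assumes "h 1 = 1" "\<And>a b. h (a + b) = h a + h b" "\<And>a b. h (a * b) = h a * h b"
  shows "ringmap h"
  using assms by (simp add: ringmap_def)

lemma ringmap_one: "ringmap h \<Longrightarrow> h 1 = 1"
  and ringmap_add: "ringmap h \<Longrightarrow> h (a + b) = h a + h b"
  and ringmap_mult: "ringmap h \<Longrightarrow> h (a * b) = h a * h b"
  by (simp_all add: ringmap_def)

lemma ringmap_zero: "ringmap h \<Longrightarrow> h 0 = 0"
  using ringmap_add[of h 0 0] by simp

lemma ringmap_uminus: "ringmap h \<Longrightarrow> h (- a) = - h a"
  using ringmap_add[of h a "- a"] ringmap_zero[of h] by (simp add: eq_neg_iff_add_eq_0 add.commute)

lemma ringmap_diff: "ringmap h \<Longrightarrow> h (a - b) = h a - h b"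
  using ringmap_add[of h a "- b"] ringmap_uminus[of h b] by simp

lemma ringmap_sum: "ringmap h \<Longrightarrow> h (sum f S) = (\<Sum>x\<in>S. h (f x))"
  by (induction S rule: infinite_finite_induct) (simp_all add: ringmap_zero ringmap_add)

lemma ringmap_prod: "ringmap h \<Longrightarrow> h (prod f S) = (\<Prod>x\<in>S. h (f x))"
  by (induction S rule: infinite_finite_induct) (simp_all add: ringmap_one ringmap_mult)

lemma ringmap_power: "ringmap h \<Longrightarrow> h (a ^ n) = h a ^ n"
  by (induction n) (simp_all add: ringmap_one ringmap_mult)

lemma ringmap_of_nat: "ringmap h \<Longrightarrow> h (of_nat n) = of_nat n"
  by (induction n) (simp_all add: ringmap_zero ringmap_one ringmap_add)

lemma ringmap_of_int: "ringmap h \<Longrightarrow> h (of_int n) = of_int n"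
  by (cases n) (simp_all add: ringmap_of_nat ringmap_uminus ringmap_diff ringmap_one)

lemmas ringmap_simps = ringmap_one ringmap_add ringmap_mult ringmap_zero ringmap_uminus
  ringmap_diff ringmap_sum ringmap_prod ringmap_power ringmap_of_nat ringmap_of_int

lemma ringmap_comp: "ringmap f \<Longrightarrow> ringmap g \<Longrightarrow> ringmap (\<lambda>x. f (g x))"
  by (simp add: ringmap_def)

lemma ringmap_id: "ringmap (\<lambda>x. x)"
  by (simp add: ringmap_def)

lemma ringmap_of_int_self: "ringmap (of_int :: int \<Rightarrow> 'a::comm_ring_1)"
  by (simp add: ringmap_def)

definition mon :: "('v \<Rightarrow> 'a::comm_ring_1) \<Rightarrow> ('v \<Rightarrow>\<^sub>0 nat) \<Rightarrow> 'a" where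
  "mon g M = (\<Prod>v\<in>Poly_Mapping.keys M. g v ^ Poly_Mapping.lookup M v)"

definition peval :: "('c::comm_ring_1 \<Rightarrow> 'a) \<Rightarrow> ('v \<Rightarrow> 'a::comm_ring_1) \<Rightarrow> (('v \<Rightarrow>\<^sub>0 nat) \<Rightarrow>\<^sub>0 'c) \<Rightarrow> 'a" where
  "peval h g P = (\<Sum>M\<in>Poly_Mapping.keys P. h (Poly_Mapping.lookup P M) * mon g M)"

lemma eval_poly_at_eq: "eval_poly_at P g = peval of_int g P"
  by (simp add: eval_poly_at_def peval_def mon_def)

lemma mon_superset:
  assumes "finite S" "Poly_Mapping.keys M \<subseteq> S"
  shows "mon g M = (\<Prod>v\<in>S. g v ^ Poly_Mapping.lookup M v)"
  unfolding mon_def using assms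
  by (intro prod.mono_neutral_left) (auto simp: in_keys_iff)

lemma mon_add: "mon g (M + M') = mon g M * mon g M'"
proof -
  let ?S = "Poly_Mapping.keys M \<union> Poly_Mapping.keys M'"
  have "mon g (M + M') = (\<Prod>v\<in>?S. g v ^ Poly_Mapping.lookup (M + M') v)"
    by (rule mon_superset) (auto simp: in_keys_iff lookup_add)
  also have "\<dots> = (\<Prod>v\<in>?S. g v ^ Poly_Mapping.lookup M v) * (\<Prod>v\<in>?S. g v ^ Poly_Mapping.lookup M' v)"
    by (simp add: lookup_add power_add prod.distrib)
  also have "\<dots> = mon g M * mon g M'"
    by (subst (1 2) mon_superset[of ?S]) auto
  finally show ?thesis .
qed

lemma mon_zero [simp]: "mon g 0 = 1"
  by (simp add: mon_def)

lemma mon_single [simp]: "mon g (Poly_Mapping.single v n) = g v ^ n"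
  by (cases "n = 0") (simp_all add: mon_def)

lemma ringmap_mon: "ringmap h \<Longrightarrow> h (mon g M) = mon (\<lambda>v. h (g v)) M"
  by (simp add: mon_def ringmap_simps)

lemma mon_power: "mon (\<lambda>v. g v ^ n) M = mon g M ^ n"
  by (simp add: mon_def prod_power_distrib flip: power_mult) (simp add: mult.commute)

lemma poly_expand: "P = (\<Sum>M\<in>Poly_Mapping.keys P. Poly_Mapping.single M (Poly_Mapping.lookup P M))"
proof (rule poly_mapping_eqI)
  fix k
  show "Poly_Mapping.lookup P k = Poly_Mapping.lookup (\<Sum>M\<in>Poly_Mapping.keys P. Poly_Mapping.single M (Poly_Mapping.lookup P M)) k"
    by (cases "k \<in> Poly_Mapping.keys P")
       (auto simp: lookup_sum lookup_single when_def in_keys_iff)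
qed

lemma poly_induct [case_names zero single add]:
  assumes "Q 0" "\<And>M c. Q (Poly_Mapping.single M c)" "\<And>a b. Q a \<Longrightarrow> Q b \<Longrightarrow> Q (a + b)"
  shows "Q (P :: 'k \<Rightarrow>\<^sub>0 'c::comm_monoid_add)"
proof -
  have "Q (\<Sum>M\<in>S. Poly_Mapping.single M (f M))" for S and f :: "'k \<Rightarrow> 'c"
    by (induction S rule: infinite_finite_induct) (auto intro: assms)
  then show ?thesis
    using poly_expand[of P] by metis
qed

lemma peval_superset:
  assumes "h 0 = 0" "finite S" "Poly_Mapping.keys P \<subseteq> S"
  shows "peval h g P = (\<Sum>M\<in>S. h (Poly_Mapping.lookup P M) * mon g M)"
  unfolding peval_def using assms
  by (intro sum.mono_neutral_left) (auto simp: in_keys_iff)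

lemma peval_zero [simp]: "peval h g 0 = 0"
  by (simp add: peval_def)

lemma peval_single: "h 0 = 0 \<Longrightarrow> peval h g (Poly_Mapping.single M c) = h c * mon g M"
  by (cases "c = 0") (simp_all add: peval_def)

lemma peval_add:
  assumes "ringmap h" shows "peval h g (P + Q) = peval h g P + peval h g Q"
proof -
  let ?S = "Poly_Mapping.keys P \<union> Poly_Mapping.keys Q"
  have h0: "h 0 = 0" using assms by (rule ringmap_zero)
  have "peval h g (P + Q) = (\<Sum>M\<in>?S. h (Poly_Mapping.lookup (P + Q) M) * mon g M)"
    using h0 by (intro peval_superset) (auto simp: keys_add)
  also have "\<dots> = (\<Sum>M\<in>?S. h (Poly_Mapping.lookup P M) * mon g M) + (\<Sum>M\<in>?S. h (Poly_Mapping.lookup Q M) * mon g M)"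
    by (simp add: lookup_add ringmap_add[OF assms] algebra_simps sum.distrib)
  also have "\<dots> = peval h g P + peval h g Q"
    using h0 by (simp add: peval_superset[of h ?S P] peval_superset[of h ?S Q])
  finally show ?thesis .
qed

lemma peval_mult:
  assumes "ringmap h" shows "peval h g (P * Q) = peval h g P * peval h g Q"
proof (induction P rule: poly_induct)
  case (single M c)
  note h0 = ringmap_zero[OF assms]
  show ?case
  proof (induction Q rule: poly_induct)
    case (single M' c')
    then show ?case
      by (simp add: mult_single peval_single[of h, OF h0] mon_add ringmap_mult[OF assms] algebra_simps)
  qed (simp_all add: peval_add[OF assms] algebra_simps)
qed (simp_all add: peval_add[OF assms] algebra_simps)

lemma ringmap_peval:
  assumes "ringmap h" shows "ringmap (peval h g)"
proof (rule ringmapI)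
  have "peval h g (Poly_Mapping.single 0 1) = h 1 * mon g 0"
    by (rule peval_single) (rule ringmap_zero[OF assms])
  then show "peval h g 1 = 1" by (simp add: ringmap_one[OF assms])
qed (simp_all add: peval_add peval_mult assms)

lemma single_eq_mon:
  "Poly_Mapping.single M c = Poly_Mapping.single 0 c * mon (\<lambda>v. Poly_Mapping.single (Poly_Mapping.single v 1) 1) M"
proof -
  have *: "Poly_Mapping.single (Poly_Mapping.single v (1::nat)) (1::'b) ^ n = Poly_Mapping.single (Poly_Mapping.single v n) 1" for v :: 'a and n
    by (induction n) (simp_all add: mult_single flip: single_add)
  have "(\<Prod>v\<in>S. Poly_Mapping.single (Poly_Mapping.single v (f v)) (1::'b)) = Poly_Mapping.single (\<Sum>v\<in>S. Poly_Mapping.single v (f v)) 1" for S :: "'a set" and f :: "'a \<Rightarrow> nat"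
    by (induction S rule: infinite_finite_induct) (simp_all add: mult_single)
  then have "mon (\<lambda>v. Poly_Mapping.single (Poly_Mapping.single v 1) (1::'b)) M = Poly_Mapping.single M 1"
    unfolding mon_def * using poly_expand[of M] by simp
  then show ?thesis by (simp add: mult_single)
qed

lemma ringmap_poly_eqI:
  fixes f g :: "(('v \<Rightarrow>\<^sub>0 nat) \<Rightarrow>\<^sub>0 'c::comm_ring_1) \<Rightarrow> 'd::comm_ring_1"
  assumes f: "ringmap f" and g: "ringmap g"
    and "\<And>c. f (Poly_Mapping.single 0 c) = g (Poly_Mapping.single 0 c)"
    and "\<And>v. f (Poly_Mapping.single (Poly_Mapping.single v 1) 1) = g (Poly_Mapping.single (Poly_Mapping.single v 1) 1)"
  shows "f P = g P"
proof (induction P rule: poly_induct)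
  case (single M c)
  show ?case
    unfolding single_eq_mon[of M c] using assms
    by (simp only: ringmap_mult ringmap_mon)
qed (simp_all add: ringmap_simps f g)

lemma ringmap_int_poly_eqI:
  fixes f g :: "'v int_poly \<Rightarrow> 'd::comm_ring_1"
  assumes f: "ringmap f" and g: "ringmap g" and "\<And>v. f (var v) = g (var v)"
  shows "f P = g P"
proof (rule ringmap_poly_eqI[OF f g])
  fix c
  have "(Poly_Mapping.single 0 c :: 'v int_poly) = of_int c"
    by (metis single_of_int of_int_eq_id id_apply)
  then show "f (Poly_Mapping.single 0 c) = g (Poly_Mapping.single 0 c)"
    using ringmap_of_int[OF f, of c] ringmap_of_int[OF g, of c] by metis
qed (use assms(3) in \<open>simp add: var_def\<close>)

lemma ringmap_eval_poly_at: "ringmap (\<lambda>P. eval_poly_at P g)"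
  unfolding eval_poly_at_eq by (rule ringmap_peval[OF ringmap_of_int_self])

lemma eval_var [simp]: "eval_poly_at (var v) g = g v"
  by (simp add: eval_poly_at_eq var_def peval_single)

lemma ringmap_eval_poly_at_comp:
  assumes "ringmap h" shows "h (eval_poly_at P g) = eval_poly_at P (\<lambda>v. h (g v))"
  by (rule ringmap_int_poly_eqI[of "\<lambda>P. h (eval_poly_at P g)"])
     (simp_all add: ringmap_comp[OF assms ringmap_eval_poly_at] ringmap_eval_poly_at)

lemma int_poly_torsion_free:
  fixes P :: "'v int_poly"
  assumes "of_nat n * P = of_nat n * Q" "n > 0" shows "P = Q"
proof (rule poly_mapping_eqI)
  fix k
  have "of_nat n * P = Poly_Mapping.map ((*) (int n)) P" for P :: "'v int_poly"
    by (simp add: mult_map_scale_conv_mult)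
  then have "Poly_Mapping.map ((*) (int n)) P = Poly_Mapping.map ((*) (int n)) Q" using assms(1) by metis
  then have "Poly_Mapping.lookup (Poly_Mapping.map ((*) (int n)) P) k = Poly_Mapping.lookup (Poly_Mapping.map ((*) (int n)) Q) k" by simp
  then show "Poly_Mapping.lookup P k = Poly_Mapping.lookup Q k"
    using assms(2) by (auto simp: Poly_Mapping.map.rep_eq when_def split: if_splits)
qed

lemma int_poly_map_div:
  fixes P :: "'v int_poly"
  assumes "n > 0" shows "Poly_Mapping.map (\<lambda>c. c div int n) (of_nat n * P) = P"
proof (rule poly_mapping_eqI)
  fix k
  have "of_nat n * P = Poly_Mapping.map ((*) (int n)) P"
    by (simp add: mult_map_scale_conv_mult)
  then show "Poly_Mapping.lookup (Poly_Mapping.map (\<lambda>c. c div int n) (of_nat n * P)) k = Poly_Mapping.lookup P k"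
    using assms by (auto simp: Poly_Mapping.map.rep_eq when_def)
qed

section \<open>Witt vectors over commutative rings\<close>

text \<open>The remainder is kept in the form \<open>p a b w\<close>, so that a factor \<open>b\<close> that is divisible by \<open>p\<close>, or
  in the image of the Verschiebung, is not lost.\<close>

lemma prime_add_power:
  fixes a b :: "'a::comm_ring_1"
  assumes "Factorial_Ring.prime p"
  shows "\<exists>w. (a + b) ^ p = a ^ p + b ^ p + of_nat p * a * b * w"
proof -
  have p: "p > 1" using assms prime_gt_1_nat by auto
  let ?w = "\<Sum>k\<in>{1..<p}. of_nat ((p choose k) div p) * a ^ (k - 1) * b ^ (p - k - 1)"
  have split: "{..p} = insert 0 (insert p {1..<p})" using p by auto
  have "(a + b) ^ p = (\<Sum>k\<le>p. of_nat (p choose k) * a ^ k * b ^ (p - k))"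
    by (rule binomial_ring)
  also have "\<dots> = b ^ p + a ^ p + (\<Sum>k\<in>{1..<p}. of_nat (p choose k) * a ^ k * b ^ (p - k))"
    unfolding split using p by simp
  also have "(\<Sum>k\<in>{1..<p}. of_nat (p choose k) * a ^ k * b ^ (p - k)) = of_nat p * a * b * ?w"
    unfolding sum_distrib_left
  proof (rule sum.cong)
    fix k assume k: "k \<in> {1..<p}"
    then have "p dvd (p choose k)"
      using assms by (intro dvd_choose_prime) auto
    then have "of_nat (p choose k) = (of_nat p * of_nat ((p choose k) div p) :: 'a)"
      by (metis dvd_mult_div_cancel of_nat_mult)
    moreover have "a ^ k = a * a ^ (k - 1)" "b ^ (p - k) = b * b ^ (p - k - 1)"
      using k by (simp_all flip: power_Suc add: Suc_diff_Suc)
    ultimately show "of_nat (p choose k) * a ^ k * b ^ (p - k) =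
        of_nat p * a * b * (of_nat ((p choose k) div p) * a ^ (k - 1) * b ^ (p - k - 1))"
      by (simp add: algebra_simps)
  qed simp
  finally show ?thesis by (intro exI[of _ ?w]) (simp add: algebra_simps)
qed

lemma power_prime_cong:
  fixes a b :: "'a::comm_ring_1"
  assumes "Factorial_Ring.prime p" "of_nat p ^ Suc k dvd a - b"
  shows "of_nat p ^ Suc (Suc k) dvd a ^ p - b ^ p"
proof -
  obtain z where z: "a = b + of_nat p ^ Suc k * z"
    using assms(2) by (metis add_diff_cancel_left' diff_add_cancel dvdE add.commute)
  obtain w where w: "a ^ p = b ^ p + (of_nat p ^ Suc k * z) ^ p + of_nat p * b * (of_nat p ^ Suc k * z) * w"
    using prime_add_power[OF assms(1)] z by metis
  have "2 \<le> p" using assms(1) prime_ge_2_nat by auto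
  then have "Suc (Suc k) \<le> Suc k * p"
    using mult_le_mono2[of 2 p "Suc k"] by simp
  then have "(of_nat p :: 'a) ^ Suc (Suc k) dvd (of_nat p ^ Suc k * z) ^ p"
    by (simp add: power_mult_distrib flip: power_mult del: power_Suc mult_Suc) (simp add: le_imp_power_dvd del: power_Suc mult_Suc)
  moreover have "of_nat p * b * (of_nat p ^ Suc k * z) * w = of_nat p ^ Suc (Suc k) * (b * z * w)"
    by (simp add: algebra_simps)
  ultimately show ?thesis unfolding w by (simp add: algebra_simps)
qed

lemma power_prime_power_cong:
  fixes a b :: "'a::comm_ring_1"
  assumes "Factorial_Ring.prime p" "of_nat p dvd a - b"
  shows "of_nat p ^ Suc k dvd a ^ (p ^ k) - b ^ (p ^ k)"
proof (induction k)
  case (Suc k)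
  then show ?case
    using power_prime_cong[OF assms(1) Suc] by (simp add: mult.commute flip: power_mult)
qed (use assms in auto)

text \<open>Raising to the power \<open>p\<close> improves a congruence by one power of \<open>p\<close>, and in the \<open>i\<close>-th term the
  factor \<open>p^i\<close> makes up for the missing \<open>i\<close> steps.\<close>

lemma ghost_cong:
  fixes x y :: "nat \<Rightarrow> 'a::comm_ring_1"
  assumes "Factorial_Ring.prime p" "\<And>i. i \<le> n \<Longrightarrow> of_nat p dvd x i - y i"
  shows "of_nat p ^ Suc n dvd ghost p n x - ghost p n y"
proof -
  have "of_nat p ^ Suc n dvd of_nat p ^ i * (x i ^ (p ^ (n - i)) - y i ^ (p ^ (n - i)))" if "i \<le> n" for i
  proof -
    have "of_nat p ^ i * of_nat p ^ Suc (n - i) dvd of_nat p ^ i * (x i ^ (p ^ (n - i)) - y i ^ (p ^ (n - i)))"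
      using power_prime_power_cong[OF assms(1) assms(2)[OF that]] by (rule mult_dvd_mono[OF dvd_refl])
    moreover have "(of_nat p :: 'a) ^ i * of_nat p ^ Suc (n - i) = of_nat p ^ Suc n"
      using that by (simp flip: power_add power_Suc)
    ultimately show ?thesis by simp
  qed
  then show ?thesis
    unfolding ghost_def by (auto simp flip: sum_subtractf right_diff_distrib intro!: dvd_sum)
qed

lemma ghost_0 [simp]: "ghost p 0 x = x 0"
  by (simp add: ghost_def)

lemma ghost_Suc: "ghost p (Suc n) x = ghost p n (\<lambda>i. x i ^ p) + of_nat p ^ Suc n * x (Suc n)"
  unfolding ghost_def
  by (auto simp: Suc_diff_le simp flip: power_mult intro!: sum.cong)

lemma ghost_split: "ghost p n x = (\<Sum>i<n. of_nat p ^ i * x i ^ (p ^ (n - i))) + of_nat p ^ n * x n"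
  by (simp add: ghost_def flip: lessThan_Suc_atMost)

lemma ghost_ringmap: "ringmap h \<Longrightarrow> h (ghost p n x) = ghost p n (\<lambda>i. h (x i))"
  by (simp add: ghost_def ringmap_simps)

lemma ghost_inj:
  fixes x y :: "nat \<Rightarrow> 'v int_poly"
  assumes "p > 0" "\<And>n. ghost p n x = ghost p n y"
  shows "x = y"
proof
  fix n show "x n = y n"
  proof (induction n rule: less_induct)
    case (less n)
    have "of_nat p ^ n * x n = of_nat p ^ n * y n"
      using assms(2)[of n] less by (simp add: ghost_split)
    then have "of_nat (p ^ n) * x n = of_nat (p ^ n) * y n" by simp
    then show ?case by (rule int_poly_torsion_free) (use assms in simp)
  qed
qed

subsection \<open>Dwork's lemma\<close>

text \<open>A lift of the Frobenius to characteristic \<open>0\<close>; it replaces the \<open>p\<close>-th power in Dwork's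
  congruences.\<close>

definition frob :: "nat \<Rightarrow> 'v int_poly \<Rightarrow> 'v int_poly" where
  "frob p P = eval_poly_at P (\<lambda>v. var v ^ p)"

lemma ringmap_frob: "ringmap (frob p)"
  unfolding frob_def by (rule ringmap_eval_poly_at)

lemma frob_cong:
  assumes p: "Factorial_Ring.prime p"
  shows "of_nat p dvd frob p P - P ^ p"
proof -
  let ?ok = "\<lambda>P :: 'v int_poly. of_nat p dvd frob p P - P ^ p"
  have add: "?ok (P + Q)" if "?ok P" "?ok Q" for P Q
  proof -
    obtain w where w: "(P + Q) ^ p = P ^ p + Q ^ p + of_nat p * P * Q * w"
      using prime_add_power[OF p] by blast
    have "frob p (P + Q) - (P + Q) ^ p = (frob p P - P ^ p) + (frob p Q - Q ^ p) + of_nat p * (- P * Q * w)"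
      by (simp add: w ringmap_add[OF ringmap_frob] algebra_simps)
    then show ?thesis using that by (metis dvd_add dvd_triv_left)
  qed
  have mult: "?ok (P * Q)" if "?ok P" "?ok Q" for P Q
  proof -
    have "frob p (P * Q) - (P * Q) ^ p = (frob p P - P ^ p) * frob p Q + P ^ p * (frob p Q - Q ^ p)"
      by (simp add: ringmap_mult[OF ringmap_frob] power_mult_distrib algebra_simps)
    then show ?thesis using that by (metis dvd_add dvd_mult dvd_mult2)
  qed
  have p2: "p \<ge> 2" using p prime_ge_2_nat by auto
  have "?ok 0" using p2 by (simp add: ringmap_zero[OF ringmap_frob] zero_power)
  have one: "?ok 1" by (simp add: ringmap_one[OF ringmap_frob])
  have neg: "?ok (-1)"
  proof (cases "odd p")
    case True then show ?thesis by (simp add: ringmap_simps[OF ringmap_frob])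
  next
    case False
    then have "p = 2" using p prime_odd_nat p2 by force
    then show ?thesis by (simp add: ringmap_simps[OF ringmap_frob])
  qed
  have one': "?ok 1" using one by simp
  have nat: "?ok (of_nat n)" for n
  proof (induction n)
    case (Suc n)
    show ?case unfolding of_nat_Suc by (rule add[OF one' Suc])
  qed (use \<open>?ok 0\<close> in simp)
  have int: "?ok (of_int c)" for c
  proof (cases c)
    case (neg n)
    have "of_int c = (-1) * (of_nat (Suc n) :: 'v int_poly)"
      using neg by simp
    then show ?thesis using mult[OF \<open>?ok (-1)\<close> nat[of "Suc n"]] by metis
  qed (use nat in simp)
  have var: "?ok (var v)" for v by (simp add: frob_def)
  have "?ok (\<Prod>v\<in>S. var v ^ f v)" for S and f :: "'v \<Rightarrow> nat"
  proof (induction S rule: infinite_finite_induct)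
    case (insert v S)
    have "?ok (var v ^ n)" for n
    proof (induction n)
      case (Suc n)
      show ?case unfolding power_Suc by (rule mult[OF var Suc])
    qed (use one in simp)
    from mult[OF this insert(3)] show ?case using insert by simp
  qed (use one in auto)
  then have mono: "?ok (mon (\<lambda>v. Poly_Mapping.single (Poly_Mapping.single v 1) 1) M)" for M
    unfolding mon_def var_def .
  show "?ok P"
  proof (induction P rule: poly_induct)
    case (single M c)
    have "(Poly_Mapping.single 0 c :: 'v int_poly) = of_int c"
      by (metis single_of_int of_int_eq_id id_apply)
    then show ?case
      using mult[OF int[of c] mono[of M]] single_eq_mon[of M c] by metis
  qed (use \<open>?ok 0\<close> add in auto)
qed

text \<open>The recursive solution \<open>x\<close> of \<open>ghost p n x = g n\<close>. It makes sense for every \<open>g\<close>, but the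
  coefficientwise division is exact only under the congruences of Dwork's lemma.\<close>

function dwork :: "nat \<Rightarrow> (nat \<Rightarrow> 'v int_poly) \<Rightarrow> nat \<Rightarrow> 'v int_poly" where
  "dwork p g n = Poly_Mapping.map (\<lambda>c. c div int p ^ n)
     (g n - (\<Sum>i<n. of_nat p ^ i * dwork p g i ^ (p ^ (n - i))))"
  by pat_completeness auto
termination by (relation "measure (\<lambda>(p, g, n). n)") auto

declare dwork.simps [simp del]

text \<open>Since \<open>frob\<close> commutes with \<open>ghost\<close> and is congruent to the \<open>p\<close>-th power, the assumption says
  that \<open>g (Suc n)\<close> agrees modulo \<open>p^(n+1)\<close> with the part of the ghost component that is already
  determined.\<close>

lemma ghost_dwork:
  fixes g :: "nat \<Rightarrow> 'v int_poly"
  assumes p: "Factorial_Ring.prime p"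
    and g: "\<And>n. of_nat p ^ Suc n dvd g (Suc n) - frob p (g n)"
  shows "ghost p n (dwork p g) = g n"
proof (induction n rule: less_induct)
  case (less n)
  let ?x = "dwork p g"
  let ?s = "\<Sum>i<n. of_nat p ^ i * ?x i ^ (p ^ (n - i))"
  have "of_nat p ^ n dvd g n - ?s"
  proof (cases n)
    case (Suc m)
    have "?s = ghost p m (\<lambda>i. ?x i ^ p)"
      using ghost_Suc[of p m ?x] ghost_split[of p n ?x] Suc by simp
    moreover have "frob p (g m) = ghost p m (\<lambda>i. frob p (?x i))"
      using less[of m] Suc ghost_ringmap[OF ringmap_frob[of p], of p m ?x] by simp
    moreover have "of_nat p ^ Suc m dvd ghost p m (\<lambda>i. frob p (?x i)) - ghost p m (\<lambda>i. ?x i ^ p)"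
      by (rule ghost_cong[OF p frob_cong[OF p]])
    ultimately show ?thesis
      using dvd_add[OF g[of m]] Suc by fastforce
  qed simp
  then obtain q where q: "g n - ?s = of_nat p ^ n * q" by blast
  have "?x n = Poly_Mapping.map (\<lambda>c. c div int p ^ n) (of_nat (p ^ n) * q)"
    by (subst dwork.simps) (simp add: q)
  also have "\<dots> = q"
    using int_poly_map_div[of "p ^ n" q] p by (simp add: prime_gt_0_nat)
  finally show ?case using q by (simp add: ghost_split[of p n ?x] algebra_simps)
qed

text \<open>Ghost sequences of variables satisfy Dwork's congruences, and these are inherited by sums and
  products; so the divisions in the definition of the structure polynomials are exact.\<close>

lemma ghost_witt_poly:
  assumes p: "Factorial_Ring.prime p" and "\<Phi> = (+) \<or> \<Phi> = (*)"
  shows "ghost p n (witt_poly p \<Phi>) = \<Phi> (ghost p n (\<lambda>i. var (Inl i))) (ghost p n (\<lambda>i. var (Inr i)))"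
proof -
  let ?g = "\<lambda>n. \<Phi> (ghost p n (\<lambda>i. var (Inl i))) (ghost p n (\<lambda>i. var (Inr i))) :: (nat + nat) int_poly"
  have "witt_poly p \<Phi> n = dwork p ?g n" for n
  proof (induction n rule: less_induct)
    case (less n)
    have "(\<Sum>i<n. of_nat p ^ i * witt_poly p \<Phi> i ^ (p ^ (n - i))) =
        (\<Sum>i<n. of_nat p ^ i * dwork p ?g i ^ (p ^ (n - i)))"
      using less by (intro sum.cong) simp_all
    then show ?case by (subst witt_poly.simps, subst dwork.simps) (simp only:)
  qed
  then have eq: "witt_poly p \<Phi> = dwork p ?g" by auto
  have v: "\<exists>c. ghost p (Suc m) (\<lambda>i. var (f i)) = frob p (ghost p m (\<lambda>i. var (f i))) + of_nat p ^ Suc m * (c :: (nat + nat) int_poly)" for m and f :: "nat \<Rightarrow> nat + nat"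
    by (rule exI[of _ "var (f (Suc m))"])
       (simp add: ghost_Suc ghost_ringmap[OF ringmap_frob], simp add: frob_def)
  have "of_nat p ^ Suc m dvd ?g (Suc m) - frob p (?g m)" for m
  proof -
    obtain c d where cd: "ghost p (Suc m) (\<lambda>i. var (Inl i)) = frob p (ghost p m (\<lambda>i. var (Inl i))) + of_nat p ^ Suc m * (c :: (nat + nat) int_poly)"
      "ghost p (Suc m) (\<lambda>i. var (Inr i)) = frob p (ghost p m (\<lambda>i. var (Inr i))) + of_nat p ^ Suc m * (d :: (nat + nat) int_poly)"
      using v by blast
    from assms(2) show ?thesis
    proof
      assume [simp]: "\<Phi> = (+)"
      have "?g (Suc m) - frob p (?g m) = of_nat p ^ Suc m * (c + d)"
        unfolding \<open>\<Phi> = (+)\<close> cd ringmap_add[OF ringmap_frob] by (simp add: algebra_simps)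
      then show ?thesis by (metis dvd_triv_left)
    next
      assume [simp]: "\<Phi> = (*)"
      have "?g (Suc m) - frob p (?g m) = of_nat p ^ Suc m * (frob p (ghost p m (\<lambda>i. var (Inl i))) * d + c * frob p (ghost p m (\<lambda>i. var (Inr i))) + c * d * of_nat p ^ Suc m)"
        unfolding \<open>\<Phi> = (*)\<close> cd ringmap_mult[OF ringmap_frob] by (simp add: algebra_simps)
      then show ?thesis by (metis dvd_triv_left)
    qed
  qed
  then show ?thesis unfolding eq by (rule ghost_dwork[OF p])
qed

subsection \<open>The operations on sequences\<close>

text \<open>The counterpart of \<open>witt_op\<close> for infinite sequences. The prime \<open>p\<close> is not tied to the
  characteristic, since the identities are to be checked over the integers.\<close>

definition wop :: "nat \<Rightarrow> ((nat + nat) int_poly \<Rightarrow> (nat + nat) int_poly \<Rightarrow> (nat + nat) int_poly)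
    \<Rightarrow> (nat \<Rightarrow> 'a::comm_ring_1) \<Rightarrow> (nat \<Rightarrow> 'a) \<Rightarrow> nat \<Rightarrow> 'a" where
  "wop p \<Phi> x y n = eval_poly_at (witt_poly p \<Phi> n) (case_sum x y)"

lemma wop_ringmap:
  assumes "ringmap h" shows "wop p \<Phi> (\<lambda>i. h (x i)) (\<lambda>i. h (y i)) = (\<lambda>n. h (wop p \<Phi> x y n))"
proof
  fix n
  have "(case_sum (\<lambda>i. h (x i)) (\<lambda>i. h (y i))) = (\<lambda>v. h (case_sum x y v))"
    by (auto split: sum.split)
  then show "wop p \<Phi> (\<lambda>i. h (x i)) (\<lambda>i. h (y i)) n = h (wop p \<Phi> x y n)"
    unfolding wop_def by (simp add: ringmap_eval_poly_at_comp[OF assms])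
qed

lemma ghost_wop_add:
  assumes "Factorial_Ring.prime p"
  shows "ghost p n (wop p (+) x y) = ghost p n x + ghost p n y"
proof -
  have "ghost p n (wop p (+) x y) = eval_poly_at (ghost p n (witt_poly p (+))) (case_sum x y)"
    unfolding wop_def by (simp add: ghost_ringmap[OF ringmap_eval_poly_at])
  then show ?thesis
    using ghost_witt_poly[OF assms, of "(+)" n]
    by (simp add: ringmap_add[OF ringmap_eval_poly_at] ghost_ringmap[OF ringmap_eval_poly_at])
qed

lemma ghost_wop_mult:
  assumes "Factorial_Ring.prime p"
  shows "ghost p n (wop p (*) x y) = ghost p n x * ghost p n y"
proof -
  have "ghost p n (wop p (*) x y) = eval_poly_at (ghost p n (witt_poly p (*))) (case_sum x y)"
    unfolding wop_def by (simp add: ghost_ringmap[OF ringmap_eval_poly_at])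
  then show ?thesis
    using ghost_witt_poly[OF assms, of "(*)" n]
    by (simp add: ringmap_mult[OF ringmap_eval_poly_at] ghost_ringmap[OF ringmap_eval_poly_at])
qed

text \<open>With naturality (\<open>wop_ringmap\<close>) this reduces every identity between Witt vector operations to
  polynomials over the integers, where the ghost components determine a sequence (\<open>ghost_inj\<close>).\<close>

lemma universal_sequence:
  fixes x :: "nat \<Rightarrow> 'a::comm_ring_1"
  shows "\<exists>u :: nat \<Rightarrow> 'a int_poly. x = (\<lambda>i. eval_poly_at (u i) (\<lambda>v. v))"
  by (rule exI[of _ "\<lambda>i. var (x i)"]) simp

text \<open>A prime for every type, so that the Witt vectors over a commutative ring form a type of class
  \<open>comm_ring_1\<close> without further data. The value \<open>2\<close> is a default for characteristics that are not
  prime.\<close>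

definition wprime :: "'a::comm_ring_1 itself \<Rightarrow> nat" where
  "wprime _ = (if Factorial_Ring.prime CHAR('a) then CHAR('a) else 2)"

lemma prime_wprime: "Factorial_Ring.prime (wprime T)"
  by (simp add: wprime_def)

lemma wop_0:
  assumes "Factorial_Ring.prime p"
  shows "wop p (+) x y 0 = x 0 + y 0" "wop p (*) x y 0 = x 0 * y 0"
  using ghost_wop_add[OF assms, of 0 x y] ghost_wop_mult[OF assms, of 0 x y] by simp_all

text \<open>Over a ring without \<open>p\<close>-torsion this converse of \<open>ghost_cong\<close> allows components to be computed
  modulo \<open>p\<close> from ghost components, hence exactly in characteristic \<open>p\<close>.\<close>

lemma ghost_cong_conv:
  fixes x y :: "nat \<Rightarrow> 'v int_poly"
  assumes p: "Factorial_Ring.prime p" and g: "\<And>n. of_nat p ^ Suc n dvd ghost p n x - ghost p n y"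
  shows "of_nat p dvd x n - y n"
proof (induction n rule: less_induct)
  case (less n)
  let ?s = "\<lambda>x :: nat \<Rightarrow> 'v int_poly. \<Sum>i<n. of_nat p ^ i * x i ^ (p ^ (n - i))"
  have "of_nat p ^ Suc n dvd ?s x - ?s y"
  proof (cases n)
    case (Suc m)
    have s: "?s x = ghost p m (\<lambda>i. x i ^ p)" for x :: "nat \<Rightarrow> 'v int_poly"
      using ghost_Suc[of p m x] ghost_split[of p n x] Suc by simp
    have "of_nat p ^ Suc n dvd of_nat p ^ i * (x i ^ (p ^ (n - i)) - y i ^ (p ^ (n - i)))" if "i < n" for i
    proof -
      have "of_nat p ^ i * of_nat p ^ Suc (n - i) dvd of_nat p ^ i * (x i ^ (p ^ (n - i)) - y i ^ (p ^ (n - i)))"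
        using power_prime_power_cong[OF p less[OF that]] by (rule mult_dvd_mono[OF dvd_refl])
      moreover have "(of_nat p :: 'v int_poly) ^ i * of_nat p ^ Suc (n - i) = of_nat p ^ Suc n"
        using that by (simp flip: power_add power_Suc)
      ultimately show ?thesis by simp
    qed
    then show ?thesis
      by (auto simp flip: sum_subtractf right_diff_distrib intro!: dvd_sum)
  qed simp
  then have "of_nat p ^ Suc n dvd (ghost p n x - ghost p n y) - (?s x - ?s y)"
    using g by (rule dvd_diff[rotated])
  also have "(ghost p n x - ghost p n y) - (?s x - ?s y) = of_nat p ^ n * (x n - y n)"
    by (simp add: ghost_split algebra_simps)
  finally obtain q where "of_nat p ^ n * (x n - y n) = of_nat p ^ Suc n * q" by blast
  then have "of_nat (p ^ n) * (x n - y n) = of_nat (p ^ n) * (of_nat p * q)"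
    by (simp add: algebra_simps)
  then have "x n - y n = of_nat p * q"
    by (rule int_poly_torsion_free) (use p in \<open>simp add: prime_gt_0_nat\<close>)
  then show ?case by simp
qed

text \<open>The four sequences below are best understood by their ghost components \<open>x^(p^n)\<close>,
  \<open>p w_(n-1)(x)\<close>, \<open>c\<close> and \<open>w_(n+1)(x)\<close>: they give the Teichmueller representatives, the
  Verschiebung, the integers and the Frobenius.\<close>

definition tseq :: "'a::comm_ring_1 \<Rightarrow> nat \<Rightarrow> 'a" where
  "tseq x i = (if i = 0 then x else 0)"

definition vseq :: "(nat \<Rightarrow> 'a::comm_ring_1) \<Rightarrow> nat \<Rightarrow> 'a" where
  "vseq x i = (case i of 0 \<Rightarrow> 0 | Suc j \<Rightarrow> x j)"

definition cseq :: "nat \<Rightarrow> int \<Rightarrow> nat \<Rightarrow> 'a::comm_ring_1" where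
  "cseq p c n = eval_poly_at (dwork p (\<lambda>_. of_int c :: nat int_poly) n) (\<lambda>_. 0)"

definition fseq :: "nat \<Rightarrow> (nat \<Rightarrow> 'a::comm_ring_1) \<Rightarrow> nat \<Rightarrow> 'a" where
  "fseq p x n = eval_poly_at (dwork p (\<lambda>n. ghost p (Suc n) var) n) x"

lemma ghost_tseq: "p > 0 \<Longrightarrow> ghost p n (tseq x) = x ^ (p ^ n)"
  by (induction n) (simp_all add: ghost_def tseq_def zero_power if_distrib sum.atMost_shift cong: if_cong)

lemma ghost_vseq_Suc: "ghost p (Suc n) (vseq x) = of_nat p * ghost p n x"
  if "p > 0"
  using that
  by (simp add: ghost_def vseq_def sum.atMost_Suc_shift sum_distrib_left zero_power mult.assoc del: sum.atMost_Suc)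

lemma vseq_0 [simp]: "vseq x 0 = 0" and vseq_Suc [simp]: "vseq x (Suc n) = x n"
  by (simp_all add: vseq_def)

lemma ghost_zero: "p > 0 \<Longrightarrow> ghost p n (\<lambda>_. 0) = 0"
  by (simp add: ghost_def zero_power)

lemma ghost_cseq:
  assumes "Factorial_Ring.prime p" shows "ghost p n (cseq p c) = of_int c"
proof -
  have "ghost p n (dwork p (\<lambda>_. of_int c :: nat int_poly)) = of_int c"
    by (rule ghost_dwork[OF assms]) (simp add: ringmap_of_int[OF ringmap_frob])
  then show ?thesis
    unfolding cseq_def
    by (simp add: ringmap_of_int[OF ringmap_eval_poly_at] flip: ghost_ringmap[OF ringmap_eval_poly_at])
qed

lemma ghost_fseq:
  assumes "Factorial_Ring.prime p" shows "ghost p n (fseq p x) = ghost p (Suc n) x"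
proof -
  have "ghost p n (dwork p (\<lambda>n. ghost p (Suc n) var)) = ghost p (Suc n) (var :: nat \<Rightarrow> nat int_poly)"
  proof (rule ghost_dwork[OF assms])
    fix n
    have "ghost p (Suc (Suc n)) var - frob p (ghost p (Suc n) var) = of_nat p ^ Suc (Suc n) * (var (Suc (Suc n)) :: nat int_poly)"
      by (subst ghost_Suc) (simp add: ghost_ringmap[OF ringmap_frob], simp add: frob_def)
    then have "of_nat p ^ Suc (Suc n) dvd ghost p (Suc (Suc n)) var - frob p (ghost p (Suc n) var :: nat int_poly)"
      by (metis dvd_triv_left)
    then show "of_nat p ^ Suc n dvd ghost p (Suc (Suc n)) var - frob p (ghost p (Suc n) var :: nat int_poly)"
      by (metis dvd_trans le_imp_power_dvd le_SucI le_refl)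
  qed
  then show ?thesis
    unfolding fseq_def
    by (simp flip: ghost_ringmap[OF ringmap_eval_poly_at]) (simp add: ghost_ringmap[OF ringmap_eval_poly_at])
qed

lemma fseq_cong:
  fixes x :: "nat \<Rightarrow> 'v int_poly"
  assumes "Factorial_Ring.prime p" shows "of_nat p dvd fseq p x n - x n ^ p"
  by (rule ghost_cong_conv[OF assms]) (simp add: ghost_fseq[OF assms] ghost_Suc)

typedef 'a witt = "UNIV :: (nat \<Rightarrow> 'a) set" morphisms wcomp mkW ..

setup_lifting type_definition_witt

lemma wcomp_mkW [simp]: "wcomp (mkW f) = f"
  by (simp add: mkW_inverse)

lemma witt_eqI: "(\<And>n. wcomp x n = wcomp y n) \<Longrightarrow> x = y"
  by (metis ext wcomp_inject)

abbreviation poly_id :: "'a::comm_ring_1 int_poly \<Rightarrow> 'a" where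
  "poly_id P \<equiv> eval_poly_at P (\<lambda>v. v)"

lemmas wop_eval = wop_ringmap[OF ringmap_eval_poly_at]

lemma tseq_eval: "tseq (eval_poly_at P g) = (\<lambda>n. eval_poly_at (tseq P n) g)"
  by (auto simp: tseq_def ringmap_zero[OF ringmap_eval_poly_at])

lemma tseq_one_eval: "tseq 1 = (\<lambda>n. eval_poly_at (tseq 1 n) g)"
  by (auto simp: tseq_def ringmap_zero[OF ringmap_eval_poly_at] ringmap_one[OF ringmap_eval_poly_at])

lemma zero_eval: "(\<lambda>_. 0) = (\<lambda>n. eval_poly_at 0 g)"
  by (simp add: ringmap_zero[OF ringmap_eval_poly_at])

lemma vseq_eval: "vseq (\<lambda>i. eval_poly_at (x i) g) = (\<lambda>n. eval_poly_at (vseq x n) g)"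
  by (auto simp: vseq_def ringmap_zero[OF ringmap_eval_poly_at] split: nat.split)

lemma cseq_eval: "cseq p c = (\<lambda>n. eval_poly_at (cseq p c n) g)"
  by (rule ext) (simp add: cseq_def ringmap_eval_poly_at_comp[OF ringmap_eval_poly_at] ringmap_zero[OF ringmap_eval_poly_at])

lemma wop_commute:
  assumes p: "Factorial_Ring.prime p" and P: "\<Phi> = (+) \<or> \<Phi> = (*)"
  shows "wop p \<Phi> x y = wop p \<Phi> y x"
proof -
  obtain u v where uv: "x = (\<lambda>i. poly_id (u i))" "y = (\<lambda>i. poly_id (v i))"
    using universal_sequence by metis
  have "wop p \<Phi> u v = wop p \<Phi> v u"
    using P by (intro ghost_inj[of p]) (auto simp: prime_gt_0_nat[OF p] ghost_wop_add[OF p] ghost_wop_mult[OF p])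
  then show ?thesis by (simp add: uv wop_eval)
qed

lemma wop_assoc:
  assumes p: "Factorial_Ring.prime p" and P: "\<Phi> = (+) \<or> \<Phi> = (*)"
  shows "wop p \<Phi> (wop p \<Phi> x y) z = wop p \<Phi> x (wop p \<Phi> y z)"
proof -
  obtain u v w where uv: "x = (\<lambda>i. poly_id (u i))" "y = (\<lambda>i. poly_id (v i))" "z = (\<lambda>i. poly_id (w i))"
    using universal_sequence by metis
  have "wop p \<Phi> (wop p \<Phi> u v) w = wop p \<Phi> u (wop p \<Phi> v w)"
    using P by (intro ghost_inj[of p]) (auto simp: prime_gt_0_nat[OF p] ghost_wop_add[OF p] ghost_wop_mult[OF p] algebra_simps)
  then show ?thesis by (simp add: uv wop_eval)
qed

lemma wop_distrib:
  assumes p: "Factorial_Ring.prime p"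
  shows "wop p (*) (wop p (+) x y) z = wop p (+) (wop p (*) x z) (wop p (*) y z)"
proof -
  obtain u v w where uv: "x = (\<lambda>i. poly_id (u i))" "y = (\<lambda>i. poly_id (v i))" "z = (\<lambda>i. poly_id (w i))"
    using universal_sequence by metis
  have "wop p (*) (wop p (+) u v) w = wop p (+) (wop p (*) u w) (wop p (*) v w)"
    by (intro ghost_inj[of p]) (auto simp: prime_gt_0_nat[OF p] ghost_wop_add[OF p] ghost_wop_mult[OF p] algebra_simps)
  then show ?thesis by (simp add: uv wop_eval)
qed

lemma wop_zero:
  assumes p: "Factorial_Ring.prime p"
  shows "wop p (+) (\<lambda>_. 0) x = x"
proof -
  obtain u where u: "x = (\<lambda>i. poly_id (u i))"
    using universal_sequence by metis
  have "wop p (+) (\<lambda>_. 0) u = u"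
    by (intro ghost_inj[of p]) (auto simp: prime_gt_0_nat[OF p] ghost_wop_add[OF p] ghost_zero)
  then show ?thesis unfolding u by (subst zero_eval[of "\<lambda>v. v"]) (simp only: wop_eval)
qed

lemma wop_one:
  assumes p: "Factorial_Ring.prime p"
  shows "wop p (*) (tseq 1) x = x"
proof -
  obtain u where u: "x = (\<lambda>i. poly_id (u i))"
    using universal_sequence by metis
  have "wop p (*) (tseq 1) u = u"
    by (intro ghost_inj[of p]) (auto simp: prime_gt_0_nat[OF p] ghost_wop_mult[OF p] ghost_tseq)
  then show ?thesis unfolding u by (subst tseq_one_eval[of "\<lambda>v. v"]) (simp only: wop_eval)
qed

lemma wop_neg:
  assumes p: "Factorial_Ring.prime p"
  shows "wop p (+) (wop p (*) (cseq p (-1)) x) x = (\<lambda>_. 0)"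
proof -
  obtain u where u: "x = (\<lambda>i. poly_id (u i))"
    using universal_sequence by metis
  have "wop p (+) (wop p (*) (cseq p (-1)) u) u = (\<lambda>_. 0)"
    by (intro ghost_inj[of p])
       (auto simp: prime_gt_0_nat[OF p] ghost_wop_add[OF p] ghost_wop_mult[OF p] ghost_cseq[OF p] ghost_zero)
  then show ?thesis
    unfolding u
    by (subst cseq_eval[of _ _ "\<lambda>v. v"]) (simp add: wop_eval ringmap_zero[OF ringmap_eval_poly_at])
qed

text \<open>Negation is multiplication by the Witt vector of the integer \<open>-1\<close>; it is not componentwise for
  \<open>p = 2\<close>.\<close>

instantiation witt :: (comm_ring_1) comm_ring_1
begin

lift_definition zero_witt :: "'a witt" is "\<lambda>_. 0" .
lift_definition one_witt :: "'a witt" is "tseq 1" .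
lift_definition plus_witt :: "'a witt \<Rightarrow> 'a witt \<Rightarrow> 'a witt" is "wop (wprime TYPE('a)) (+)" .
lift_definition times_witt :: "'a witt \<Rightarrow> 'a witt \<Rightarrow> 'a witt" is "wop (wprime TYPE('a)) (*)" .
lift_definition uminus_witt :: "'a witt \<Rightarrow> 'a witt" is
  "wop (wprime TYPE('a)) (*) (cseq (wprime TYPE('a)) (-1))" .
definition minus_witt :: "'a witt \<Rightarrow> 'a witt \<Rightarrow> 'a witt" where "minus_witt a b = a + (- b)"

instance
proof
  fix a b c :: "'a witt"
  show "a + b + c = a + (b + c)" by transfer (simp add: wop_assoc prime_wprime)
  show "a + b = b + a" by transfer (simp add: wop_commute prime_wprime)
  show "0 + a = a" by transfer (simp add: wop_zero prime_wprime)
  show "- a + a = 0" by transfer (simp add: wop_neg prime_wprime)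
  show "a - b = a + - b" by (simp add: minus_witt_def)
  show "a * b * c = a * (b * c)" by transfer (simp add: wop_assoc prime_wprime)
  show "a * b = b * a" by transfer (simp add: wop_commute prime_wprime)
  show "1 * a = a" by transfer (simp add: wop_one prime_wprime)
  show "(a + b) * c = a * c + b * c" by transfer (simp add: wop_distrib prime_wprime)
  show "(0 :: 'a witt) \<noteq> 1" by transfer (auto simp: tseq_def fun_eq_iff)
qed

end

lift_definition verschiebung :: "'a::comm_ring_1 witt \<Rightarrow> 'a witt" is vseq .
lift_definition teich :: "'a::comm_ring_1 \<Rightarrow> 'a witt" is tseq .
lift_definition witt_tail :: "'a::comm_ring_1 witt \<Rightarrow> 'a witt" is "\<lambda>x i. x (Suc i)" .
lift_definition frobenius :: "'a::comm_ring_1 witt \<Rightarrow> 'a witt" is "\<lambda>x i. x i ^ wprime TYPE('a)" .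

lemma wcomp_zero [simp]: "wcomp 0 n = 0"
  by transfer simp
lemma wcomp_verschiebung_0 [simp]: "wcomp (verschiebung x) 0 = 0"
  by transfer simp
lemma wcomp_verschiebung_Suc [simp]: "wcomp (verschiebung x) (Suc n) = wcomp x n"
  by transfer simp
lemma wcomp_teich: "wcomp (teich x) n = (if n = 0 then x else 0)"
  by transfer (simp add: tseq_def)
lemma wcomp_witt_tail [simp]: "wcomp (witt_tail x) n = wcomp x (Suc n)"
  by transfer simp
lemma wcomp_frobenius: "wcomp (frobenius x) n = wcomp x n ^ wprime TYPE('a)" for x :: "'a::comm_ring_1 witt"
  by transfer simp

lemma teich_one [simp]: "teich 1 = 1"
  by transfer simp
lemma teich_zero [simp]: "teich 0 = 0"
  by (rule witt_eqI) (simp add: wcomp_teich)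

lemma verschiebung_add: "verschiebung (x + y) = verschiebung x + verschiebung y"
proof (transfer)
  fix x y :: "nat \<Rightarrow> 'a"
  let ?p = "wprime TYPE('a)"
  note p = prime_wprime[of "TYPE('a)"]
  obtain u v where uv: "x = (\<lambda>i. poly_id (u i))" "y = (\<lambda>i. poly_id (v i))"
    using universal_sequence by metis
  have "vseq (wop ?p (+) u v) = wop ?p (+) (vseq u) (vseq v)"
  proof (rule ghost_inj[of ?p])
    fix n show "ghost ?p n (vseq (wop ?p (+) u v)) = ghost ?p n (wop ?p (+) (vseq u) (vseq v))"
      by (cases n) (use prime_gt_0_nat[OF p] in \<open>simp_all add: ghost_wop_add[OF p] ghost_vseq_Suc wop_0[OF p] algebra_simps\<close>)
  qed (simp add: prime_gt_0_nat[OF p])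
  then show "vseq (wop ?p (+) x y) = wop ?p (+) (vseq x) (vseq y)"
    by (simp add: uv wop_eval vseq_eval)
qed

lemma verschiebung_zero [simp]: "verschiebung 0 = 0"
  using verschiebung_add[of 0 0] by simp

lemma verschiebung_uminus: "verschiebung (- x) = - verschiebung x"
  using verschiebung_add[of x "- x"] by (simp add: eq_neg_iff_add_eq_0 add.commute)

lemma verschiebung_diff: "verschiebung (x - y) = verschiebung x - verschiebung y"
  using verschiebung_add[of x "- y"] by (simp add: verschiebung_uminus)

lemma verschiebung_inj: "verschiebung x = verschiebung y \<longleftrightarrow> x = y"
  by (metis wcomp_verschiebung_Suc witt_eqI)

lemma wcomp0_ringmap: "ringmap (\<lambda>x :: 'a::comm_ring_1 witt. wcomp x 0)"
proof (rule ringmapI)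
  note p = prime_wprime[of "TYPE('a)"]
  fix x y :: "'a witt"
  show "wcomp (1 :: 'a witt) 0 = 1" by transfer (simp add: tseq_def)
  show "wcomp (x + y) 0 = wcomp x 0 + wcomp y 0"
    by transfer (simp add: wop_0[OF p])
  show "wcomp (x * y) 0 = wcomp x 0 * wcomp y 0"
    by transfer (simp add: wop_0[OF p])
qed

lemmas wcomp0_simps = ringmap_simps[OF wcomp0_ringmap]

lemma teich_mult: "teich (a * b) = teich a * teich (b :: 'a::comm_ring_1)"
proof (transfer)
  fix a b :: 'a
  let ?p = "wprime TYPE('a)"
  note p = prime_wprime[of "TYPE('a)"]
  have "tseq (var a * var b :: 'a int_poly) = wop ?p (*) (tseq (var a)) (tseq (var b))"
    by (intro ghost_inj[of ?p]) (auto simp: prime_gt_0_nat[OF p] ghost_wop_mult[OF p] ghost_tseq power_mult_distrib)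
  then have "(\<lambda>n. poly_id (tseq (var a * var b) n)) = (\<lambda>n. poly_id (wop ?p (*) (tseq (var a)) (tseq (var b)) n))"
    by simp
  then show "tseq (a * b) = wop ?p (*) (tseq a) (tseq b)"
    by (simp flip: tseq_eval wop_eval add: ringmap_mult[OF ringmap_eval_poly_at])
qed

lemma teich_power: "teich (a ^ n) = teich a ^ n"
  by (induction n) (simp_all add: teich_mult)

text \<open>Recursion over the components of a Witt vector is done through this decomposition.\<close>

lemma witt_split: "x = teich (wcomp x 0) + verschiebung (witt_tail x)"
proof (transfer)
  fix x :: "nat \<Rightarrow> 'a"
  let ?p = "wprime TYPE('a)"
  note p = prime_wprime[of "TYPE('a)"]
  obtain u where u: "x = (\<lambda>i. poly_id (u i))"
    using universal_sequence by metis
  have "u = wop ?p (+) (tseq (u 0)) (vseq (\<lambda>i. u (Suc i)))"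
  proof (rule ghost_inj[of ?p])
    fix n
    show "ghost ?p n u = ghost ?p n (wop ?p (+) (tseq (u 0)) (vseq (\<lambda>i. u (Suc i))))"
    proof (cases n)
      case (Suc m)
      have "ghost ?p (Suc m) u = u 0 ^ (?p ^ Suc m) + of_nat ?p * ghost ?p m (\<lambda>i. u (Suc i))"
        by (simp add: ghost_def sum.atMost_Suc_shift sum_distrib_left mult.assoc del: sum.atMost_Suc)
      then show ?thesis
        using Suc by (simp add: ghost_wop_add[OF p] ghost_tseq ghost_vseq_Suc prime_gt_0_nat[OF p])
    qed (simp add: wop_0[OF p], simp add: tseq_def)
  qed (simp add: prime_gt_0_nat[OF p])
  then have "(\<lambda>n. poly_id (u n)) = (\<lambda>n. poly_id (wop ?p (+) (tseq (u 0)) (vseq (\<lambda>i. u (Suc i))) n))"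
    by simp
  then show "x = wop ?p (+) (tseq (x 0)) (vseq (\<lambda>i. x (Suc i)))"
    unfolding u tseq_eval vseq_eval wop_eval .
qed

lemma wcomp0_eq_zero: "wcomp x 0 = 0 \<Longrightarrow> x = verschiebung (witt_tail x)"
  using witt_split[of x] by simp

section \<open>Witt vectors over a field of characteristic p\<close>

text \<open>Witt vectors of length \<open>k\<close> are Witt vectors modulo \<open>vfil k\<close>, the image of \<open>V^k\<close> (\<open>vfil_iff\<close>).\<close>

definition vfil :: "nat \<Rightarrow> 'a::comm_ring_1 witt set" where
  "vfil k = {w. \<forall>i<k. wcomp w i = 0}"

lemma verschiebung_funpow_comp: "wcomp ((verschiebung ^^ k) w) i = (if i < k then 0 else wcomp w (i - k))"
proof (induction k arbitrary: i)
  case (Suc k)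
  show ?case by (cases i) (simp_all add: Suc)
qed simp

lemma vfil_iff: "w \<in> vfil k \<longleftrightarrow> (\<exists>x. w = (verschiebung ^^ k) x)"
proof
  assume "w \<in> vfil k"
  then have "w = (verschiebung ^^ k) (mkW (\<lambda>i. wcomp w (i + k)))"
    by (intro witt_eqI) (auto simp: verschiebung_funpow_comp vfil_def)
  then show "\<exists>x. w = (verschiebung ^^ k) x" by blast
qed (auto simp: vfil_def verschiebung_funpow_comp)

lemma verschiebung_funpow_add: "(verschiebung ^^ k) (x + y) = (verschiebung ^^ k) x + (verschiebung ^^ k) y"
  by (induction k) (simp_all add: verschiebung_add)

lemma verschiebung_funpow_uminus: "(verschiebung ^^ k) (- x) = - (verschiebung ^^ k) x"
  by (induction k) (simp_all add: verschiebung_uminus)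

lemma vfil_zero [simp]: "0 \<in> vfil k"
  by (simp add: vfil_def)

lemma vfil_0 [simp]: "w \<in> vfil 0"
  by (simp add: vfil_def)

lemma vfil_add: "x \<in> vfil k \<Longrightarrow> y \<in> vfil k \<Longrightarrow> x + y \<in> vfil k"
  unfolding vfil_iff by (metis verschiebung_funpow_add)

lemma vfil_uminus: "x \<in> vfil k \<Longrightarrow> - x \<in> vfil k"
  unfolding vfil_iff by (metis verschiebung_funpow_uminus)

lemma vfil_diff: "x \<in> vfil k \<Longrightarrow> y \<in> vfil k \<Longrightarrow> x - y \<in> vfil k"
  using vfil_add[of x k "- y"] vfil_uminus[of y k] by simp

lemma vfil_sum: "(\<And>i. i \<in> S \<Longrightarrow> f i \<in> vfil k) \<Longrightarrow> sum f S \<in> vfil k"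
  by (induction S rule: infinite_finite_induct) (simp_all add: vfil_add)

lemma vfil_mono: "j \<le> k \<Longrightarrow> x \<in> vfil k \<Longrightarrow> x \<in> vfil j"
  by (auto simp: vfil_def)

lemma vfil_Suc_0: "x \<in> vfil (Suc 0) \<longleftrightarrow> wcomp x 0 = 0"
  by (simp add: vfil_def)

lemma vfil_verschiebung: "verschiebung x \<in> vfil (Suc k) \<longleftrightarrow> x \<in> vfil k"
  by (auto simp: vfil_def less_Suc_eq_0_disj)

text \<open>Although subtraction is not componentwise, congruence modulo the filtration is the same as
  equality of the first components, by induction along \<open>witt_split\<close>.\<close>

lemma wcomp_eq_if_vfil:
  assumes "x - y \<in> vfil k" "i < k"
  shows "wcomp x i = wcomp y i"
  using assms
proof (induction k arbitrary: x y i)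
  case (Suc k)
  have "wcomp (x - y) 0 = 0" using Suc.prems(1) by (auto simp: vfil_def)
  then have c0: "wcomp x 0 = wcomp y 0" by (simp add: wcomp0_simps)
  show ?case
  proof (cases i)
    case (Suc j)
    have "x - y = verschiebung (witt_tail x - witt_tail y)"
      using witt_split[of x] witt_split[of y] c0 by (metis add_diff_cancel_left verschiebung_diff)
    then have "witt_tail x - witt_tail y \<in> vfil k" using Suc.prems(1) vfil_verschiebung by metis
    then show ?thesis using Suc.IH[of "witt_tail x" "witt_tail y" j] Suc.prems Suc by simp
  qed (use c0 in simp)
qed simp

lemma vfil_if_wcomp_eq:
  assumes "\<And>i. i < k \<Longrightarrow> wcomp x i = wcomp y i"
  shows "x - y \<in> vfil k"
  using assms
proof (induction k arbitrary: x y)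
  case (Suc k)
  have "x - y = verschiebung (witt_tail x - witt_tail y)"
    using witt_split[of x] witt_split[of y] Suc.prems[of 0] by (metis add_diff_cancel_left verschiebung_diff zero_less_Suc)
  moreover have "witt_tail x - witt_tail y \<in> vfil k" by (rule Suc.IH) (use Suc.prems in auto)
  ultimately show ?case by (simp add: vfil_verschiebung)
qed simp

text \<open>The argument \<open>ty\<close> records the field, for statements in which no variable has its type.\<close>

locale char_p =
  fixes p :: nat and ty :: "'a::field itself"
  assumes prime_p: "Factorial_Ring.prime p" and char_eq: "CHAR('a) = p"
begin

lemma p_gt_1: "p > 1"
  using prime_p prime_gt_1_nat by auto

lemma p_gt_0 [simp]: "p > 0"
  using p_gt_1 by simp

lemma p_ge_2: "p \<ge> 2"
  using p_gt_1 by simp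

lemma wprime_eq: "wprime TYPE('a) = p"
  using prime_p by (simp add: wprime_def char_eq)

lemma of_nat_p [simp]: "(of_nat p :: 'a) = 0"
  using char_eq of_nat_CHAR[where 'a='a] by simp

lemma ringmap_pth_power: "ringmap (\<lambda>x :: 'a. x ^ p)"
  by (rule ringmapI) (simp_all add: freshmans_dream prime_p char_eq power_mult_distrib)

lemma pth_power_inj: "(x :: 'a) ^ p = y ^ p \<longleftrightarrow> x = y"
proof
  assume "x ^ p = y ^ p"
  then have "(x - y) ^ p = 0" by (simp add: ringmap_diff[OF ringmap_pth_power])
  then show "x = y" by simp
qed simp

lemma wcomp_frob [simp]: "wcomp (frobenius x) n = (wcomp x n :: 'a) ^ p"
  by (simp add: wcomp_frobenius wprime_eq)

lemma ringmap_frobenius: "ringmap (frobenius :: 'a witt \<Rightarrow> 'a witt)"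
proof (rule ringmapI)
  note p = prime_p
  have h: "wop p \<Phi> (\<lambda>i. x i ^ p) (\<lambda>i. y i ^ p) = (\<lambda>n. wop p \<Phi> x y n ^ p)" for \<Phi> and x y :: "nat \<Rightarrow> 'a"
    by (rule wop_ringmap[OF ringmap_pth_power])
  fix x y :: "'a witt"
  show "frobenius (1 :: 'a witt) = 1"
    by transfer (auto simp: tseq_def wprime_eq zero_power)
  show "frobenius (x + y) = frobenius x + frobenius y"
    by transfer (simp add: wprime_eq h)
  show "frobenius (x * y) = frobenius x * frobenius y"
    by transfer (simp add: wprime_eq h)
qed

lemmas frobenius_simps = ringmap_simps[OF ringmap_frobenius]

lemma eval_dvd_zero:
  assumes "of_nat p dvd (u :: 'v int_poly)" shows "eval_poly_at u (g :: 'v \<Rightarrow> 'a) = 0"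
  using assms by (auto simp: ringmap_mult[OF ringmap_eval_poly_at] ringmap_of_nat[OF ringmap_eval_poly_at])

lemma eval_cong:
  assumes "of_nat p dvd (u - w :: 'v int_poly)" shows "eval_poly_at u (g :: 'v \<Rightarrow> 'a) = eval_poly_at w g"
  using eval_dvd_zero[OF assms] by (simp add: ringmap_diff[OF ringmap_eval_poly_at])

lemma of_nat_witt: "(of_nat m :: 'a witt) = mkW (cseq p (int m))"
proof (induction m)
  case 0
  have "cseq p 0 = (\<lambda>_. 0 :: 'a int_poly)"
    by (intro ghost_inj[of p]) (simp_all add: ghost_cseq[OF prime_p] ghost_zero)
  then have "cseq p 0 = (\<lambda>_. 0 :: 'a)"
    by (subst cseq_eval[of _ _ "\<lambda>v. v"]) (simp add: ringmap_zero[OF ringmap_eval_poly_at])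
  then show ?case by (simp add: zero_witt_def)
next
  case (Suc m)
  have "wop p (+) (tseq 1) (cseq p (int m)) = (cseq p (int (Suc m)) :: nat \<Rightarrow> 'a int_poly)"
    by (intro ghost_inj[of p]) (simp_all add: ghost_cseq[OF prime_p] ghost_wop_add[OF prime_p] ghost_tseq)
  then have "wop p (+) (tseq 1) (cseq p (int m)) = (cseq p (int (Suc m)) :: nat \<Rightarrow> 'a)"
    by (subst (1 2) cseq_eval[of _ _ "\<lambda>v. v"], subst tseq_one_eval[of "\<lambda>v. v"]) (simp add: wop_eval)
  then show ?case
    by (simp add: Suc one_witt.abs_eq plus_witt.abs_eq wprime_eq)
qed

text \<open>The ghost components of \<open>V 1\<close> are \<open>0, p, p, \<dots>\<close>, those of the integer \<open>p\<close> are \<open>p, p, p, \<dots>\<close>; they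
  are close enough for \<open>ghost_cong_conv\<close>.\<close>

lemma verschiebung_one: "verschiebung (1 :: 'a witt) = of_nat p"
proof -
  have "of_nat p dvd vseq (tseq 1) n - (cseq p (int p) n :: 'a int_poly)" for n
  proof (rule ghost_cong_conv[OF prime_p])
    fix n
    show "of_nat p ^ Suc n dvd ghost p n (vseq (tseq 1)) - (ghost p n (cseq p (int p)) :: 'a int_poly)"
      using ghost_cseq[OF prime_p, of 0 "int p", where 'a="'a int_poly"]
      by (cases n) (simp_all add: ghost_cseq[OF prime_p] ghost_vseq_Suc ghost_tseq)
  qed
  then have "poly_id (vseq (tseq 1) n) = (poly_id (cseq p (int p) n) :: 'a)" for n
    by (rule eval_cong)
  then have "vseq (tseq 1) = (cseq p (int p) :: nat \<Rightarrow> 'a)"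
    by (subst cseq_eval[of _ _ "\<lambda>v. v"], subst tseq_one_eval[of "\<lambda>v. v"]) (simp add: vseq_eval)
  then show ?thesis
    by (simp add: of_nat_witt verschiebung_def one_witt_def)
qed

text \<open>The projection formula. Over the integers the Frobenius on the left becomes \<open>fseq\<close>, for which
  the ghost components of both sides agree; modulo \<open>p\<close> it is the \<open>p\<close>-th power of the components.\<close>

lemma verschiebung_mult: "verschiebung (x * frobenius y) = verschiebung x * (y :: 'a witt)"
proof (transfer)
  fix x y :: "nat \<Rightarrow> 'a"
  note p = prime_p
  obtain u v where uv: "x = (\<lambda>i. poly_id (u i))" "y = (\<lambda>i. poly_id (v i))"
    using universal_sequence by metis
  have "vseq (wop p (*) u (fseq p v)) = wop p (*) (vseq u) v"
  proof (rule ghost_inj[of p])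
    fix n show "ghost p n (vseq (wop p (*) u (fseq p v))) = ghost p n (wop p (*) (vseq u) v)"
      by (cases n) (simp_all add: ghost_wop_mult[OF p] ghost_vseq_Suc ghost_fseq[OF p] wop_0[OF p])
  qed simp
  moreover have "poly_id (fseq p v n) = poly_id (v n) ^ p" for n
    using eval_cong[OF fseq_cong[OF p, of v n]] by (simp add: ringmap_power[OF ringmap_eval_poly_at])
  ultimately show "vseq (wop (wprime TYPE('a)) (*) x (\<lambda>i. y i ^ wprime TYPE('a))) = wop (wprime TYPE('a)) (*) (vseq x) y"
    unfolding wprime_eq uv
    by (simp flip: \<open>\<And>n. poly_id (fseq p v n) = poly_id (v n) ^ p\<close> add: wop_eval vseq_eval)
qed

lemma verschiebung_frobenius: "verschiebung (frobenius x) = of_nat p * (x :: 'a witt)"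
  using verschiebung_mult[of 1 x] by (simp add: verschiebung_one)

lemma frobenius_verschiebung: "frobenius (verschiebung x) = verschiebung (frobenius (x :: 'a witt))"
proof (rule witt_eqI)
  fix n show "wcomp (frobenius (verschiebung x)) n = wcomp (verschiebung (frobenius x)) n"
    by (cases n) (simp_all add: zero_power)
qed

lemma frobenius_teich: "frobenius (teich (x :: 'a)) = teich (x ^ p)"
  by (rule witt_eqI) (simp add: wcomp_teich zero_power)

lemma frobenius_inj: "frobenius (x :: 'a witt) = frobenius y \<longleftrightarrow> x = y"
  by (metis pth_power_inj wcomp_frob witt_eqI)

lemma p_cancel: "of_nat p * (x :: 'a witt) = of_nat p * y \<longleftrightarrow> x = y"
  by (metis frobenius_inj verschiebung_frobenius verschiebung_inj)

lemma vfil_frobenius: "frobenius (x :: 'a witt) \<in> vfil k \<longleftrightarrow> x \<in> vfil k"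
  by (simp add: vfil_def)

lemma vfil_p_mult: "of_nat p * (x :: 'a witt) \<in> vfil (Suc k) \<longleftrightarrow> x \<in> vfil k"
  by (simp add: vfil_verschiebung vfil_frobenius flip: verschiebung_frobenius)

lemma verschiebung_funpow_mult:
  "(verschiebung ^^ k) (x * (frobenius ^^ k) y) = (verschiebung ^^ k) x * (y :: 'a witt)"
  by (induction k arbitrary: x y) (simp_all add: funpow_swap1 verschiebung_mult)

lemma frobenius_verschiebung_funpow:
  "(frobenius ^^ j) ((verschiebung ^^ k) (x :: 'a witt)) = (verschiebung ^^ k) ((frobenius ^^ j) x)"
proof -
  have "frobenius ((verschiebung ^^ k) (x :: 'a witt)) = (verschiebung ^^ k) (frobenius x)" for x
    by (induction k) (simp_all add: frobenius_verschiebung)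
  then show ?thesis by (induction j) simp_all
qed

lemma ringmap_frobenius_funpow: "ringmap ((frobenius ^^ k) :: 'a witt \<Rightarrow> 'a witt)"
  by (induction k) (use ringmap_comp[OF ringmap_frobenius] in \<open>auto simp: ringmap_id comp_def id_def\<close>)

lemma wcomp_frobenius_funpow: "wcomp ((frobenius ^^ k) x) i = (wcomp x i :: 'a) ^ (p ^ k)"
  by (induction k) (simp_all add: mult.commute flip: power_mult)

text \<open>From the projection formula, \<open>V^j x V^k y = V^(j+k) (F^j y F^k x)\<close>.\<close>

lemma vfil_mult_add: "x \<in> vfil j \<Longrightarrow> (y :: 'a witt) \<in> vfil k \<Longrightarrow> x * y \<in> vfil (j + k)"
proof -
  assume "x \<in> vfil j" "y \<in> vfil k"
  then obtain x' y' where x: "x = (verschiebung ^^ j) x'" and y: "y = (verschiebung ^^ k) y'"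
    unfolding vfil_iff by blast
  have "x * y = (verschiebung ^^ j) (x' * (frobenius ^^ j) ((verschiebung ^^ k) y'))"
    unfolding x y verschiebung_funpow_mult ..
  also have "\<dots> = (verschiebung ^^ j) ((verschiebung ^^ k) ((frobenius ^^ j) y' * (frobenius ^^ k) x'))"
    by (simp add: frobenius_verschiebung_funpow verschiebung_funpow_mult mult.commute)
  finally show ?thesis unfolding vfil_iff by (metis comp_apply funpow_add)
qed

lemma vfil_mult: "x \<in> vfil k \<Longrightarrow> x * (y :: 'a witt) \<in> vfil k"
  and vfil_mult': "x \<in> vfil k \<Longrightarrow> (y :: 'a witt) * x \<in> vfil k"
  using vfil_mult_add[of x k y 0] by (simp_all add: mult.commute)

lemma vfil_p_power: "(of_nat p :: 'a witt) ^ k \<in> vfil k"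
proof (induction k)
  case (Suc k) then show ?case by (simp add: vfil_p_mult)
qed simp

lemma vfil_power_p_cong:
  assumes "(x :: 'a witt) - y \<in> vfil (Suc k)" shows "x ^ p - y ^ p \<in> vfil (Suc (Suc k))"
proof -
  define z where "z = x - y"
  have x: "x = y + z" by (simp add: z_def)
  obtain w where w: "(y + z) ^ p = y ^ p + z ^ p + of_nat p * y * z * w"
    using prime_add_power[OF prime_p] by blast
  have "z * z \<in> vfil (Suc (Suc k))"
    by (rule vfil_mono[OF _ vfil_mult_add]) (use assms in \<open>auto simp: z_def\<close>)
  moreover have "z ^ p = z * z * z ^ (p - 2)"
    using p_ge_2 by (metis le_add_diff_inverse power2_eq_square power_add)
  ultimately have "z ^ p \<in> vfil (Suc (Suc k))" by (simp add: vfil_mult)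
  moreover have "of_nat p * (z * (y * w)) \<in> vfil (Suc (Suc k))"
    unfolding vfil_p_mult by (rule vfil_mult) (use assms in \<open>simp add: z_def\<close>)
  ultimately have "z ^ p + of_nat p * (z * (y * w)) \<in> vfil (Suc (Suc k))" by (rule vfil_add)
  then show ?thesis by (simp add: x w algebra_simps)
qed

lemma vfil_power_cong:
  assumes "(x :: 'a witt) - y \<in> vfil (Suc 0)" shows "x ^ (p ^ k) - y ^ (p ^ k) \<in> vfil (Suc k)"
proof (induction k)
  case (Suc k)
  from vfil_power_p_cong[OF Suc] show ?case by (simp add: mult.commute flip: power_mult)
qed (use assms in simp)

text \<open>The Frobenius fixes Teichmueller representatives up to the \<open>p\<close>-th power, \<open>F V y = p y\<close>, and
  \<open>(V y)^p\<close> is divisible by \<open>p\<close> as \<open>(V y)^2 = p V (y^2)\<close>.\<close>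

lemma frobenius_cong: "\<exists>z. frobenius (x :: 'a witt) = x ^ p + of_nat p * z"
proof -
  obtain y where x: "x = teich (wcomp x 0) + verschiebung y" using witt_split by blast
  let ?t = "teich (wcomp x 0)" and ?v = "verschiebung y"
  obtain w where w: "(?t + ?v) ^ p = ?t ^ p + ?v ^ p + of_nat p * ?t * ?v * w"
    using prime_add_power[OF prime_p] by blast
  have "?v * ?v = verschiebung (y * frobenius ?v)" by (rule verschiebung_mult[symmetric])
  also have "y * frobenius ?v = verschiebung (frobenius (y * y))"
    by (simp add: frobenius_verschiebung verschiebung_frobenius)
  also have "verschiebung (verschiebung (frobenius (y * y))) = of_nat p * verschiebung (y * y)"
    by (metis frobenius_verschiebung verschiebung_frobenius)
  finally have "?v * ?v = of_nat p * verschiebung (y * y)" .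
  moreover have "?v ^ p = ?v * ?v * ?v ^ (p - 2)"
    using p_ge_2 by (metis le_add_diff_inverse power2_eq_square power_add)
  ultimately have vp: "?v ^ p = of_nat p * (verschiebung (y * y) * ?v ^ (p - 2))" by (simp add: mult.assoc)
  have "frobenius x = ?t ^ p + of_nat p * y"
    by (subst x) (simp add: frobenius_simps frobenius_teich teich_power frobenius_verschiebung verschiebung_frobenius)
  also have "\<dots> = x ^ p + of_nat p * (y - verschiebung (y * y) * ?v ^ (p - 2) - ?t * ?v * w)"
    using w[folded x] by (simp add: vp algebra_simps)
  finally show ?thesis by blast
qed

end

section \<open>Polynomials over the Witt vectors\<close>

type_synonym ('v, 'a) wpoly = "('v \<Rightarrow>\<^sub>0 nat) \<Rightarrow>\<^sub>0 'a witt"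

text \<open>The operator \<open>v d/dv\<close>, and not \<open>d/dv\<close>: it is diagonal on monomials, and \<open>log_deriv v P\<close> is the
  coefficient of \<open>dlog v\<close> in \<open>dP\<close>. Differential forms are represented throughout by their
  coefficients with respect to the \<open>dlog v\<close>.\<close>

definition log_deriv :: "'v \<Rightarrow> (('v \<Rightarrow>\<^sub>0 nat) \<Rightarrow>\<^sub>0 'c::comm_ring_1) \<Rightarrow> ('v \<Rightarrow>\<^sub>0 nat) \<Rightarrow>\<^sub>0 'c" where
  "log_deriv v P = Poly_Mapping.mapp (\<lambda>M c. of_nat (Poly_Mapping.lookup M v) * c) P"

lemma lookup_log_deriv: "Poly_Mapping.lookup (log_deriv v P) M = of_nat (Poly_Mapping.lookup M v) * Poly_Mapping.lookup P M"
  by (auto simp: log_deriv_def lookup_mapp when_def in_keys_iff)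

lemma log_deriv_add: "log_deriv v (P + Q) = log_deriv v P + log_deriv v Q"
  by (rule poly_mapping_eqI) (simp add: lookup_log_deriv lookup_add algebra_simps)

lemma log_deriv_zero [simp]: "log_deriv v 0 = 0"
  by (rule poly_mapping_eqI) (simp add: lookup_log_deriv)

lemma log_deriv_uminus: "log_deriv v (- P) = - log_deriv v P"
  by (rule poly_mapping_eqI) (simp add: lookup_log_deriv)

lemma log_deriv_diff: "log_deriv v (P - Q) = log_deriv v P - log_deriv v Q"
  by (rule poly_mapping_eqI) (simp add: lookup_log_deriv lookup_minus algebra_simps)

lemma log_deriv_sum: "log_deriv v (sum f S) = (\<Sum>i\<in>S. log_deriv v (f i))"
  by (induction S rule: infinite_finite_induct) (simp_all add: log_deriv_add)

lemma log_deriv_single: "log_deriv v (Poly_Mapping.single M c) = Poly_Mapping.single M (of_nat (Poly_Mapping.lookup M v) * c)"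
  by (rule poly_mapping_eqI) (auto simp: lookup_log_deriv lookup_single when_def)

lemma single_of_nat_mult: "Poly_Mapping.single M (of_nat k * c) = of_nat k * Poly_Mapping.single M (c :: 'c::comm_ring_1)"
  by (induction k) (simp_all add: algebra_simps single_add)

lemma log_deriv_mult: "log_deriv v (P * Q) = log_deriv v P * Q + P * log_deriv v Q"
proof (induction P rule: poly_induct)
  case (single M c)
  show ?case
  proof (induction Q rule: poly_induct)
    case (single M' c')
    then show ?case
      by (simp add: mult_single log_deriv_single lookup_add algebra_simps flip: single_add)
  qed (simp_all add: log_deriv_add algebra_simps)
qed (simp_all add: log_deriv_add algebra_simps)

lemma log_deriv_one [simp]: "log_deriv v 1 = 0"
  using log_deriv_mult[of v 1 1] by simp

lemma log_deriv_of_nat [simp]: "log_deriv v (of_nat n) = 0"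
  by (induction n) (simp_all add: log_deriv_add)

lemma log_deriv_of_int [simp]: "log_deriv v (of_int n) = 0"
  by (cases n) (simp_all add: log_deriv_uminus log_deriv_diff)

lemma log_deriv_of_nat_mult [simp]: "log_deriv v (of_nat n * P) = of_nat n * log_deriv v P"
  by (simp add: log_deriv_mult)

lemma log_deriv_of_nat_power_mult [simp]: "log_deriv v (of_nat n ^ k * P) = of_nat n ^ k * log_deriv v P"
  by (metis of_nat_power log_deriv_of_nat_mult)

lemma log_deriv_power: "log_deriv v (P ^ n) = of_nat n * P ^ (n - 1) * log_deriv v P"
proof (induction n)
  case (Suc n)
  then show ?case by (cases n) (simp_all add: log_deriv_mult algebra_simps)
qed simp

lemma log_deriv_commute: "log_deriv v (log_deriv u P) = log_deriv u (log_deriv v P)"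
  by (rule poly_mapping_eqI) (simp add: lookup_log_deriv algebra_simps)

lemma finite_log_deriv_support: "finite {v. log_deriv v P \<noteq> 0}"
proof (rule finite_subset)
  show "{v. log_deriv v P \<noteq> 0} \<subseteq> (\<Union>M\<in>Poly_Mapping.keys P. Poly_Mapping.keys M)"
  proof safe
    fix v assume "log_deriv v P \<noteq> 0"
    then obtain M where "Poly_Mapping.lookup (log_deriv v P) M \<noteq> 0"
      by (metis lookup_zero poly_mapping_eqI)
    then have "Poly_Mapping.lookup P M \<noteq> 0" "Poly_Mapping.lookup M v \<noteq> 0"
      unfolding lookup_log_deriv by (metis mult_zero_right) (metis \<open>Poly_Mapping.lookup (log_deriv v P) M \<noteq> 0\<close> lookup_log_deriv mult_zero_left of_nat_0)
    then show "v \<in> (\<Union>M\<in>Poly_Mapping.keys P. Poly_Mapping.keys M)"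
      by (auto simp: in_keys_iff)
  qed
qed simp

context char_p
begin

lemma wpoly_p_cancel: "of_nat p * (P :: ('v, 'a) wpoly) = of_nat p * Q \<longleftrightarrow> P = Q"
proof
  have l: "Poly_Mapping.lookup (of_nat p * P) M = of_nat p * Poly_Mapping.lookup P M" for M and P :: "('v, 'a) wpoly"
  proof -
    have "of_nat p * P = Poly_Mapping.map ((*) (of_nat p)) P"
      by (simp add: mult_map_scale_conv_mult)
    then show ?thesis by (simp add: Poly_Mapping.map.rep_eq when_def)
  qed
  assume "of_nat p * P = of_nat p * Q"
  then have "of_nat p * Poly_Mapping.lookup P M = of_nat p * Poly_Mapping.lookup Q M" for M
    by (metis l)
  then show "P = Q" by (auto intro: poly_mapping_eqI simp: p_cancel)
qed simp

lemma wpoly_p_power_cancel: "of_nat p ^ k * (P :: ('v, 'a) wpoly) = of_nat p ^ k * Q \<longleftrightarrow> P = Q"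
  by (induction k) (simp_all add: wpoly_p_cancel mult.assoc)

text \<open>In the basis \<open>dlog v\<close> the pullback of a form \<open>\<theta>\<close> along this lift of the Frobenius is \<open>p phi \<theta>\<close>
  (see \<open>log_deriv_phi\<close>); so \<open>phi\<close>, applied to coefficients, is the divided Frobenius and lifts
  the inverse Cartier operator.\<close>

definition phi :: "('v, 'a) wpoly \<Rightarrow> ('v, 'a) wpoly" where
  "phi = peval (\<lambda>c. Poly_Mapping.single 0 (frobenius c)) (\<lambda>v. Poly_Mapping.single (Poly_Mapping.single v p) 1)"

lemma ringmap_const: "ringmap (\<lambda>c. Poly_Mapping.single 0 c :: ('v \<Rightarrow>\<^sub>0 nat) \<Rightarrow>\<^sub>0 'c::comm_ring_1)"
  by (rule ringmapI) (simp_all add: single_add mult_single)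

lemma ringmap_const_frobenius: "ringmap (\<lambda>c. Poly_Mapping.single 0 (frobenius c) :: ('v, 'a) wpoly)"
  by (rule ringmap_comp[OF ringmap_const ringmap_frobenius])

lemma ringmap_phi: "ringmap (phi :: ('v, 'a) wpoly \<Rightarrow> _)"
  unfolding phi_def by (rule ringmap_peval[OF ringmap_const_frobenius])

lemmas phi_simps = ringmap_simps[OF ringmap_phi]

lemma mon_var_power: "mon (\<lambda>v. Poly_Mapping.single (Poly_Mapping.single v n) 1) M = (Poly_Mapping.single M 1 :: ('v \<Rightarrow>\<^sub>0 nat) \<Rightarrow>\<^sub>0 'c::comm_ring_1) ^ n"
proof -
  have *: "Poly_Mapping.single (Poly_Mapping.single v n) (1::'c) = Poly_Mapping.single (Poly_Mapping.single v 1) 1 ^ n" for v :: 'v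
  proof (induction n)
    case (Suc n)
    have "Poly_Mapping.single v (Suc n) = Poly_Mapping.single v 1 + Poly_Mapping.single v n"
      using single_add[of v 1 n] by simp
    then show ?case unfolding power_Suc Suc[symmetric] mult_single by simp
  qed simp
  show ?thesis
    unfolding * mon_power using single_eq_mon[of M "1 :: 'c"] by simp
qed

lemma phi_single: "phi (Poly_Mapping.single M c) = Poly_Mapping.single 0 (frobenius c) * Poly_Mapping.single M 1 ^ p"
  unfolding phi_def
  by (subst peval_single) (simp_all add: ringmap_zero[OF ringmap_frobenius] mon_var_power)

lemma log_deriv_phi: "log_deriv v (phi P) = of_nat p * phi (log_deriv v P)"
proof (induction P rule: poly_induct)
  case (single M c)
  have s: "Poly_Mapping.single M (1 :: 'a witt) ^ p = Poly_Mapping.single M 1 ^ (p - 1) * Poly_Mapping.single M 1"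
    using p_gt_0 by (metis Suc_diff_1 power_Suc2)
  have "phi (log_deriv v (Poly_Mapping.single M c)) =
      of_nat (Poly_Mapping.lookup M v) * (Poly_Mapping.single 0 (frobenius c) * Poly_Mapping.single M 1 ^ p)"
    by (simp only: log_deriv_single single_of_nat_mult phi_simps phi_single)
  moreover have "log_deriv v (Poly_Mapping.single M (1 :: 'a witt)) = of_nat (Poly_Mapping.lookup M v) * Poly_Mapping.single M 1"
    by (simp only: log_deriv_single single_of_nat_mult)
  moreover have "log_deriv v (Poly_Mapping.single 0 (frobenius c)) = 0" by (simp add: log_deriv_single)
  ultimately show ?case
    unfolding phi_single log_deriv_mult log_deriv_power by (simp add: s algebra_simps)
qed (simp_all add: log_deriv_add phi_simps algebra_simps)

lemma phi_cong: "\<exists>z. phi (P :: ('v, 'a) wpoly) = P ^ p + of_nat p * z"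
proof (induction P rule: poly_induct)
  case zero
  show ?case by (intro exI[of _ 0]) (simp add: phi_simps zero_power)
next
  case (single M c)
  obtain z where z: "frobenius c = c ^ p + of_nat p * z" using frobenius_cong by blast
  let ?m = "Poly_Mapping.single M 1 ^ p :: ('v, 'a) wpoly"
  have "phi (Poly_Mapping.single M c) = Poly_Mapping.single 0 c ^ p * ?m + of_nat p * (Poly_Mapping.single 0 z * ?m)"
    unfolding phi_single z by (simp add: ringmap_simps[OF ringmap_const] algebra_simps)
  also have "Poly_Mapping.single 0 c ^ p * ?m = Poly_Mapping.single M c ^ p"
    by (simp add: mult_single flip: power_mult_distrib)
  finally show ?case by blast
next
  case (add P Q)
  then obtain z y where "phi P = P ^ p + of_nat p * z" "phi Q = Q ^ p + of_nat p * y" by blast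
  moreover obtain w where "(P + Q) ^ p = P ^ p + Q ^ p + of_nat p * P * Q * w"
    using prime_add_power[OF prime_p] by blast
  ultimately have "phi (P + Q) = (P + Q) ^ p + of_nat p * (z + y - P * Q * w)"
    by (simp add: phi_simps algebra_simps)
  then show ?case by blast
qed

text \<open>Since \<open>phi a\<close> and \<open>a^p\<close> are congruent modulo \<open>p\<close>, their powers with exponent \<open>p^j\<close> are
  congruent modulo \<open>p^(j+1)\<close>. Differentiating, all terms become divisible by \<open>p^(j+1)\<close>, which can
  be cancelled.\<close>

lemma power_log_deriv_phi:
  "\<exists>z. \<forall>v. a ^ (p ^ Suc j - 1) * log_deriv v a = phi (a ^ (p ^ j - 1) * log_deriv v a) + log_deriv v (z :: ('v, 'a) wpoly)"
proof -
  obtain y where "phi a = a ^ p + of_nat p * y" using phi_cong by blast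
  then have "of_nat p dvd phi a - a ^ p" by simp
  then have "of_nat p ^ Suc j dvd phi a ^ (p ^ j) - (a ^ p) ^ (p ^ j)"
    by (rule power_prime_power_cong[OF prime_p])
  then obtain z where "phi a ^ (p ^ j) - (a ^ p) ^ (p ^ j) = of_nat p ^ Suc j * z" by blast
  then have z: "a ^ (p ^ Suc j) = phi (a ^ (p ^ j)) + of_nat p ^ Suc j * (- z)"
    by (simp add: phi_simps algebra_simps flip: power_mult)
  have "a ^ (p ^ Suc j - 1) * log_deriv v a = phi (a ^ (p ^ j - 1) * log_deriv v a) + log_deriv v (- z)" for v
  proof -
    have "of_nat p ^ Suc j * (a ^ (p ^ Suc j - 1) * log_deriv v a) = log_deriv v (a ^ (p ^ Suc j))"
      by (simp add: log_deriv_power mult.assoc)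
    also have "\<dots> = of_nat p * phi (log_deriv v (a ^ (p ^ j))) + of_nat p ^ Suc j * log_deriv v (- z)"
      unfolding z log_deriv_add log_deriv_phi log_deriv_of_nat_power_mult ..
    also have "\<dots> = of_nat p ^ Suc j * (phi (a ^ (p ^ j - 1) * log_deriv v a) + log_deriv v (- z))"
      by (simp add: log_deriv_power phi_simps algebra_simps)
    finally show ?thesis unfolding wpoly_p_power_cancel .
  qed
  then show ?thesis by blast
qed

text \<open>The form \<open>a^(p^j) dlog a\<close> is that of the symbol \<open>V^i [a] \<otimes> a\<close>, up to a power of \<open>p\<close>. It has to
  be trivial, and is so by telescoping the previous lemma.\<close>

lemma power_log_deriv_trivial:
  "\<exists>\<theta> z. (\<forall>v. log_deriv v a = 0 \<longrightarrow> \<theta> v = 0) \<and>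
     (\<forall>v. a ^ (p ^ j - 1) * log_deriv v a = phi (\<theta> v) - \<theta> v + log_deriv v (z :: ('v, 'a) wpoly))"
proof (induction j)
  case 0
  show ?case by (rule exI[of _ "\<lambda>_. 0"], rule exI[of _ a]) (simp add: phi_simps)
next
  case (Suc j)
  then obtain \<theta> z where IH: "\<And>v. log_deriv v a = 0 \<Longrightarrow> \<theta> v = 0"
    "\<And>v. a ^ (p ^ j - 1) * log_deriv v a = phi (\<theta> v) - \<theta> v + log_deriv v (z :: ('v, 'a) wpoly)" by blast
  obtain y where y: "\<And>v. a ^ (p ^ Suc j - 1) * log_deriv v a = phi (a ^ (p ^ j - 1) * log_deriv v a) + log_deriv v y"
    using power_log_deriv_phi by blast
  show ?case
  proof (rule exI[of _ "\<lambda>v. a ^ (p ^ j - 1) * log_deriv v a + \<theta> v"], rule exI[of _ "z + y"], safe)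
    fix v
    show "a ^ (p ^ Suc j - 1) * log_deriv v a = phi (a ^ (p ^ j - 1) * log_deriv v a + \<theta> v) -
        (a ^ (p ^ j - 1) * log_deriv v a + \<theta> v) + log_deriv v (z + y)"
      unfolding y[of v] ringmap_add[OF ringmap_phi] log_deriv_add using IH(2)[of v] by (simp add: algebra_simps)
  qed (simp add: IH)
qed

text \<open>The twist of the coefficients by \<open>F^N\<close> is what makes derivations compatible with evaluation: on
  residues it leaves only coefficients that are \<open>p^N\<close>-th powers, and over these the monomials in
  a \<open>p\<close>-basis with exponents below \<open>p^N\<close> are independent.\<close>

definition ev :: "('v \<Rightarrow> 'a) \<Rightarrow> nat \<Rightarrow> ('v, 'a) wpoly \<Rightarrow> 'a witt" where
  "ev g N = peval (frobenius ^^ N) (\<lambda>v. teich (g v))"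

lemma ringmap_ev: "ringmap (ev g N)"
  unfolding ev_def by (rule ringmap_peval[OF ringmap_frobenius_funpow])

lemmas ev_simps = ringmap_simps[OF ringmap_ev]

lemma teich_prod: "teich (prod f S) = (\<Prod>x\<in>S. teich (f x :: 'a))"
  by (induction S rule: infinite_finite_induct) (simp_all add: teich_mult)

lemma ev_single: "ev g N (Poly_Mapping.single M c) = (frobenius ^^ N) c * teich (mon g M)"
proof -
  have "mon (\<lambda>v. teich (g v)) M = teich (mon g M)"
    unfolding mon_def by (simp add: teich_prod teich_power)
  then show ?thesis unfolding ev_def
    by (subst peval_single) (simp_all add: ringmap_zero[OF ringmap_frobenius_funpow])
qed

lemma frobenius_funpow_teich: "(frobenius ^^ N) (teich x) = teich ((x :: 'a) ^ (p ^ N))"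
  by (induction N) (simp_all add: frobenius_teich mult.commute flip: power_mult)

lemma ev_phi: "ev g N (phi P) = frobenius (ev g N P)"
proof (rule ringmap_poly_eqI[of "\<lambda>P. ev g N (phi P)"])
  fix c show "ev g N (phi (Poly_Mapping.single 0 c)) = frobenius (ev g N (Poly_Mapping.single 0 c))"
    by (simp add: phi_single ev_single ev_simps flip: funpow_swap1)
next
  fix v
  show "ev g N (phi (Poly_Mapping.single (Poly_Mapping.single v 1) 1)) =
      frobenius (ev g N (Poly_Mapping.single (Poly_Mapping.single v 1) 1))"
    by (simp add: phi_single ev_single ev_simps ringmap_simps[OF ringmap_frobenius_funpow]
        ringmap_one[OF ringmap_frobenius] frobenius_teich teich_power)
qed (use ringmap_comp[OF ringmap_ev ringmap_phi] ringmap_comp[OF ringmap_frobenius ringmap_ev] in auto)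

text \<open>Passes from level \<open>N\<close> to level \<open>N + 1\<close>, in contrast to \<open>phi\<close>.\<close>

definition psi :: "('v, 'a) wpoly \<Rightarrow> ('v, 'a) wpoly" where
  "psi = peval (\<lambda>c. Poly_Mapping.single 0 c) (\<lambda>v. Poly_Mapping.single (Poly_Mapping.single v p) 1)"

lemma ringmap_psi: "ringmap (psi :: ('v, 'a) wpoly \<Rightarrow> _)"
  unfolding psi_def by (rule ringmap_peval[OF ringmap_const])

lemma psi_single: "psi (Poly_Mapping.single M c) = Poly_Mapping.single 0 c * Poly_Mapping.single M 1 ^ p"
  unfolding psi_def by (subst peval_single) (simp_all add: mon_var_power)

lemma ev_psi: "ev g (Suc N) (psi P) = frobenius (ev g N P)"
proof (rule ringmap_poly_eqI[of "\<lambda>P. ev g (Suc N) (psi P)"])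
  fix c show "ev g (Suc N) (psi (Poly_Mapping.single 0 c)) = frobenius (ev g N (Poly_Mapping.single 0 c))"
    by (simp add: psi_single ev_single ev_simps)
next
  fix v
  show "ev g (Suc N) (psi (Poly_Mapping.single (Poly_Mapping.single v 1) 1)) =
      frobenius (ev g N (Poly_Mapping.single (Poly_Mapping.single v 1) 1))"
    by (simp add: psi_single ev_single ev_simps ringmap_simps[OF ringmap_frobenius_funpow]
        ringmap_one[OF ringmap_frobenius] frobenius_teich teich_power)
qed (use ringmap_comp[OF ringmap_ev ringmap_psi] ringmap_comp[OF ringmap_frobenius ringmap_ev] in auto)

definition res :: "('v \<Rightarrow> 'a) \<Rightarrow> nat \<Rightarrow> ('v, 'a) wpoly \<Rightarrow> 'a" where
  "res g N P = wcomp (ev g N P) 0"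

lemma ringmap_res: "ringmap (res g N)"
  unfolding res_def by (rule ringmap_comp[OF wcomp0_ringmap ringmap_ev])

lemmas res_simps = ringmap_simps[OF ringmap_res]

lemma res_phi: "res g N (phi P) = res g N P ^ p"
  by (simp add: res_def ev_phi)

lemma res_psi: "res g (Suc N) (psi P) = res g N P ^ p"
  by (simp add: res_def ev_psi)

lemma res_single: "res g N (Poly_Mapping.single M c) = wcomp c 0 ^ (p ^ N) * mon g M"
  by (simp add: res_def ev_single wcomp0_simps wcomp_frobenius_funpow wcomp_teich)

text \<open>The case \<open>j = 0\<close> of \<open>power_log_deriv_phi\<close>: the inverse Cartier operator maps \<open>dP\<close> to
  \<open>P^(p-1) dP\<close> modulo exact forms. On coefficients with respect to \<open>dlog v\<close> it is the \<open>p\<close>-th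
  power.\<close>

lemma res_inverse_cartier:
  "\<exists>z. \<forall>v. res g N (log_deriv v P) ^ p = res g N P ^ (p - 1) * res g N (log_deriv v P) + res g N (log_deriv v z)"
proof -
  obtain z where z: "\<And>v. P ^ (p ^ Suc 0 - 1) * log_deriv v P = phi (P ^ (p ^ 0 - 1) * log_deriv v P) + log_deriv v z"
    using power_log_deriv_phi by blast
  have "res g N (log_deriv v P) ^ p = res g N P ^ (p - 1) * res g N (log_deriv v P) + res g N (log_deriv v (- z))" for v
    using arg_cong[OF z[of v], of "res g N"] by (simp add: res_simps res_phi log_deriv_uminus)
  then show ?thesis by blast
qed

end

section \<open>Lifts along a p-basis\<close>

definition emod :: "nat \<Rightarrow> ('v \<Rightarrow>\<^sub>0 nat) \<Rightarrow> 'v \<Rightarrow>\<^sub>0 nat" where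
  "emod n e = Poly_Mapping.map (\<lambda>x. x mod n) e"

definition ediv :: "nat \<Rightarrow> ('v \<Rightarrow>\<^sub>0 nat) \<Rightarrow> 'v \<Rightarrow>\<^sub>0 nat" where
  "ediv n e = Poly_Mapping.map (\<lambda>x. x div n) e"

lemma lookup_emod [simp]: "Poly_Mapping.lookup (emod n e) v = Poly_Mapping.lookup e v mod n"
  by (simp add: emod_def Poly_Mapping.map.rep_eq when_def)

lemma lookup_ediv [simp]: "Poly_Mapping.lookup (ediv n e) v = Poly_Mapping.lookup e v div n"
  by (simp add: ediv_def Poly_Mapping.map.rep_eq when_def)

lemma keys_emod: "Poly_Mapping.keys (emod n e) \<subseteq> Poly_Mapping.keys e"
  and keys_ediv: "Poly_Mapping.keys (ediv n e) \<subseteq> Poly_Mapping.keys e"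
  by (auto simp: in_keys_iff intro!: Nat.gr0I)

lemma emod_ediv_eqI: "emod n e = emod n f \<Longrightarrow> ediv n e = ediv n f \<Longrightarrow> e = f"
  by (rule poly_mapping_eqI) (metis lookup_emod lookup_ediv div_mult_mod_eq)

lemma mon_emod_ediv: "mon g e = mon g (emod n e) * mon g (ediv n e) ^ n"
proof -
  let ?S = "Poly_Mapping.keys e"
  have "mon g e = (\<Prod>v\<in>?S. g v ^ (Poly_Mapping.lookup e v mod n) * (g v ^ (Poly_Mapping.lookup e v div n)) ^ n)"
    unfolding mon_def by (rule prod.cong) (simp_all flip: power_mult power_add)
  also have "\<dots> = mon g (emod n e) * mon g (ediv n e) ^ n"
    by (simp add: prod.distrib mon_superset[of ?S "emod n e"] mon_superset[of ?S "ediv n e"] keys_emod keys_ediv prod_power_distrib)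
  finally show ?thesis .
qed

lemma sum_group_by:
  fixes f :: "'x \<Rightarrow> 'c::comm_monoid_add"
  assumes "finite E"
  shows "sum f E = (\<Sum>y\<in>h ` E. \<Sum>x | x \<in> E \<and> h x = y. f x)"
  using sum.image_gen[OF assms, of f h] by simp

text \<open>The monomials in \<open>B\<close> with exponents below \<open>p\<close> form a basis of the field over its \<open>p\<close>-th powers.\<close>

locale p_basis = char_p p ty for p :: nat and ty :: "'a::field itself" +
  fixes B :: "'a set"
  assumes indep: "\<And>E c e. \<lbrakk>finite E; \<And>e. e \<in> E \<Longrightarrow> Poly_Mapping.keys e \<subseteq> B;
      \<And>e v. e \<in> E \<Longrightarrow> Poly_Mapping.lookup e v < p;
      (\<Sum>e\<in>E. c e ^ p * mon (\<lambda>v. v) e) = 0; e \<in> E\<rbrakk> \<Longrightarrow> c e = (0 :: 'a)"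
    and spanning: "\<And>x :: 'a. \<exists>E c. finite E \<and> (\<forall>e\<in>E. Poly_Mapping.keys e \<subseteq> B) \<and>
      (\<forall>e\<in>E. \<forall>v. Poly_Mapping.lookup e v < p) \<and> x = (\<Sum>e\<in>E. c e ^ p * mon (\<lambda>v. v) e)"
begin

lemma ringmap_pth_power_funpow: "ringmap (\<lambda>x :: 'a. x ^ (p ^ k))"
proof (induction k)
  case (Suc k)
  from ringmap_comp[OF ringmap_pth_power Suc] show ?case by (simp add: mult.commute flip: power_mult)
qed (simp add: ringmap_id)

text \<open>A \<open>p\<close>-basis is also a \<open>p^N\<close>-basis: collect the exponents by their remainders modulo \<open>p\<close>, and
  take \<open>p\<close>-th roots.\<close>

lemma indep_power:
  assumes "finite E" "\<And>e. e \<in> E \<Longrightarrow> Poly_Mapping.keys e \<subseteq> B"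
    "\<And>e v. e \<in> E \<Longrightarrow> Poly_Mapping.lookup e v < p ^ N"
    "(\<Sum>e\<in>E. c e ^ (p ^ N) * mon (\<lambda>v. v) e) = 0" "e \<in> E"
  shows "c e = (0 :: 'a)"
  using assms
proof (induction N arbitrary: E c e)
  case 0
  have "f = 0" if "f \<in> E" for f
    using 0(3)[OF that] by (intro poly_mapping_eqI) simp
  then have "E = {0}" "e = 0" using 0(5) by auto
  then show ?case using 0(4) by simp
next
  case (Suc N)
  let ?G = "\<lambda>d. {f \<in> E. emod p f = d}"
  let ?y = "\<lambda>d. \<Sum>f\<in>?G d. c f ^ (p ^ N) * mon (\<lambda>v. v) (ediv p f)"
  have "(\<Sum>f\<in>E. c f ^ (p ^ Suc N) * mon (\<lambda>v. v) f) =
      (\<Sum>d\<in>emod p ` E. \<Sum>f\<in>?G d. c f ^ (p ^ Suc N) * mon (\<lambda>v. v) f)"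
    by (rule sum_group_by[OF Suc.prems(1)])
  also have "\<dots> = (\<Sum>d\<in>emod p ` E. ?y d ^ p * mon (\<lambda>v. v) d)"
  proof (rule sum.cong)
    fix d
    have "(\<Sum>f\<in>?G d. c f ^ (p ^ Suc N) * mon (\<lambda>v. v) f) =
        (\<Sum>f\<in>?G d. (c f ^ (p ^ N) * mon (\<lambda>v. v) (ediv p f)) ^ p * mon (\<lambda>v. v) d)"
    proof (rule sum.cong)
      fix f assume "f \<in> ?G d"
      then show "c f ^ (p ^ Suc N) * mon (\<lambda>v. v) f = (c f ^ (p ^ N) * mon (\<lambda>v. v) (ediv p f)) ^ p * mon (\<lambda>v. v) d"
        using mon_emod_ediv[of "\<lambda>v. v" f p]
        by (simp add: power_mult_distrib power_mult[symmetric] algebra_simps)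
    qed simp
    then show "(\<Sum>f\<in>?G d. c f ^ (p ^ Suc N) * mon (\<lambda>v. v) f) = ?y d ^ p * mon (\<lambda>v. v) d"
      by (simp add: ringmap_sum[OF ringmap_pth_power] sum_distrib_right)
  qed simp
  finally have "(\<Sum>d\<in>emod p ` E. ?y d ^ p * mon (\<lambda>v. v) d) = 0" using Suc.prems(4) by simp
  then have y0: "?y (emod p e) = 0"
    by (intro indep[of "emod p ` E" ?y "emod p e"])
       (use Suc.prems(1,2,5) keys_emod p_gt_0 in \<open>auto dest!: subsetD[OF keys_emod]\<close>)
  have inj: "inj_on (ediv p) (?G (emod p e))"
    by (rule inj_onI, rule emod_ediv_eqI[of p]) auto
  define c' where "c' = (\<lambda>d. c (the_inv_into (?G (emod p e)) (ediv p) d))"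
  have c': "c' (ediv p f) = c f" if "f \<in> ?G (emod p e)" for f
    unfolding c'_def using the_inv_into_f_f[OF inj that] by simp
  have "(\<Sum>d\<in>ediv p ` ?G (emod p e). c' d ^ (p ^ N) * mon (\<lambda>v. v) d) = ?y (emod p e)"
    by (subst sum.reindex[OF inj]) (intro sum.cong, simp_all add: c')
  then have "c' (ediv p e) = 0"
    by (intro Suc.IH[of "ediv p ` ?G (emod p e)" c'])
       (use Suc.prems y0 in \<open>auto dest!: subsetD[OF keys_ediv] simp: less_mult_imp_div_less mult.commute\<close>)
  then show ?case using c'[of e] Suc.prems(5) by simp
qed

text \<open>The variables are all elements of the field, but only those in the \<open>p\<close>-basis are given a
  nonzero value.\<close>

definition bvar :: "'a \<Rightarrow> 'a" where
  "bvar v = (if v \<in> B then v else 0)"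

lemma mon_bvar: "mon bvar e = (if Poly_Mapping.keys e \<subseteq> B then mon (\<lambda>v. v) e else 0)"
proof (cases "Poly_Mapping.keys e \<subseteq> B")
  case True
  then show ?thesis by (auto simp: mon_def bvar_def intro!: prod.cong)
next
  case False
  then obtain v where "v \<in> Poly_Mapping.keys e" "v \<notin> B" by auto
  then have "mon bvar e = 0"
    unfolding mon_def by (intro prod_zero) (auto simp: bvar_def in_keys_iff zero_power)
  then show ?thesis using False by simp
qed

text \<open>Expand in the \<open>p\<close>-basis; the \<open>p\<close>-th powers in the expansion are reached with \<open>psi\<close> from the
  previous level.\<close>

lemma res_surj: "\<exists>P :: ('a, 'a) wpoly. res bvar N P = x"
proof (induction N arbitrary: x)
  case 0
  show ?case by (rule exI[of _ "Poly_Mapping.single 0 (teich x)"]) (simp add: res_single wcomp_teich)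
next
  case (Suc N)
  obtain E c where E: "finite E" "\<And>e. e \<in> E \<Longrightarrow> Poly_Mapping.keys e \<subseteq> B"
    "x = (\<Sum>e\<in>E. c e ^ p * mon (\<lambda>v. v) e)"
    using spanning[of x] by blast
  obtain Q where Q: "\<And>x. res bvar N (Q x) = x" using Suc by metis
  have "res bvar (Suc N) (\<Sum>e\<in>E. psi (Q (c e)) * Poly_Mapping.single e 1) = x"
    unfolding E(3) ringmap_sum[OF ringmap_res] ringmap_mult[OF ringmap_res] res_psi Q
    by (intro sum.cong) (simp_all add: res_single mon_bvar E(2) wcomp0_simps)
  then show ?case by blast
qed

abbreviation ev' :: "nat \<Rightarrow> ('a, 'a) wpoly \<Rightarrow> 'a witt" where "ev' \<equiv> ev bvar"
abbreviation res' :: "nat \<Rightarrow> ('a, 'a) wpoly \<Rightarrow> 'a" where "res' \<equiv> res bvar"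

lemma ev_expand: "ev g N P = (\<Sum>e\<in>Poly_Mapping.keys P. (frobenius ^^ N) (Poly_Mapping.lookup P e) * teich (mon g e))"
  by (subst poly_expand[of P]) (simp only: ringmap_sum[OF ringmap_ev] ev_single)

text \<open>A value with residue zero is \<open>p\<close> times a value at the previous level, compatibly with the
  derivations. Collect the terms by exponents modulo \<open>p^(N+1)\<close>: independence forces the
  coefficient of each remainder to be of the form \<open>V u\<close>, and \<open>F V u = p u\<close>. Replacing an exponent
  by its remainder changes the derivation by a multiple of \<open>p^(N+1)\<close> only.\<close>

lemma res_zero_reduce:
  assumes "res' (Suc N) a = 0"
  shows "\<exists>a'. ev' (Suc N) a = of_nat p * ev' N a' \<and>
    (\<forall>b. ev' (Suc N) (log_deriv b a) - of_nat p * ev' N (log_deriv b a') \<in> vfil (Suc N))"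
proof -
  let ?q = "p ^ Suc N"
  define K where "K = {e \<in> Poly_Mapping.keys a. Poly_Mapping.keys e \<subseteq> B}"
  define w where "w = Poly_Mapping.lookup a"
  have fin: "finite K" by (simp add: K_def)
  have evK: "ev' (Suc N) P = (\<Sum>e\<in>K. (frobenius ^^ Suc N) (Poly_Mapping.lookup P e) * teich (mon (\<lambda>v. v) e))"
    if "Poly_Mapping.keys P \<subseteq> Poly_Mapping.keys a" for P
  proof -
    have "ev' (Suc N) P = (\<Sum>e\<in>Poly_Mapping.keys a. (frobenius ^^ Suc N) (Poly_Mapping.lookup P e) * teich (mon bvar e))"
      unfolding ev_expand using that
      by (intro sum.mono_neutral_left) (auto simp: in_keys_iff ringmap_zero[OF ringmap_frobenius] ringmap_zero[OF ringmap_frobenius_funpow])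
    also have "\<dots> = (\<Sum>e\<in>K. (frobenius ^^ Suc N) (Poly_Mapping.lookup P e) * teich (mon bvar e))"
      unfolding K_def by (intro sum.mono_neutral_right) (auto simp: mon_bvar)
    also have "\<dots> = (\<Sum>e\<in>K. (frobenius ^^ Suc N) (Poly_Mapping.lookup P e) * teich (mon (\<lambda>v. v) e))"
      by (intro sum.cong) (auto simp: mon_bvar K_def)
    finally show ?thesis .
  qed
  let ?G = "\<lambda>d. {e \<in> K. emod ?q e = d}"
  define y where "y = (\<lambda>d. \<Sum>e\<in>?G d. w e * teich (mon (\<lambda>v. v) (ediv ?q e)))"
  define D where "D = emod ?q ` K"
  have tm: "(frobenius ^^ Suc N) (w e) * teich (mon (\<lambda>v. v) e) =
      teich (mon (\<lambda>v. v) (emod ?q e)) * (frobenius ^^ Suc N) (w e * teich (mon (\<lambda>v. v) (ediv ?q e)))" for e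
    unfolding ringmap_mult[OF ringmap_frobenius_funpow] frobenius_funpow_teich
    by (subst mon_emod_ediv[of _ e ?q]) (simp add: teich_mult algebra_simps)
  have grp: "(\<Sum>e\<in>K. f (emod ?q e) * ((frobenius ^^ Suc N) (w e) * teich (mon (\<lambda>v. v) e))) =
      (\<Sum>d\<in>D. f d * (teich (mon (\<lambda>v. v) d) * (frobenius ^^ Suc N) (y d)))" for f
  proof -
    have "(\<Sum>e\<in>K. f (emod ?q e) * ((frobenius ^^ Suc N) (w e) * teich (mon (\<lambda>v. v) e))) =
       (\<Sum>d\<in>D. \<Sum>e\<in>?G d. f (emod ?q e) * ((frobenius ^^ Suc N) (w e) * teich (mon (\<lambda>v. v) e)))"
      unfolding D_def by (rule sum_group_by[OF fin])
    also have "\<dots> = (\<Sum>d\<in>D. f d * (teich (mon (\<lambda>v. v) d) * (frobenius ^^ Suc N) (y d)))"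
      unfolding y_def ringmap_sum[OF ringmap_frobenius_funpow] sum_distrib_left
      by (intro sum.cong) (auto simp only: tm mem_Collect_eq)
    finally show ?thesis .
  qed
  have eva: "ev' (Suc N) a = (\<Sum>d\<in>D. teich (mon (\<lambda>v. v) d) * (frobenius ^^ Suc N) (y d))"
    using evK[of a] grp[of "\<lambda>_. 1"] by (simp add: w_def del: funpow.simps)
  have "(\<Sum>d\<in>D. wcomp (y d) 0 ^ ?q * mon (\<lambda>v. v) d) = 0"
    using assms unfolding res_def eva
    by (simp add: wcomp0_simps wcomp_frobenius_funpow wcomp_teich mult.commute del: funpow.simps)
  then have "wcomp (y d) 0 = 0" if "d \<in> D" for d
    using that p_gt_0 by (intro indep_power[of D "Suc N" "\<lambda>d. wcomp (y d) 0"])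
       (auto simp: D_def fin K_def dest!: subsetD[OF keys_emod])
  then have yu: "y d = verschiebung (witt_tail (y d))" if "d \<in> D" for d
    using that wcomp0_eq_zero by metis
  have Fy: "(frobenius ^^ Suc N) (y d) = of_nat p * (frobenius ^^ N) (witt_tail (y d))" if "d \<in> D" for d
  proof -
    have "(frobenius ^^ Suc N) (verschiebung u) = (frobenius ^^ N) (of_nat p * u)" for u :: "'a witt"
      by (simp only: funpow_Suc_right comp_apply frobenius_verschiebung verschiebung_frobenius)
    then have "(frobenius ^^ Suc N) (verschiebung u) = of_nat p * (frobenius ^^ N) u" for u :: "'a witt"
      by (simp only: ringmap_mult[OF ringmap_frobenius_funpow] ringmap_of_nat[OF ringmap_frobenius_funpow])
    then show ?thesis using yu[OF that] by metis
  qed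
  define a' where "a' = (\<Sum>d\<in>D. Poly_Mapping.single d (witt_tail (y d)))"
  have monD: "mon bvar d = mon (\<lambda>v. v) d" if "d \<in> D" for d
    using that by (auto simp: mon_bvar D_def K_def dest!: subsetD[OF keys_emod])
  have "ev' (Suc N) a = of_nat p * ev' N a'"
    unfolding eva a'_def ringmap_sum[OF ringmap_ev] sum_distrib_left ev_single
    by (intro sum.cong) (simp_all add: Fy monD algebra_simps del: funpow.simps)
  moreover have "ev' (Suc N) (log_deriv b a) - of_nat p * ev' N (log_deriv b a') \<in> vfil (Suc N)" for b
  proof -
    let ?t = "\<lambda>e. (frobenius ^^ Suc N) (w e) * teich (mon (\<lambda>v. v) e)"
    have "ev' (Suc N) (log_deriv b a) = (\<Sum>e\<in>K. of_nat (Poly_Mapping.lookup e b) * ?t e)"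
      by (subst evK) (auto simp: lookup_log_deriv in_keys_iff w_def ringmap_simps[OF ringmap_frobenius_funpow] mult.assoc simp del: funpow.simps)
    also have "\<dots> = (\<Sum>e\<in>K. of_nat (Poly_Mapping.lookup (emod ?q e) b) * ?t e) +
        of_nat p ^ Suc N * (\<Sum>e\<in>K. of_nat (Poly_Mapping.lookup (ediv ?q e) b) * ?t e)"
    proof -
      have "of_nat (Poly_Mapping.lookup e b) * t = of_nat (Poly_Mapping.lookup (emod ?q e) b) * t
          + of_nat p ^ Suc N * (of_nat (Poly_Mapping.lookup (ediv ?q e) b) * t)" for e and t :: "'a witt"
        unfolding mult.assoc[symmetric] distrib_right[symmetric]
        by (metis lookup_emod lookup_ediv of_nat_power of_nat_mult of_nat_add mod_mult_div_eq)
      then have "(\<Sum>e\<in>K. of_nat (Poly_Mapping.lookup e b) * ?t e) =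
          (\<Sum>e\<in>K. of_nat (Poly_Mapping.lookup (emod ?q e) b) * ?t e
             + of_nat p ^ Suc N * (of_nat (Poly_Mapping.lookup (ediv ?q e) b) * ?t e))"
        by (intro sum.cong refl)
      then show ?thesis by (simp only: sum.distrib sum_distrib_left)
    qed
    also have "(\<Sum>e\<in>K. of_nat (Poly_Mapping.lookup (emod ?q e) b) * ?t e) =
       (\<Sum>d\<in>D. of_nat (Poly_Mapping.lookup d b) * (teich (mon (\<lambda>v. v) d) * (frobenius ^^ Suc N) (y d)))"
      by (rule grp)
    also have "\<dots> = of_nat p * ev' N (log_deriv b a')"
      unfolding a'_def log_deriv_sum ringmap_sum[OF ringmap_ev] sum_distrib_left ev_single log_deriv_single
      by (intro sum.cong) (simp_all add: Fy monD ringmap_simps[OF ringmap_frobenius_funpow] algebra_simps del: funpow.simps)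
    finally show ?thesis
      using vfil_mult[OF vfil_p_power[of "Suc N"]] by (simp del: power_Suc funpow.simps)
  qed
  ultimately show ?thesis by blast
qed

text \<open>The derivations are therefore defined on values modulo \<open>V^n\<close>. A value in \<open>vfil n\<close> is divisible
  by \<open>p\<close> by the previous lemma, and the quotient lies in \<open>vfil (n - 1)\<close>.\<close>

lemma ev_log_deriv_vfil:
  assumes "n \<le> N" "ev' N a \<in> vfil n" shows "ev' N (log_deriv b a) \<in> vfil n"
  using assms
proof (induction n arbitrary: N a)
  case (Suc n)
  then obtain M where N: "N = Suc M" by (cases N) auto
  have "res' (Suc M) a = 0" using Suc.prems(2) N by (simp add: res_def vfil_def)
  then obtain a' where a': "ev' N a = of_nat p * ev' M a'"
    "ev' N (log_deriv b a) - of_nat p * ev' M (log_deriv b a') \<in> vfil (Suc M)"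
    using res_zero_reduce N by blast
  have "ev' M a' \<in> vfil n" using Suc.prems(2) a'(1) by (simp add: vfil_p_mult)
  then have "ev' M (log_deriv b a') \<in> vfil n" using Suc N by simp
  then have "of_nat p * ev' M (log_deriv b a') \<in> vfil (Suc n)" by (simp add: vfil_p_mult)
  moreover have "ev' N (log_deriv b a) - of_nat p * ev' M (log_deriv b a') \<in> vfil (Suc n)"
    using a'(2) Suc.prems(1) N vfil_mono[of "Suc n" "Suc M"] by auto
  ultimately show ?case using vfil_add by fastforce
qed simp

definition lift :: "nat \<Rightarrow> 'a \<Rightarrow> ('a, 'a) wpoly" where
  "lift N x = (SOME P. res' N P = x)"

lemma res_lift [simp]: "res' N (lift N x) = x"
  unfolding lift_def by (rule someI_ex[OF res_surj])

text \<open>The shape of a ghost component. The value of \<open>x^(p^k)\<close> modulo \<open>V^(k+1)\<close> depends on the residue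
  of \<open>x\<close> only, so the choice of the lifts does not matter.\<close>

definition witt_lift :: "nat \<Rightarrow> nat \<Rightarrow> 'a witt \<Rightarrow> ('a, 'a) wpoly" where
  "witt_lift N n w = (\<Sum>j<n. of_nat p ^ j * lift N (wcomp w j) ^ (p ^ (n - 1 - j)))"

lemma verschiebung_sum: "verschiebung (sum f S) = (\<Sum>i\<in>S. verschiebung (f i))"
  by (induction S rule: infinite_finite_induct) (simp_all add: verschiebung_add)

lemma witt_expand: "w - (\<Sum>j<n. (verschiebung ^^ j) (teich (wcomp w j))) \<in> vfil (n :: nat)"
proof (induction n arbitrary: w)
  case (Suc n)
  have "w - (\<Sum>j<Suc n. (verschiebung ^^ j) (teich (wcomp w j))) =
      (w - teich (wcomp w 0)) - verschiebung (\<Sum>j<n. (verschiebung ^^ j) (teich (wcomp (witt_tail w) j)))"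
    by (simp add: sum.lessThan_Suc_shift verschiebung_sum del: sum.lessThan_Suc)
  also have "w - teich (wcomp w 0) = verschiebung (witt_tail w)"
    using witt_split[of w] by (metis add_diff_cancel_left')
  finally show ?case
    using Suc[of "witt_tail w"] by (simp add: vfil_verschiebung flip: verschiebung_diff)
qed simp

lemma verschiebung_frobenius_funpow: "(verschiebung ^^ j) ((frobenius ^^ j) x) = of_nat p ^ j * (x :: 'a witt)"
proof (induction j arbitrary: x)
  case (Suc j)
  have "(verschiebung ^^ Suc j) ((frobenius ^^ Suc j) x) = verschiebung ((verschiebung ^^ j) ((frobenius ^^ j) (frobenius x)))"
    by (simp add: funpow_swap1)
  also have "\<dots> = verschiebung (of_nat p ^ j * frobenius x)" by (simp only: Suc)
  also have "\<dots> = verschiebung (frobenius (of_nat p ^ j * x))" by (simp add: frobenius_simps)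
  also have "\<dots> = of_nat p ^ Suc j * x" by (simp add: verschiebung_frobenius)
  finally show ?case .
qed simp

lemma frobenius_verschiebung_teich:
  assumes "j \<le> k"
  shows "(frobenius ^^ k) ((verschiebung ^^ j) (teich x)) = of_nat p ^ j * teich (x :: 'a) ^ (p ^ (k - j))"
proof -
  obtain i where k: "k = j + i" using assms le_Suc_ex by blast
  show ?thesis
    unfolding frobenius_verschiebung_funpow k funpow_add comp_apply verschiebung_frobenius_funpow
      frobenius_funpow_teich teich_power add_diff_cancel_left' ..
qed

lemma ev_power_teich:
  assumes "res' N a = x" shows "ev' N a ^ (p ^ k) - teich x ^ (p ^ k) \<in> vfil (Suc k)"
  by (rule vfil_power_cong) (use assms in \<open>simp add: vfil_Suc_0 res_def wcomp0_simps wcomp_teich\<close>)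

lemma vfil_frobenius_funpow: "(frobenius ^^ k) (x :: 'a witt) \<in> vfil n \<longleftrightarrow> x \<in> vfil n"
  by (induction k) (simp_all add: vfil_frobenius)

lemma vfil_p_power_mult: "x \<in> vfil n \<Longrightarrow> of_nat p ^ j * (x :: 'a witt) \<in> vfil (j + n)"
  by (rule vfil_mult_add[OF vfil_p_power])

text \<open>The twist \<open>F^(n-1)\<close> turns \<open>V^j [x]\<close> into \<open>p^j [x]^(p^(n-1-j))\<close>, the value of the corresponding
  term.\<close>

lemma ev_witt_lift: "ev' N (witt_lift N n w) - (frobenius ^^ (n - 1)) w \<in> vfil n"
proof -
  let ?s = "\<Sum>j<n. (verschiebung ^^ j) (teich (wcomp w j))"
  have "(frobenius ^^ (n - 1)) (w - ?s) \<in> vfil n"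
    by (simp add: vfil_frobenius_funpow witt_expand)
  then have 1: "(frobenius ^^ (n - 1)) w - (frobenius ^^ (n - 1)) ?s \<in> vfil n"
    by (simp add: ringmap_diff[OF ringmap_frobenius_funpow])
  have "ev' N (witt_lift N n w) - (frobenius ^^ (n - 1)) ?s =
     (\<Sum>j<n. of_nat p ^ j * (ev' N (lift N (wcomp w j)) ^ (p ^ (n - 1 - j)) - teich (wcomp w j) ^ (p ^ (n - 1 - j))))"
    unfolding witt_lift_def ringmap_sum[OF ringmap_ev] ringmap_sum[OF ringmap_frobenius_funpow] sum_subtractf[symmetric]
    by (intro sum.cong) (simp_all add: frobenius_verschiebung_teich ev_simps algebra_simps)
  also have "\<dots> \<in> vfil n"
  proof (rule vfil_sum)
    fix j assume "j \<in> {..<n}"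
    then have "n = j + Suc (n - 1 - j)" by auto
    then show "of_nat p ^ j * (ev' N (lift N (wcomp w j)) ^ (p ^ (n - 1 - j)) - teich (wcomp w j) ^ (p ^ (n - 1 - j))) \<in> vfil n"
      using vfil_p_power_mult[OF ev_power_teich[OF res_lift]] by metis
  qed
  finally show ?thesis using vfil_diff[OF _ 1] by fastforce
qed

text \<open>The values modulo \<open>V^n\<close> form a lift of the field in which \<open>p\<close> generates the maximal ideal. The
  quotient by \<open>p\<close> found in \<open>res_zero_reduce\<close> lives at the previous level; its coefficients are
  lifted back with \<open>witt_lift\<close>.\<close>

lemma res_zero_divide:
  assumes "n \<le> N" "res' N a = 0" shows "\<exists>r. ev' N a - of_nat p * ev' N r \<in> vfil n"
proof (cases n)
  case (Suc m)
  then obtain M where N: "N = Suc M" using assms(1) by (cases N) auto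
  obtain a' where a': "ev' N a = of_nat p * ev' M a'"
    using res_zero_reduce assms(2) N by blast
  define r where "r = (\<Sum>e\<in>Poly_Mapping.keys a'. witt_lift N m ((frobenius ^^ (N - m)) (Poly_Mapping.lookup a' e)) * Poly_Mapping.single e 1)"
  have "ev' N r - ev' M a' \<in> vfil m"
  proof (cases m)
    case (Suc k)
    have "ev' N r - ev' M a' = (\<Sum>e\<in>Poly_Mapping.keys a'.
       (ev' N (witt_lift N m ((frobenius ^^ (N - m)) (Poly_Mapping.lookup a' e))) - (frobenius ^^ M) (Poly_Mapping.lookup a' e)) * teich (mon bvar e))"
      unfolding r_def ringmap_sum[OF ringmap_ev] ev_expand[of bvar M a'] sum_subtractf[symmetric]
      by (intro sum.cong) (simp_all add: ev_simps ev_single ringmap_one[OF ringmap_frobenius_funpow] algebra_simps)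
    also have "\<dots> \<in> vfil m"
    proof (intro vfil_sum vfil_mult)
      fix e
      have "(frobenius ^^ M) (Poly_Mapping.lookup a' e) = (frobenius ^^ (m - 1)) ((frobenius ^^ (N - m)) (Poly_Mapping.lookup a' e))"
      proof -
        have "M = (m - 1) + (N - m)" using Suc N assms(1) \<open>n = Suc m\<close> by simp
        then show ?thesis by (metis comp_apply funpow_add)
      qed
      then show "ev' N (witt_lift N m ((frobenius ^^ (N - m)) (Poly_Mapping.lookup a' e))) - (frobenius ^^ M) (Poly_Mapping.lookup a' e) \<in> vfil m"
        using ev_witt_lift by simp
    qed
    finally show ?thesis .
  qed simp
  then have "ev' M a' - ev' N r \<in> vfil m" using vfil_uminus by fastforce
  then have "of_nat p * (ev' M a' - ev' N r) \<in> vfil n" unfolding Suc vfil_p_mult .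
  then show ?thesis using a' by (metis right_diff_distrib)
qed simp

end

section \<open>Derivations and logarithmic forms\<close>

text \<open>The falling factorial \<open>T (T - 1) \<cdots> (T - (n - 1))\<close> of an operator, applied to \<open>y\<close>.\<close>

primrec falling :: "('a::comm_ring_1 \<Rightarrow> 'a) \<Rightarrow> nat \<Rightarrow> 'a \<Rightarrow> 'a" where
  "falling T 0 y = y"
| "falling T (Suc n) y = T (falling T n y) - of_nat n * falling T n y"

lemma binomial_sum_Suc:
  fixes f :: "nat \<Rightarrow> nat \<Rightarrow> 'a::comm_ring_1"
  shows "(\<Sum>k\<le>Suc n. of_nat (Suc n choose k) * f k (Suc n - k)) =
    (\<Sum>k\<le>n. of_nat (n choose k) * (f (Suc k) (n - k) + f k (Suc (n - k))))"
proof -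
  have "(\<Sum>k\<le>Suc n. of_nat (Suc n choose k) * f k (Suc n - k)) =
     f 0 (Suc n) + (\<Sum>k\<le>n. of_nat (n choose k) * f (Suc k) (n - k)) + (\<Sum>k\<le>n. of_nat (n choose Suc k) * f (Suc k) (n - k))"
    by (simp add: sum.atMost_Suc_shift algebra_simps sum.distrib del: sum.atMost_Suc)
  also have "(\<Sum>k\<le>n. of_nat (n choose Suc k) * f (Suc k) (n - k)) = (\<Sum>k<n. of_nat (n choose Suc k) * f (Suc k) (Suc (n - Suc k)))"
    by (cases n) (auto simp: lessThan_Suc_atMost binomial_eq_0 Suc_diff_le intro!: sum.cong)
  also have "f 0 (Suc n) + (\<Sum>k\<le>n. of_nat (n choose k) * f (Suc k) (n - k)) + \<dots> =
     (\<Sum>k\<le>n. of_nat (n choose k) * f (Suc k) (n - k)) + (\<Sum>k\<le>n. of_nat (n choose k) * f k (Suc (n - k)))"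
    by (simp add: sum.atMost_shift[of _ n])
  finally show ?thesis by (simp add: algebra_simps sum.distrib)
qed

text \<open>Vandermonde's identity for falling factorials, with operators in place of numbers.\<close>

lemma falling_Leibniz:
  fixes A C U :: "'a::comm_ring_1 \<Rightarrow> 'a"
  assumes C: "\<And>g y. C (g * y) = A g * y + g * U y"
    and add: "\<And>x y. C (x + y) = C x + C y" and nat: "\<And>n y. C (of_nat n * y) = of_nat n * C y"
  shows "falling C n (g * y) = (\<Sum>k\<le>n. of_nat (n choose k) * (falling A k g * falling U (n - k) y))"
proof (induction n)
  case (Suc n)
  have C0: "C 0 = 0" using add[of 0 0] by simp
  have Csum: "C (\<Sum>k\<in>S. h k) = (\<Sum>k\<in>S. C (h k))" for h and S :: "nat set"
    by (induction S rule: infinite_finite_induct) (simp_all add: C0 add)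
  have "falling C (Suc n) (g * y) = (\<Sum>k\<le>n. of_nat (n choose k) *
      (C (falling A k g * falling U (n - k) y) - of_nat n * (falling A k g * falling U (n - k) y)))"
    by (simp add: Suc Csum nat sum_distrib_left sum_subtractf algebra_simps)
  also have "\<dots> = (\<Sum>k\<le>n. of_nat (n choose k) * (falling A (Suc k) g * falling U (n - k) y + falling A k g * falling U (Suc (n - k)) y))"
  proof (rule sum.cong)
    fix k assume "k \<in> {..n}"
    then have "(of_nat n :: 'a) = of_nat k + of_nat (n - k)" by (simp flip: of_nat_add)
    then show "of_nat (n choose k) * (C (falling A k g * falling U (n - k) y) - of_nat n * (falling A k g * falling U (n - k) y)) =
      of_nat (n choose k) * (falling A (Suc k) g * falling U (n - k) y + falling A k g * falling U (Suc (n - k)) y)"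
      by (simp add: C algebra_simps)
  qed simp
  also have "\<dots> = (\<Sum>k\<le>Suc n. of_nat (Suc n choose k) * (falling A k g * falling U (Suc n - k) y))"
    by (rule binomial_sum_Suc[symmetric])
  finally show ?case .
qed simp

lemma falling_eq_fold: "falling T n y = fold (\<lambda>c y. T y - of_nat c * y) [0..<n] y"
  by (induction n) simp_all

context char_p
begin

lemma of_nat_mod_p [simp]: "(of_nat (i mod p) :: 'a) = of_nat i"
proof -
  have "(of_nat i :: 'a) = of_nat (p * (i div p) + i mod p)" by simp
  also have "\<dots> = of_nat (i mod p)" by (simp only: of_nat_add of_nat_mult of_nat_p mult_zero_left add_0)
  finally show ?thesis ..
qed

lemma of_nat_eq_0_iff_dvd: "(of_nat i :: 'a) = 0 \<longleftrightarrow> p dvd i"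
  using of_nat_eq_0_iff_char_dvd[where 'a='a] char_eq by simp

lemma of_nat_eq_iff_mod: "(of_nat i :: 'a) = of_nat j \<longleftrightarrow> i mod p = j mod p"
proof (induction i j rule: linorder_wlog)
  case (le i j)
  have "(of_nat j :: 'a) = of_nat i + of_nat (j - i)"
    using le by (simp flip: of_nat_add)
  then have "(of_nat i :: 'a) = of_nat j \<longleftrightarrow> p dvd j - i"
    by (simp add: of_nat_eq_0_iff_dvd)
  then show ?case using le mod_eq_dvd_iff_nat[of i j p] by auto
qed auto

lemma of_nat_pth_power [simp]: "(of_nat i :: 'a) ^ p = of_nat i"
  by (rule ringmap_of_nat[OF ringmap_pth_power])

lemma of_nat_eq_0_lt: "i < p \<Longrightarrow> (of_nat i :: 'a) = 0 \<longleftrightarrow> i = 0"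
  by (auto simp: of_nat_eq_0_iff_dvd dest: dvd_imp_le)

text \<open>Both sides are monic of degree \<open>p\<close> in \<open>x\<close> and vanish on the prime field.\<close>

lemma prod_minus_of_nat: "(\<Prod>j<p. (x :: 'a) - of_nat j) = x ^ p - x"
proof -
  define q :: "'a poly" where "q = monom 1 p - monom 1 1 - (\<Prod>j<p. [:- of_nat j, 1:])"
  have roots: "poly q (of_nat i) = 0" if "i < p" for i
  proof -
    have "(\<Prod>j<p. (of_nat i :: 'a) - of_nat j) = 0" using that by (intro prod_zero) auto
    then show ?thesis by (simp add: q_def poly_monom poly_prod)
  qed
  have inj: "inj_on (of_nat :: nat \<Rightarrow> 'a) {..<p}"
    by (rule inj_onI) (auto simp: of_nat_eq_iff_mod)
  have "q = 0"
  proof (rule ccontr)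
    assume "q \<noteq> 0"
    have "degree (\<Prod>j<p. [:- of_nat j :: 'a, 1:]) = p" by (simp add: degree_prod_eq_sum_degree)
    moreover have "lead_coeff (\<Prod>j<p. [:- of_nat j :: 'a, 1:]) = 1" by (simp add: lead_coeff_prod)
    ultimately have "coeff q p = 0" using p_gt_1 by (simp add: q_def)
    moreover have "degree q \<le> p"
      unfolding q_def using p_gt_1 \<open>degree (\<Prod>j<p. [:- of_nat j :: 'a, 1:]) = p\<close>
      by (intro degree_diff_le) (auto simp: degree_monom_eq)
    ultimately have "degree q < p"
      using \<open>q \<noteq> 0\<close> by (metis leading_coeff_0_iff nat_less_le)
    moreover have "card (of_nat ` {..<p} :: 'a set) \<le> card {x. poly q x = 0}"
      by (intro card_mono poly_roots_finite[OF \<open>q \<noteq> 0\<close>]) (auto simp: roots)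
    ultimately show False
      using card_poly_roots_bound[OF \<open>q \<noteq> 0\<close>] card_image[OF inj] by simp
  qed
  then have "poly q x = 0" by simp
  then show ?thesis by (simp add: q_def poly_monom poly_prod)
qed

text \<open>The factors commute and \<open>c \<mapsto> c k\<close> permutes the residues modulo \<open>p\<close>.\<close>

lemma falling_permute:
  fixes T :: "'a \<Rightarrow> 'a"
  assumes add: "\<And>x y. T (x + y) = T x + T y" and nat: "\<And>n y. T (of_nat n * y) = of_nat n * T y"
    and k: "\<not> p dvd k"
  shows "falling T p y = fold (\<lambda>c y. T y - of_nat (c * k) * y) [0..<p] y"
proof -
  let ?f = "\<lambda>c y. T y - of_nat c * y"
  have min: "T (- x) = - T x" for x using add[of x "- x"] add[of 0 0] by (simp add: eq_neg_iff_add_eq_0 add.commute)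
  have diff: "T (x - y) = T x - T y" for x y using add[of x "- y"] min[of y] by simp
  have nat': "T (y * of_nat n) = of_nat n * T y" for n y by (metis nat mult.commute)
  have comm: "?f c \<circ> ?f d = ?f d \<circ> ?f c" for c d
    by (rule ext) (simp add: diff nat nat' algebra_simps)
  have inj: "inj_on (\<lambda>j. j * k mod p) {0..<p}"
  proof (rule inj_onI)
    fix i j assume ij: "i \<in> {0..<p}" "j \<in> {0..<p}" "i * k mod p = j * k mod p"
    then have "(of_nat i :: 'a) * of_nat k = of_nat j * of_nat k"
      by (simp only: of_nat_eq_iff_mod flip: of_nat_mult)
    moreover have "(of_nat k :: 'a) \<noteq> 0" using k of_nat_eq_0_iff_dvd by blast
    ultimately have "(of_nat i :: 'a) = of_nat j" by simp
    then show "i = j" using ij by (simp add: of_nat_eq_iff_mod)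
  qed
  have "(\<lambda>j. j * k mod p) ` {0..<p} = {0..<p}"
    by (rule card_subset_eq) (auto simp: card_image[OF inj])
  then have "mset (map (\<lambda>j. j * k mod p) [0..<p]) = mset [0..<p]"
    using inj by (intro set_eq_iff_mset_eq_distinct[THEN iffD1]) (auto simp: distinct_map)
  then have "fold ?f [0..<p] = fold ?f (map (\<lambda>j. j * k mod p) [0..<p])"
    by (intro fold_multiset_equiv) (auto simp: comm)
  then show ?thesis by (simp add: falling_eq_fold fold_map comp_def)
qed

end

locale p_basis_level = p_basis p ty B for p :: nat and ty :: "'a::field itself" and B +
  fixes N :: nat assumes N_pos: "N > 0"
begin

text \<open>The derivation \<open>b d/db\<close> of the field. It does not depend on the lift by \<open>ev_log_deriv_vfil\<close>,
  for which the level has to be positive.\<close>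

definition der :: "'a \<Rightarrow> 'a \<Rightarrow> 'a" where
  "der b x = res' N (log_deriv b (lift N x))"

lemma der_res: "der b (res' N P) = res' N (log_deriv b P)"
proof -
  have "ev' N (lift N (res' N P) - P) \<in> vfil (Suc 0)"
    using res_lift[of N "res' N P"] by (simp add: vfil_Suc_0 ev_simps wcomp0_simps res_def)
  then have "ev' N (log_deriv b (lift N (res' N P) - P)) \<in> vfil (Suc 0)"
    by (intro ev_log_deriv_vfil) (use N_pos in auto)
  then show ?thesis
    by (simp add: der_def vfil_Suc_0 log_deriv_diff ev_simps wcomp0_simps res_def)
qed

lemma der_add: "der b (x + y) = der b x + der b y"
  by (metis der_res res_lift log_deriv_add res_simps(2))

lemma der_mult: "der b (x * y) = der b x * y + x * der b y"
proof -
  have "der b (res' N (lift N x * lift N y)) = res' N (log_deriv b (lift N x)) * y + x * res' N (log_deriv b (lift N y))"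
    unfolding der_res log_deriv_mult by (simp add: res_simps)
  then show ?thesis by (simp add: res_simps der_def)
qed

lemma der_zero [simp]: "der b 0 = 0"
  using der_add[of b 0 0] by (metis add_0 add_cancel_right_right)

lemma der_one [simp]: "der b 1 = 0"
  using der_mult[of b 1 1] by (metis add_cancel_right_right mult_1 mult_1_right)

lemma der_uminus: "der b (- x) = - der b x"
  using der_add[of b x "- x"] by (simp add: eq_neg_iff_add_eq_0 add.commute)

lemma der_diff: "der b (x - y) = der b x - der b y"
  using der_add[of b x "- y"] by (simp add: der_uminus)

lemma der_sum: "der b (sum f S) = (\<Sum>i\<in>S. der b (f i))"
  by (induction S rule: infinite_finite_induct) (simp_all add: der_add)

lemma der_of_nat [simp]: "der b (of_nat n) = 0"
  by (induction n) (simp_all add: der_add)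

lemma der_power: "der b (x ^ n) = of_nat n * x ^ (n - 1) * der b x"
proof (induction n)
  case (Suc n)
  then show ?case by (cases n) (simp_all add: der_mult algebra_simps)
qed simp

lemma der_pth_power [simp]: "der b (x ^ p) = 0"
  by (simp add: der_power)

lemma der_pth_power_mult [simp]: "der b (x ^ p * y) = x ^ p * der b y"
  by (simp add: der_mult)

lemma der_inverse:
  assumes "x \<noteq> 0" shows "der b (inverse x) = - der b x / x ^ 2"
proof -
  have "x * der b (inverse x) = - (der b x * inverse x)"
    using der_mult[of b x "inverse x"] assms by (simp add: eq_neg_iff_add_eq_0 add.commute)
  then have "inverse x * (x * der b (inverse x)) = inverse x * - (der b x * inverse x)" by simp
  moreover have "inverse x * (x * d) = d" for d using assms by (simp flip: mult.assoc)
  ultimately show ?thesis by (simp add: divide_inverse power2_eq_square)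
qed

lemma der_commute: "der b (der c x) = der c (der b x)"
  by (metis der_res res_lift log_deriv_commute)

lemma of_nat_pth_power_funpow [simp]: "(of_nat i :: 'a) ^ (p ^ k) = of_nat i"
  by (rule ringmap_of_nat[OF ringmap_pth_power_funpow])

lemma der_mon: "Poly_Mapping.keys e \<subseteq> B \<Longrightarrow> der b (mon (\<lambda>v. v) e) = of_nat (Poly_Mapping.lookup e b) * mon (\<lambda>v. v) e"
  using der_res[of b "Poly_Mapping.single e 1"]
  by (simp add: res_single log_deriv_single mon_bvar wcomp0_simps)

lemma der_basis: "c \<in> B \<Longrightarrow> der b c = (if b = c then c else 0)"
  using der_mon[of "Poly_Mapping.single c 1" b] by (auto simp: lookup_single)

lemma der_res_single: "der b (res' N (Poly_Mapping.single M c)) = of_nat (Poly_Mapping.lookup M b) * res' N (Poly_Mapping.single M c)"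
  by (simp only: der_res log_deriv_single) (simp add: res_single wcomp0_simps power_mult_distrib)

text \<open>The field is additively generated by joint eigenvectors of the derivations, namely multiples of
  monomials by \<open>p\<close>-th powers.\<close>

lemma field_induct [case_names eigen add]:
  assumes "\<And>u k. (\<And>b. der b u = of_nat (k b) * u) \<Longrightarrow> Q u" "\<And>u v. Q u \<Longrightarrow> Q v \<Longrightarrow> Q (u + v)"
  shows "Q x"
proof -
  have "Q (res' N P)" for P
  proof (induction P rule: poly_induct)
    case zero then show ?case by (intro assms(1)[of _ "\<lambda>_. 0"]) (simp add: res_simps)
  next
    case (single M c) then show ?case by (intro assms(1)) (rule der_res_single)
  next
    case (add P Q) then show ?case by (simp add: res_simps assms(2))
  qed
  then show ?thesis by (metis res_lift)
qed

lemma der_funpow_add: "(der b ^^ n) (x + y) = (der b ^^ n) x + (der b ^^ n) y"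
  by (induction n) (simp_all add: der_add)

lemma der_funpow_eigen: "der b u = of_nat k * u \<Longrightarrow> (der b ^^ n) u = of_nat k ^ n * u"
  by (induction n) (simp_all add: der_mult der_power)

lemma der_funpow_p: "(der b ^^ p) x = der b x"
proof (induction x rule: field_induct)
  case (eigen u k)
  show ?case using der_funpow_eigen[OF eigen[of b], of p] eigen[of b] by simp
qed (simp add: der_funpow_add der_add)

text \<open>Modulo \<open>p\<close> only the outer binomial coefficients survive.\<close>

lemma falling_binomial_p:
  fixes A C U :: "'a \<Rightarrow> 'a"
  assumes "\<And>g y. C (g * y) = A g * y + g * U y"
    and "\<And>x y. C (x + y) = C x + C y" "\<And>n y. C (of_nat n * y) = of_nat n * C y"
  shows "falling C p (g * y) = falling A p g * y + g * falling U p y"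
proof -
  have "falling C p (g * y) = (\<Sum>k\<le>p. of_nat (p choose k) * (falling A k g * falling U (p - k) y))"
    by (rule falling_Leibniz[OF assms])
  also have "\<dots> = (\<Sum>k\<in>{0, p}. of_nat (p choose k) * (falling A k g * falling U (p - k) y))"
  proof (intro sum.mono_neutral_right ballI)
    fix k assume "k \<in> {..p} - {0, p}"
    then have "p dvd (p choose k)" using prime_p by (intro dvd_choose_prime) auto
    then have "(of_nat (p choose k) :: 'a) = 0" using of_nat_eq_0_iff_char_dvd char_eq by blast
    then show "of_nat (p choose k) * (falling A k g * falling U (p - k) y) = 0" by simp
  qed auto
  also have "\<dots> = falling A p g * y + g * falling U p y" using p_gt_0 by simp
  finally show ?thesis .
qed

text \<open>A connection of rank one in the direction \<open>b\<close>. Its \<open>p\<close>-curvature is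
  \<open>falling (connection b u) p\<close>, because \<open>der b\<close> satisfies \<open>D^p = D\<close>.\<close>

definition connection :: "'a \<Rightarrow> 'a \<Rightarrow> 'a \<Rightarrow> 'a" where
  "connection b u y = der b y + u * y"

lemma connection_add: "connection b u (x + y) = connection b u x + connection b u y"
  and connection_of_nat: "connection b u (of_nat n * y) = of_nat n * connection b u y"
  and connection_mult: "connection b (u + v) (g * y) = connection b v g * y + g * connection b u y"
  by (simp_all add: connection_def der_add der_mult algebra_simps)

text \<open>The \<open>p\<close>-curvature is linear over the field. For \<open>u = 0\<close> it vanishes on eigenvectors.\<close>

lemma falling_connection_eq: "falling (connection b u) p y = falling (connection b u) p 1 * y"
proof -
  have z: "falling (connection b 0) p y = 0"
  proof (induction y rule: field_induct)
    case (eigen u k)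
    have "falling (connection b 0) n u = (\<Prod>j<n. of_nat (k b) - of_nat j) * u" for n
    proof (induction n)
      case (Suc n)
      have "der b (\<Prod>j<n. of_nat (k b) - of_nat j) = 0"
        by (induction n) (simp_all add: der_mult der_diff)
      then show ?case unfolding falling.simps Suc by (simp add: connection_def der_mult eigen algebra_simps)
    qed simp
    then show ?case by (simp add: prod_minus_of_nat)
  next
    case (add x y)
    have "falling (connection b 0) n (x + y) = falling (connection b 0) n x + falling (connection b 0) n y" for n
      by (induction n) (simp_all add: connection_add algebra_simps)
    then show ?case using add by simp
  qed
  have "falling (connection b (0 + u)) p (1 * y) = falling (connection b u) p 1 * y + 1 * falling (connection b 0) p y"
    by (rule falling_binomial_p[OF connection_mult connection_add connection_of_nat])
  then show ?thesis by (simp add: z)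
qed

lemma falling_connection_add: "falling (connection b (u + v)) p 1 = falling (connection b u) p 1 + falling (connection b v) p 1"
proof -
  have "falling (connection b (u + v)) p (1 * 1) = falling (connection b v) p 1 * 1 + 1 * falling (connection b u) p 1"
    by (rule falling_binomial_p[OF connection_mult connection_add connection_of_nat])
  then show ?thesis by (simp add: add.commute)
qed

text \<open>Jacobson's formula. Both sides are additive in \<open>u\<close>, so \<open>u\<close> may be an eigenvector, with
  eigenvalue \<open>k\<close>. If \<open>k = 0\<close> in the field, \<open>u\<close> behaves like a constant and \<open>prod_minus_of_nat\<close>
  applies. Otherwise the product may be taken over the multiples of \<open>k\<close>, and each factor just
  multiplies by \<open>u\<close>.\<close>

lemma falling_connection_one: "falling (connection b u) p 1 = u ^ p - u + (der b ^^ (p - 1)) u"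
proof (induction u rule: field_induct)
  case (eigen u k)
  show ?case
  proof (cases "p dvd k b")
    case True
    then have d: "der b u = 0" using eigen[of b] of_nat_eq_0_iff_char_dvd[where 'a='a] char_eq by simp
    have "falling (connection b u) n 1 = (\<Prod>j<n. u - of_nat j)" for n
    proof (induction n)
      case (Suc n)
      have "der b (\<Prod>j<n. u - of_nat j) = 0"
        by (induction n) (simp_all add: der_mult der_diff d)
      then show ?case unfolding falling.simps Suc by (simp add: connection_def algebra_simps)
    qed simp
    moreover have "(der b ^^ (p - 1)) u = 0"
      using p_gt_1 d der_funpow_eigen[of b u 0 "p - 1"] by (simp add: zero_power)
    ultimately show ?thesis by (simp add: prod_minus_of_nat)
  next
    case False
    have "fold (\<lambda>c y. connection b u y - of_nat (c * k b) * y) [0..<n] 1 = u ^ n" for n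
      by (induction n) (simp_all add: connection_def der_power eigen algebra_simps, case_tac n, simp_all add: algebra_simps)
    then have "falling (connection b u) p 1 = u ^ p"
      using falling_permute[of "connection b u" "k b" 1, OF connection_add connection_of_nat False] by simp
    moreover have "(of_nat (k b) :: 'a) ^ (p - 1) = 1"
    proof -
      have "(of_nat (k b) :: 'a) * of_nat (k b) ^ (p - 1) = of_nat (k b)"
        using of_nat_pth_power[of "k b"] p_gt_0 by (metis Suc_diff_1 power_Suc)
      moreover have "(of_nat (k b) :: 'a) \<noteq> 0" using False of_nat_eq_0_iff_char_dvd[where 'a='a] char_eq by simp
      ultimately show ?thesis by simp
    qed
    ultimately show ?thesis using der_funpow_eigen[of b u "k b" "p - 1"] eigen[of b] by simp
  qed
next
  case (add u v)
  then show ?case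
    by (simp add: falling_connection_add der_funpow_add ringmap_add[OF ringmap_pth_power])
qed

text \<open>By Jacobson's formula and \<open>D^p = D\<close>, the \<open>p\<close>-curvature of \<open>D - \<theta>\<close> vanishes if \<open>\<theta>\<close> is fixed by
  the Cartier operator.\<close>

lemma falling_connection_zero:
  assumes "\<theta> = \<theta> ^ p + der b g" shows "falling (connection b (- \<theta>)) p y = 0"
proof -
  have "falling (connection b (\<theta> + - \<theta>)) p 1 = falling (connection b \<theta>) p 1 + falling (connection b (- \<theta>)) p 1" by (rule falling_connection_add)
  moreover have "falling (connection b 0) p 1 = 0" using falling_connection_add[of b 0 0] by (metis add_0 add_cancel_right_right)
  ultimately have "falling (connection b (- \<theta>)) p 1 = - falling (connection b \<theta>) p 1" by (simp add: eq_neg_iff_add_eq_0 add.commute)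
  also have "falling (connection b \<theta>) p 1 = 0"
  proof -
    obtain m where m: "p - 1 = Suc m" using p_ge_2 by (cases "p - 1") auto
    have 0: "(der b ^^ n) 0 = 0" for n by (induction n) simp_all
    have "(der b ^^ (p - 1)) (\<theta> ^ p) = 0" unfolding m by (simp only: funpow_Suc_right comp_apply der_pth_power 0)
    moreover have "(der b ^^ (p - 1)) (der b g) = der b g"
      using der_funpow_p[of b g] p_gt_0 by (metis Suc_diff_1 comp_apply funpow_Suc_right)
    ultimately have "(der b ^^ (p - 1)) \<theta> = der b g"
      by (subst assms) (simp add: der_funpow_add)
    then show ?thesis unfolding falling_connection_one using assms by (simp add: algebra_simps)
  qed
  finally show ?thesis using falling_connection_eq[of b "- \<theta>" y] by simp
qed

text \<open>The theorem of Jacobson and Cartier: a form \<open>\<theta>\<close> fixed by the Cartier operator is logarithmic.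
  The function \<open>f\<close> is adjusted in one direction \<open>b\<close> after the other. The falling factorials of
  \<open>D - \<theta>\<close> applied to \<open>f\<close> eventually vanish, since the \<open>p\<close>-curvature does; the last nonzero one
  satisfies \<open>D y = (\<theta> + j) y\<close>, and \<open>y b^(-j)\<close> is the new \<open>f\<close>. The other directions are not
  disturbed, since fixed forms are closed.\<close>

lemma jacobson_cartier:
  assumes "finite {b \<in> S. \<theta> b \<noteq> 0}" "S \<subseteq> B" "\<And>b. b \<in> S \<Longrightarrow> \<theta> b = \<theta> b ^ p + der b g"
  shows "\<exists>f. f \<noteq> 0 \<and> (\<forall>b\<in>S. der b f = \<theta> b * f)"
proof -
  \<comment> \<open>A form that is fixed by the Cartier operator is closed.\<close>
  have closed: "der c (\<theta> b) = der b (\<theta> c)" if "b \<in> S" "c \<in> S" for b c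
    using that assms(3)[of b] assms(3)[of c] by (metis add_0 der_add der_commute der_pth_power)
  have "\<exists>f. f \<noteq> 0 \<and> (\<forall>b\<in>S - R. der b f = \<theta> b * f)" if "finite Y" "R = {b \<in> S. \<theta> b \<noteq> 0} - Y" "Y \<subseteq> S" for Y R
    using that
  proof (induction Y arbitrary: R rule: finite_induct)
    case empty
    show ?case by (rule exI[of _ 1]) (use empty in auto)
  next
    case (insert b Y)
    obtain f where f: "f \<noteq> 0" "\<And>c. c \<in> S \<Longrightarrow> \<theta> c = 0 \<or> c \<in> Y \<Longrightarrow> der c f = \<theta> c * f"
      using insert by auto
    have bS: "b \<in> S" "b \<in> B" using insert assms(2) by auto
    define y where "y = (\<lambda>n. falling (connection b (- \<theta> b)) n f)"
    have yp: "y p = 0" unfolding y_def by (rule falling_connection_zero[OF assms(3)[OF bS(1)]])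
    have y0: "y 0 \<noteq> 0" using f by (simp add: y_def)
    \<comment> \<open>The last nonzero member \<open>y j\<close> of the sequence is an eigenvector of \<open>der b - \<theta> b\<close> with
       eigenvalue \<open>j\<close>.\<close>
    define n where "n = (LEAST n. y n = 0)"
    have yn: "y n = 0" unfolding n_def by (rule LeastI[of _ p]) (rule yp)
    then obtain j where j: "n = Suc j" using y0 by (cases n) auto
    have yj: "y j \<noteq> 0" using not_less_Least[of j "\<lambda>n. y n = 0"] j n_def by auto
    have ycl: "der c (y i) = \<theta> c * y i" if c: "c \<in> S" "\<theta> c = 0 \<or> c \<in> Y" for c i
    proof (induction i)
      case (Suc i)
      have "der c (der b (y i)) = der b (\<theta> c * y i)" using Suc by (metis der_commute)
      then have "der c (y (Suc i)) = \<theta> c * y (Suc i)"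
        using Suc closed[OF bS(1) c(1)] by (simp add: y_def connection_def der_mult der_diff der_add der_uminus algebra_simps)
      then show ?case .
    qed (use f c in \<open>simp add: y_def\<close>)
    have db: "der b (y j) = (\<theta> b + of_nat j) * y j"
      using yn unfolding j by (simp add: y_def connection_def algebra_simps)
    have b0: "b \<noteq> 0"
    proof
      assume "b = 0"
      have "(1 :: 'a) = 0"
        by (rule indep[where E = "{Poly_Mapping.single b 1}" and c = "\<lambda>_. 1" and e = "Poly_Mapping.single b 1"])
           (use bS p_gt_1 \<open>b = 0\<close> in \<open>auto simp: lookup_single when_def\<close>)
      then show False by simp
    qed
    \<comment> \<open>Dividing by \<open>b^j\<close> shifts the eigenvalue in the direction \<open>b\<close> only.\<close>
    define f' where "f' = y j * inverse b ^ j"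
    have dinv: "der b (inverse b) = - inverse b"
      using der_basis[of b b] bS b0 der_inverse[of b b] by (simp add: field_simps power2_eq_square)
    have dbj: "der b (inverse b ^ j) = - of_nat j * inverse b ^ j"
      unfolding der_power dinv by (cases j) (simp_all add: algebra_simps)
    have "der b f' = \<theta> b * f'"
      by (simp add: f'_def der_mult db dbj algebra_simps)
    moreover have "der c f' = \<theta> c * f'" if c: "c \<in> S" "\<theta> c = 0 \<or> c \<in> Y" "c \<noteq> b" for c
    proof -
      have "der c (inverse b ^ j) = 0"
        using der_basis[of b c] bS b0 der_inverse[of b c] c by (simp add: der_power)
      then show ?thesis by (simp add: f'_def der_mult ycl[OF c(1,2)])
    qed
    moreover have "f' \<noteq> 0" using yj b0 by (simp add: f'_def)
    ultimately show ?case using insert by (intro exI[of _ f']) auto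
  qed
  from this[OF assms(1), of "{}"] show ?thesis by auto
qed

text \<open>Conversely, logarithmic forms are fixed by the Cartier operator.\<close>

lemma der_inverse_cartier:
  assumes "f \<noteq> 0" shows "\<exists>z. \<forall>b. (der b f / f) ^ p - der b f / f = der b z"
proof -
  obtain z where z: "\<And>b. res' N (log_deriv b (lift N f)) ^ p = res' N (lift N f) ^ (p - 1) * res' N (log_deriv b (lift N f)) + res' N (log_deriv b z)"
    using res_inverse_cartier by blast
  have z: "der b f ^ p = f ^ (p - 1) * der b f + der b (res' N z)" for b
    unfolding der_res using z[of b] by (simp add: der_def)
  have "(der b f / f) ^ p - der b f / f = der b (inverse f ^ p * res' N z)" for b
  proof -
    have "f ^ p = f * f ^ (p - 1)" using p_gt_0 by (metis Suc_diff_1 power_Suc)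
    then have "(der b f / f) ^ p = der b f / f + inverse f ^ p * der b (res' N z)"
      using assms by (simp add: power_divide z field_simps)
    then show ?thesis by simp
  qed
  then show ?thesis by blast
qed

text \<open>In the expansion of \<open>x\<close> the derivation \<open>der b\<close> multiplies the term of \<open>e\<close> by \<open>e_b\<close>, so a
  nonzero term has no exponent outside \<open>B0\<close>.\<close>

lemma der_zero_span:
  assumes "\<And>b. b \<in> B - B0 \<Longrightarrow> der b x = 0"
  shows "\<exists>E c. finite E \<and> (\<forall>e\<in>E. Poly_Mapping.keys e \<subseteq> B \<inter> B0) \<and> x = (\<Sum>e\<in>E. c e ^ p * mon (\<lambda>v. v) e)"
proof -
  obtain E c where E': "finite E" "\<forall>e\<in>E. Poly_Mapping.keys e \<subseteq> B"
    "\<forall>e\<in>E. \<forall>v. Poly_Mapping.lookup e v < p" "x = (\<Sum>e\<in>E. c e ^ p * mon (\<lambda>v. v) e)"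
    using spanning[of x] by blast
  then have E: "finite E" "\<And>e. e \<in> E \<Longrightarrow> Poly_Mapping.keys e \<subseteq> B"
    "\<And>e v. e \<in> E \<Longrightarrow> Poly_Mapping.lookup e v < p" "x = (\<Sum>e\<in>E. c e ^ p * mon (\<lambda>v. v) e)"
    by auto
  have z: "c e = 0 \<or> Poly_Mapping.lookup e b = 0" if "e \<in> E" "b \<in> B - B0" for e b
  proof -
    have "(\<Sum>e\<in>E. (of_nat (Poly_Mapping.lookup e b) * c e) ^ p * mon (\<lambda>v. v) e) = der b x"
      unfolding E(4) der_sum
      by (intro sum.cong) (simp_all add: der_mon E(2) power_mult_distrib algebra_simps)
    then have "(\<Sum>e\<in>E. (of_nat (Poly_Mapping.lookup e b) * c e) ^ p * mon (\<lambda>v. v) e) = 0"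
      using assms[OF that(2)] by simp
    from indep[OF E(1) E(2) E(3) this that(1)]
    have "of_nat (Poly_Mapping.lookup e b) * c e = 0" .
    then show ?thesis using of_nat_eq_0_lt[OF E(3)[OF that(1), of b]] by auto
  qed
  let ?E = "{e \<in> E. c e \<noteq> 0}"
  have "x = (\<Sum>e\<in>?E. c e ^ p * mon (\<lambda>v. v) e)"
    unfolding E(4) using E(1) by (intro sum.mono_neutral_right) (auto simp: zero_power)
  moreover have "Poly_Mapping.keys e \<subseteq> B \<inter> B0" if "e \<in> ?E" for e
    using that z[of e] E(2)[of e] by (auto simp: in_keys_iff)
  ultimately show ?thesis using E(1) by (intro exI[of _ ?E] exI[of _ c]) auto
qed

lemma der_zero_pth_power:
  assumes "\<And>b. b \<in> B \<Longrightarrow> der b x = 0" shows "\<exists>y. x = y ^ p"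
proof -
  obtain E c where E: "finite E" "\<forall>e\<in>E. Poly_Mapping.keys e \<subseteq> B \<inter> {}" "x = (\<Sum>e\<in>E. c e ^ p * mon (\<lambda>v. v) e)"
    using der_zero_span[of "{}" x] assms by auto
  have "x = (\<Sum>e\<in>E. c e ^ p)" unfolding E(3) using E(2) by (intro sum.cong) (auto simp: mon_def)
  also have "\<dots> = (\<Sum>e\<in>E. c e) ^ p" by (simp add: ringmap_sum[OF ringmap_pth_power])
  finally show ?thesis by blast
qed

end

section \<open>Symbols and their logarithmic forms\<close>

type_synonym 'a symb = "('a witt \<times> 'a) \<Rightarrow>\<^sub>0 int"

abbreviation sy :: "'a witt \<Rightarrow> 'a \<Rightarrow> 'a symb" where
  "sy w b \<equiv> frag_of (w, b)"

text \<open>Relations between symbols of Witt vectors of infinite length. With \<open>Rel_trunc\<close> they describe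
  the group of symbols of length \<open>k\<close>, and the shift becomes an operation on one and the same set
  of formal sums for all \<open>k\<close>.\<close>

inductive_set Rel :: "nat \<Rightarrow> 'a::field symb set" for k :: nat where
  Rel_zero: "0 \<in> Rel k"
| Rel_add: "x \<in> Rel k \<Longrightarrow> y \<in> Rel k \<Longrightarrow> x + y \<in> Rel k"
| Rel_uminus: "x \<in> Rel k \<Longrightarrow> - x \<in> Rel k"
| Rel_left: "b \<noteq> 0 \<Longrightarrow> sy (w + w') b - sy w b - sy w' b \<in> Rel k"
| Rel_right: "b \<noteq> 0 \<Longrightarrow> b' \<noteq> 0 \<Longrightarrow> sy w (b * b') - sy w b - sy w b' \<in> Rel k"
| Rel_self: "b \<noteq> 0 \<Longrightarrow> sy ((verschiebung ^^ i) (teich b)) b \<in> Rel k"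
| Rel_frobenius: "b \<noteq> 0 \<Longrightarrow> sy (frobenius w - w) b \<in> Rel k"
| Rel_trunc: "b \<noteq> 0 \<Longrightarrow> sy ((verschiebung ^^ k) w) b \<in> Rel k"

definition linear_ext :: "('s \<Rightarrow> 'r::comm_ring_1) \<Rightarrow> ('s \<Rightarrow>\<^sub>0 int) \<Rightarrow> 'r" where
  "linear_ext L x = (\<Sum>s\<in>Poly_Mapping.keys x. of_int (Poly_Mapping.lookup x s) * L s)"

lemma linear_ext_superset:
  assumes "finite S" "Poly_Mapping.keys x \<subseteq> S"
  shows "linear_ext L x = (\<Sum>s\<in>S. of_int (Poly_Mapping.lookup x s) * L s)"
  unfolding linear_ext_def using assms by (intro sum.mono_neutral_left) (auto simp: in_keys_iff)

lemma linear_ext_zero [simp]: "linear_ext L 0 = 0"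
  by (simp add: linear_ext_def)

lemma linear_ext_add: "linear_ext L (x + y) = linear_ext L x + linear_ext L y"
proof -
  let ?S = "Poly_Mapping.keys x \<union> Poly_Mapping.keys y"
  have "linear_ext L (x + y) = (\<Sum>s\<in>?S. of_int (Poly_Mapping.lookup (x + y) s) * L s)"
    by (rule linear_ext_superset) (auto simp: keys_add)
  also have "\<dots> = linear_ext L x + linear_ext L y"
    by (simp add: linear_ext_superset[of ?S x] linear_ext_superset[of ?S y] lookup_add algebra_simps sum.distrib)
  finally show ?thesis .
qed

lemma linear_ext_uminus: "linear_ext L (- x) = - linear_ext L x"
  using linear_ext_add[of L x "- x"] by (simp add: eq_neg_iff_add_eq_0 add.commute)

lemma linear_ext_diff: "linear_ext L (x - y) = linear_ext L x - linear_ext L y"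
  using linear_ext_add[of L x "- y"] by (simp add: linear_ext_uminus)

lemma linear_ext_frag_of [simp]: "linear_ext L (frag_of s) = L s"
  by (simp add: linear_ext_def)

lemma linear_ext_sum: "linear_ext L (sum f S) = (\<Sum>i\<in>S. linear_ext L (f i))"
  by (induction S rule: infinite_finite_induct) (simp_all add: linear_ext_add)

context char_p
begin

text \<open>The coefficients \<open>p^i / (i + 1)\<close> of the series \<open>log (1 + p r) / p\<close> are integral at \<open>p\<close>; as only
  their values modulo \<open>p^k\<close> matter, they can be replaced by integers.\<close>

lemma exists_log_coeff: "\<exists>c d. int (Suc i) * c = int p ^ i + int p ^ k * d"
proof -
  obtain w where w: "w \<le> k" "gcd (Suc i) (p ^ k) = p ^ w"
    using divides_primepow_nat[OF prime_p, of "gcd (Suc i) (p ^ k)" k] by auto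
  have "w < p ^ w" using p_gt_1 by (intro power_gt_expt) simp
  also have "p ^ w \<le> Suc i" using w(2) by (metis gcd_dvd1 dvd_imp_le zero_less_Suc)
  finally have "p ^ w dvd p ^ i" by (simp add: le_imp_power_dvd)
  then have "gcd (int (Suc i)) (int (p ^ k)) dvd int (p ^ i)"
    using w(2) by (metis gcd_int_int_eq int_dvd_int_iff)
  then obtain m where m: "int (p ^ i) = gcd (int (Suc i)) (int (p ^ k)) * m" by blast
  obtain u v where uv: "u * int (Suc i) + v * int (p ^ k) = gcd (int (Suc i)) (int (p ^ k))"
    using bezout_int by blast
  have "int (Suc i) * (u * m) = int p ^ i + int p ^ k * (- v * m)"
    using m unfolding uv[symmetric] by (simp add: algebra_simps)
  then show ?thesis by blast
qed

end

context p_basis_level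
begin

text \<open>The kernel of evaluation in Witt vectors of length \<open>k\<close>. Modulo \<open>eval_ideal k\<close> the polynomials
  are flat over the integers modulo \<open>p^k\<close>, by \<open>eval_ideal_p\<close>.\<close>

definition eval_ideal :: "nat \<Rightarrow> ('a, 'a) wpoly set" where
  "eval_ideal k = {a. ev' N a \<in> vfil k}"

lemma eval_ideal_zero [simp]: "0 \<in> eval_ideal k"
  by (simp add: eval_ideal_def ev_simps)

lemma eval_ideal_add: "a \<in> eval_ideal k \<Longrightarrow> b \<in> eval_ideal k \<Longrightarrow> a + b \<in> eval_ideal k"
  by (simp add: eval_ideal_def ev_simps vfil_add)

lemma eval_ideal_uminus: "a \<in> eval_ideal k \<Longrightarrow> - a \<in> eval_ideal k"
  by (simp add: eval_ideal_def ev_simps vfil_uminus)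

lemma eval_ideal_diff: "a \<in> eval_ideal k \<Longrightarrow> b \<in> eval_ideal k \<Longrightarrow> a - b \<in> eval_ideal k"
  by (simp add: eval_ideal_def ev_simps vfil_diff)

lemma eval_ideal_mult: "a \<in> eval_ideal k \<Longrightarrow> a * c \<in> eval_ideal k" and eval_ideal_mult': "a \<in> eval_ideal k \<Longrightarrow> c * a \<in> eval_ideal k"
  by (simp_all add: eval_ideal_def ev_simps vfil_mult vfil_mult')

lemma eval_ideal_sum: "(\<And>i. i \<in> S \<Longrightarrow> f i \<in> eval_ideal k) \<Longrightarrow> sum f S \<in> eval_ideal k"
  by (induction S rule: infinite_finite_induct) (simp_all add: eval_ideal_add)

lemma eval_ideal_mono: "j \<le> k \<Longrightarrow> a \<in> eval_ideal k \<Longrightarrow> a \<in> eval_ideal j"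
  by (auto simp: eval_ideal_def vfil_mono)

lemma eval_ideal_log_deriv: "k \<le> N \<Longrightarrow> a \<in> eval_ideal k \<Longrightarrow> log_deriv b a \<in> eval_ideal k"
  by (simp add: eval_ideal_def ev_log_deriv_vfil)

lemma eval_ideal_phi: "a \<in> eval_ideal k \<Longrightarrow> phi a \<in> eval_ideal k"
  by (simp add: eval_ideal_def ev_phi vfil_frobenius)

lemma eval_ideal_p: "of_nat p * a \<in> eval_ideal (Suc k) \<longleftrightarrow> a \<in> eval_ideal k"
  by (simp add: eval_ideal_def ev_simps vfil_p_mult)

lemma eval_ideal_p_power: "of_nat p ^ k * a \<in> eval_ideal k"
  by (simp add: eval_ideal_def ev_simps vfil_mult[OF vfil_p_power])

lemma eval_ideal_Suc_0: "a \<in> eval_ideal (Suc 0) \<longleftrightarrow> res' N a = 0"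
  by (simp add: eval_ideal_def vfil_Suc_0 res_def)

lemma eval_ideal_trans: "a - b \<in> eval_ideal k \<Longrightarrow> b - c \<in> eval_ideal k \<Longrightarrow> a - c \<in> eval_ideal k"
  using eval_ideal_add[of "a - b" k "b - c"] by simp

lemma eval_ideal_power_one: "a - 1 \<in> eval_ideal k \<Longrightarrow> a ^ n - 1 \<in> eval_ideal k"
proof (induction n)
  case (Suc n)
  have e: "a ^ Suc n - 1 = a * (a ^ n - 1) + (a - 1)" by (simp add: algebra_simps)
  show ?case unfolding e using Suc by (intro eval_ideal_add eval_ideal_mult') auto
qed simp

lemma inverse_exists:
  assumes "res' N a \<noteq> 0" shows "\<exists>a'. a * a' - 1 \<in> eval_ideal k"
proof -
  define c where "c = lift N (inverse (res' N a))"
  have "res' N (a * c) = 1" using assms by (simp add: c_def res_simps)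
  then have "ev' N (a * c) - 1 \<in> vfil (Suc 0)" by (simp add: vfil_Suc_0 wcomp0_simps res_def)
  then have "ev' N (a * c) ^ (p ^ k) - 1 ^ (p ^ k) \<in> vfil (Suc k)" by (rule vfil_power_cong)
  then have "(a * c) ^ (p ^ k) - 1 \<in> eval_ideal k"
    by (simp add: eval_ideal_def ev_simps vfil_mono[of k "Suc k"])
  moreover have "(a * c) ^ (p ^ k) = a * (c * (a * c) ^ (p ^ k - 1))"
  proof -
    have "p ^ k = Suc (p ^ k - 1)" using p_gt_0 by simp
    then show ?thesis by (metis mult.assoc power_Suc)
  qed
  ultimately show ?thesis by metis
qed

text \<open>The form \<open>dlog (1 + p r) / p\<close> is exact: its primitive is \<open>log (1 + p r) / p\<close>, with the
  coefficients of \<open>exists_log_coeff\<close>. Here \<open>t\<close> is an inverse of \<open>1 + p r\<close>.\<close>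

lemma log_exact:
  assumes "t * (1 + of_nat p * r) - 1 \<in> eval_ideal k"
  shows "\<exists>L. \<forall>b. t * log_deriv b r - log_deriv b L \<in> eval_ideal k"
proof -
  obtain c d where cd: "\<And>i. int (Suc i) * c i = int p ^ i + int p ^ k * d i"
    using exists_log_coeff[of _ k] by metis
  let ?x = "- (of_nat p * r)"
  define s where "s = (\<Sum>i<k. ?x ^ i)"
  have "1 - ?x ^ k = (1 + of_nat p * r) * s"
    unfolding s_def using one_diff_power_eq[of ?x k] by simp
  moreover have "x = 1 - y" if "1 - x = y" for x y :: "('a, 'a) wpoly" using that by auto
  ultimately have xk: "?x ^ k = 1 - (1 + of_nat p * r) * s" by blast
  have "t - s = t * ?x ^ k + s * (t * (1 + of_nat p * r) - 1)"
    unfolding xk by (simp add: algebra_simps)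
  moreover have "?x ^ k = of_nat p ^ k * (- r) ^ k"
    by (simp flip: power_mult_distrib)
  ultimately have ts: "t - s \<in> eval_ideal k"
    using assms by (simp add: eval_ideal_add eval_ideal_mult' eval_ideal_p_power)
  define L where "L = (\<Sum>i<k. of_int (c i) * (- 1) ^ i * r ^ Suc i)"
  have "t * log_deriv b r - log_deriv b L \<in> eval_ideal k" for b
  proof -
    have pdm: "log_deriv b ((-1) ^ i) = 0" for i by (simp add: log_deriv_power log_deriv_uminus)
    have "log_deriv b L = (\<Sum>i<k. (of_nat (Suc i) * of_int (c i)) * (- 1) ^ i * r ^ i * log_deriv b r)"
      unfolding L_def log_deriv_sum by (intro sum.cong) (simp_all add: log_deriv_mult pdm log_deriv_power[of b r "Suc _"] algebra_simps del: power_Suc of_nat_Suc)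
    also have "\<dots> = (\<Sum>i<k. (of_nat p ^ i + of_nat p ^ k * of_int (d i)) * (- 1) ^ i * r ^ i * log_deriv b r)"
    proof (intro sum.cong refl)
      fix i
      have "(of_nat (Suc i) * of_int (c i) :: ('a, 'a) wpoly) = of_int (int (Suc i) * c i)" by simp
      also have "\<dots> = of_nat p ^ i + of_nat p ^ k * of_int (d i)" unfolding cd by simp
      finally show "of_nat (Suc i) * of_int (c i) * (- 1) ^ i * r ^ i * log_deriv b r =
          (of_nat p ^ i + of_nat p ^ k * of_int (d i)) * (- 1) ^ i * r ^ i * log_deriv b r" by simp
    qed
    also have "\<dots> = s * log_deriv b r + of_nat p ^ k * (\<Sum>i<k. of_int (d i) * (- 1) ^ i * r ^ i * log_deriv b r)"
      unfolding s_def sum_distrib_left sum_distrib_right sum.distrib[symmetric]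
    proof (intro sum.cong refl)
      fix i
      have x: "?x ^ i = of_nat p ^ i * (- 1) ^ i * r ^ i"
      proof -
        have "?x = of_nat p * ((- 1) * r)" by simp
        then show ?thesis by (simp only: power_mult_distrib mult.assoc)
      qed
      show "(of_nat p ^ i + of_nat p ^ k * of_int (d i)) * (- 1) ^ i * r ^ i * log_deriv b r =
          ?x ^ i * log_deriv b r + of_nat p ^ k * (of_int (d i) * (- 1) ^ i * r ^ i * log_deriv b r)"
        unfolding x by (simp only: algebra_simps)
    qed
    finally have "t * log_deriv b r - log_deriv b L = (t - s) * log_deriv b r - of_nat p ^ k * (\<Sum>i<k. of_int (d i) * (- 1) ^ i * r ^ i * log_deriv b r)"
      by (simp add: algebra_simps)
    then show ?thesis using ts by (simp only: eval_ideal_diff eval_ideal_mult eval_ideal_p_power)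
  qed
  then show ?thesis by blast
qed

text \<open>Write \<open>phi a = a^p (1 + p r)\<close>. As \<open>phi\<close> is the Frobenius divided by \<open>p\<close>, the difference of
  \<open>phi (dlog a)\<close> and \<open>dlog a\<close> is \<open>dlog (1 + p r) / p\<close>.\<close>

lemma dlog_phi:
  assumes k: "k \<le> N" and inv: "a * a' - 1 \<in> eval_ideal k"
  shows "\<exists>L. \<forall>b. phi (a' * log_deriv b a) - a' * log_deriv b a - log_deriv b L \<in> eval_ideal k"
proof -
  obtain \<delta> where \<delta>: "phi a = a ^ p + of_nat p * \<delta>" using phi_cong by blast
  define r where "r = \<delta> * a' ^ p"
  define t where "t = phi a' * a ^ p"
  have invp: "(a * a') ^ p - 1 \<in> eval_ideal k" by (rule eval_ideal_power_one[OF inv])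
  have "t * (1 + of_nat p * r) - 1 = phi (a * a' - 1) + phi a' * of_nat p * \<delta> * ((a * a') ^ p - 1)"
    by (simp add: t_def r_def phi_simps \<delta> algebra_simps power_mult_distrib)
  then have t: "t * (1 + of_nat p * r) - 1 \<in> eval_ideal k"
    using inv invp by (simp add: eval_ideal_add eval_ideal_phi eval_ideal_mult')
  obtain L where L: "\<And>b. t * log_deriv b r - log_deriv b L \<in> eval_ideal k" using log_exact[OF t] by blast
  have ap: "a ^ p = a * a ^ (p - 1)" using p_gt_0 by (metis Suc_diff_1 power_Suc)
  have "phi (a' * log_deriv b a) - a' * log_deriv b a - log_deriv b L \<in> eval_ideal k" for b
  proof -
    have "of_nat p * phi (log_deriv b a) = of_nat p * (a ^ (p - 1) * log_deriv b a + log_deriv b \<delta>)"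
      using log_deriv_phi[of b a] unfolding \<delta> by (simp add: log_deriv_add log_deriv_power log_deriv_mult algebra_simps)
    then have 1: "phi (log_deriv b a) = a ^ (p - 1) * log_deriv b a + log_deriv b \<delta>" by (simp only: wpoly_p_cancel)
    have "\<delta> - a ^ p * r = - (\<delta> * ((a * a') ^ p - 1))"
      by (simp add: r_def power_mult_distrib algebra_simps)
    then have "log_deriv b (\<delta> - a ^ p * r) \<in> eval_ideal k"
      using invp k by (intro eval_ideal_log_deriv) (simp_all add: eval_ideal_uminus eval_ideal_mult' del: power_mult_distrib)
    then have 2: "log_deriv b \<delta> - (of_nat p * a ^ (p - 1) * log_deriv b a * r + a ^ p * log_deriv b r) \<in> eval_ideal k"
      by (simp add: log_deriv_diff log_deriv_mult log_deriv_power)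
    define u where "u = phi a' * a ^ (p - 1) * (1 + of_nat p * r)"
    have "u - a' = - u * (a * a' - 1) + a' * (t * (1 + of_nat p * r) - 1)"
      by (simp add: u_def t_def ap algebra_simps)
    then have 3: "u - a' \<in> eval_ideal k" using inv t by (simp add: eval_ideal_diff eval_ideal_mult')
    have "phi (a' * log_deriv b a) - a' * log_deriv b a - log_deriv b L =
      phi a' * (log_deriv b \<delta> - (of_nat p * a ^ (p - 1) * log_deriv b a * r + a ^ p * log_deriv b r)) + (u - a') * log_deriv b a + (t * log_deriv b r - log_deriv b L)"
      by (simp add: phi_simps 1 u_def t_def algebra_simps)
    then show ?thesis using 2 3 L by (simp only: eval_ideal_add eval_ideal_mult eval_ideal_mult')
  qed
  then show ?thesis by blast
qed

text \<open>Two lifts of the same residue differ by a factor \<open>1 + p s\<close>, whose logarithmic form is \<open>p\<close> times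
  an exact form.\<close>

lemma dlog_change:
  assumes k: "k \<le> N" and u: "u * u' - 1 \<in> eval_ideal k" and v: "v * v' - 1 \<in> eval_ideal k" and uv: "res' N u = res' N v"
  shows "\<exists>L. \<forall>b. v' * log_deriv b v - u' * log_deriv b u - of_nat p * log_deriv b L \<in> eval_ideal k"
proof -
  obtain s where "ev' N (v - u) - of_nat p * ev' N s \<in> vfil k"
    using res_zero_divide[OF k, of "v - u"] uv by (auto simp: res_simps)
  then have s: "v - (u + of_nat p * s) \<in> eval_ideal k" by (simp add: eval_ideal_def ev_simps algebra_simps)
  define r where "r = u' * s"
  define t where "t = v' * u"
  have "t * (1 + of_nat p * r) - 1 = v' * of_nat p * s * (u * u' - 1) - v' * (v - (u + of_nat p * s)) + (v * v' - 1)"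
    by (simp add: t_def r_def algebra_simps)
  then have t: "t * (1 + of_nat p * r) - 1 \<in> eval_ideal k"
    using u v s by (simp only: eval_ideal_add eval_ideal_diff eval_ideal_mult eval_ideal_mult')
  obtain L where L: "\<And>b. t * log_deriv b r - log_deriv b L \<in> eval_ideal k" using log_exact[OF t] by blast
  define w where "w = v' * (1 + of_nat p * r)"
  have "w - u' = u' * (t * (1 + of_nat p * r) - 1) - w * (u * u' - 1)"
    by (simp add: w_def t_def algebra_simps)
  then have w: "w - u' \<in> eval_ideal k" using u t by (simp only: eval_ideal_diff eval_ideal_mult')
  have "s - u * r = - (s * (u * u' - 1))" by (simp add: r_def algebra_simps)
  then have sr: "s - u * r \<in> eval_ideal k" using u by (simp only: eval_ideal_uminus eval_ideal_mult')
  have "v' * log_deriv b v - u' * log_deriv b u - of_nat p * log_deriv b L \<in> eval_ideal k" for b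
  proof -
    have "v' * log_deriv b v - u' * log_deriv b u - of_nat p * log_deriv b L =
      v' * log_deriv b (v - (u + of_nat p * s)) + v' * of_nat p * log_deriv b (s - u * r) + (w - u') * log_deriv b u
      + of_nat p * (t * log_deriv b r - log_deriv b L)"
      by (simp add: log_deriv_diff log_deriv_add log_deriv_mult w_def t_def algebra_simps)
    then show ?thesis
      using eval_ideal_log_deriv[OF k s] eval_ideal_log_deriv[OF k sr] w L by (simp only: eval_ideal_add eval_ideal_mult eval_ideal_mult')
  qed
  then show ?thesis by blast
qed

text \<open>The forms \<open>phi \<theta> - \<theta> + d g\<close> modulo \<open>p^k\<close>, given by their coefficients at \<open>dlog b\<close> for \<open>b \<in> B\<close>.
  They are the Artin-Schreier relations, in the guise of forms, enlarged by the exact forms.\<close>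

definition trivial_forms :: "nat \<Rightarrow> ('a \<Rightarrow> ('a, 'a) wpoly) set" where
  "trivial_forms k = {\<omega>. \<exists>\<theta> g. finite {b. \<theta> b \<noteq> 0} \<and> (\<forall>b\<in>B. \<omega> b - (phi (\<theta> b) - \<theta> b + log_deriv b g) \<in> eval_ideal k)}"

lemma trivial_formsI: "finite {b. \<theta> b \<noteq> 0} \<Longrightarrow> (\<And>b. b \<in> B \<Longrightarrow> \<omega> b - (phi (\<theta> b) - \<theta> b + log_deriv b g) \<in> eval_ideal k) \<Longrightarrow> \<omega> \<in> trivial_forms k"
  unfolding trivial_forms_def by blast

lemma trivial_forms_zero: "(\<lambda>_. 0) \<in> trivial_forms k"
  by (rule trivial_formsI[of "\<lambda>_. 0" _ 0]) (simp_all add: phi_simps)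

lemma trivial_forms_add:
  assumes "\<omega> \<in> trivial_forms k" "\<eta> \<in> trivial_forms k" shows "(\<lambda>b. \<omega> b + \<eta> b) \<in> trivial_forms k"
proof -
  obtain \<theta> g where 1: "finite {b. \<theta> b \<noteq> 0}" "\<And>b. b \<in> B \<Longrightarrow> \<omega> b - (phi (\<theta> b) - \<theta> b + log_deriv b g) \<in> eval_ideal k"
    using assms(1) unfolding trivial_forms_def by blast
  obtain \<theta>' g' where 2: "finite {b. \<theta>' b \<noteq> 0}" "\<And>b. b \<in> B \<Longrightarrow> \<eta> b - (phi (\<theta>' b) - \<theta>' b + log_deriv b g') \<in> eval_ideal k"
    using assms(2) unfolding trivial_forms_def by blast
  show ?thesis
  proof (rule trivial_formsI[of "\<lambda>b. \<theta> b + \<theta>' b" _ "g + g'"])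
    show "finite {b. \<theta> b + \<theta>' b \<noteq> 0}"
      by (rule finite_subset[OF _ finite_UnI[OF 1(1) 2(1)]]) auto
    fix b assume "b \<in> B"
    from eval_ideal_add[OF 1(2)[OF this] 2(2)[OF this]]
    show "\<omega> b + \<eta> b - (phi (\<theta> b + \<theta>' b) - (\<theta> b + \<theta>' b) + log_deriv b (g + g')) \<in> eval_ideal k"
      by (simp add: phi_simps log_deriv_add algebra_simps)
  qed
qed

lemma trivial_forms_uminus:
  assumes "\<omega> \<in> trivial_forms k" shows "(\<lambda>b. - \<omega> b) \<in> trivial_forms k"
proof -
  obtain \<theta> g where 1: "finite {b. \<theta> b \<noteq> 0}" "\<And>b. b \<in> B \<Longrightarrow> \<omega> b - (phi (\<theta> b) - \<theta> b + log_deriv b g) \<in> eval_ideal k"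
    using assms(1) unfolding trivial_forms_def by blast
  show ?thesis
  proof (rule trivial_formsI[of "\<lambda>b. - \<theta> b" _ "- g"])
    fix b assume "b \<in> B"
    from eval_ideal_uminus[OF 1(2)[OF this]]
    show "- \<omega> b - (phi (- \<theta> b) - (- \<theta> b) + log_deriv b (- g)) \<in> eval_ideal k"
      by (simp add: phi_simps log_deriv_uminus algebra_simps)
  qed (use 1 in simp)
qed

lemma trivial_forms_cong:
  assumes "\<omega> \<in> trivial_forms k" "\<And>b. b \<in> B \<Longrightarrow> \<eta> b - \<omega> b \<in> eval_ideal k" shows "\<eta> \<in> trivial_forms k"
proof -
  obtain \<theta> g where 1: "finite {b. \<theta> b \<noteq> 0}" "\<And>b. b \<in> B \<Longrightarrow> \<omega> b - (phi (\<theta> b) - \<theta> b + log_deriv b g) \<in> eval_ideal k"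
    using assms(1) unfolding trivial_forms_def by blast
  show ?thesis by (rule trivial_formsI[OF 1(1)]) (rule eval_ideal_trans[OF assms(2) 1(2)])
qed

lemma trivial_forms_exact: "(\<lambda>b. log_deriv b g) \<in> trivial_forms k"
  by (rule trivial_formsI[of "\<lambda>_. 0" _ g]) (simp_all add: phi_simps)

text \<open>If \<open>p \<eta> = phi \<theta> - \<theta> + d g\<close>, then modulo \<open>p\<close> the form \<open>\<theta>\<close> is fixed by the Cartier operator,
  hence logarithmic. Since lifts of logarithmic forms are fixed by \<open>phi\<close> up to exact forms, the
  logarithmic part can be removed and \<open>\<theta>\<close> assumed divisible by \<open>p\<close>. Then \<open>d g\<close> vanishes modulo
  \<open>p\<close>, so \<open>g\<close> is a \<open>p\<close>-th power there, that is \<open>phi c + p e\<close>; and \<open>d (phi c)\<close> is again divisible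
  by \<open>p\<close>. Now \<open>p\<close> can be cancelled.\<close>

lemma trivial_forms_divide:
  assumes k: "k > 0" "Suc k \<le> N" and pz: "(\<lambda>b. of_nat p * \<eta> b) \<in> trivial_forms (Suc k)"
  shows "\<eta> \<in> trivial_forms k"
proof -
  obtain \<theta> g where fin: "finite {b. \<theta> b \<noteq> 0}"
    and z: "\<And>b. b \<in> B \<Longrightarrow> of_nat p * \<eta> b - (phi (\<theta> b) - \<theta> b + log_deriv b g) \<in> eval_ideal (Suc k)"
    using pz unfolding trivial_forms_def by blast
  have 1: "res' N (\<theta> b) = res' N (\<theta> b) ^ p + der b (res' N g)" if "b \<in> B" for b
  proof -
    have "of_nat p * \<eta> b - (phi (\<theta> b) - \<theta> b + log_deriv b g) \<in> eval_ideal (Suc 0)" by (rule eval_ideal_mono[OF _ z[OF that]]) simp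
    then show ?thesis by (simp add: eval_ideal_Suc_0 res_simps res_phi der_res algebra_simps)
  qed
  have fin': "finite {b \<in> B. res' N (\<theta> b) \<noteq> 0}"
    by (rule finite_subset[OF _ fin]) (auto simp: res_simps)
  obtain f where f: "f \<noteq> 0" "\<And>b. b \<in> B \<Longrightarrow> der b f = res' N (\<theta> b) * f"
    using jacobson_cartier[OF fin' order_refl 1] by blast
  define h where "h = lift N f"
  obtain h' where h': "h * h' - 1 \<in> eval_ideal (Suc k)" using inverse_exists[of h] f(1) by (auto simp: h_def)
  have "h * h' - 1 \<in> eval_ideal (Suc 0)" by (rule eval_ideal_mono[OF _ h']) simp
  then have resh': "f * res' N h' = 1" by (simp add: eval_ideal_Suc_0 res_simps h_def)
  have "\<exists>r. \<theta> b - (h' * log_deriv b h + of_nat p * r) \<in> eval_ideal (Suc k) \<and> (\<theta> b = 0 \<and> log_deriv b h = 0 \<longrightarrow> r = 0)" if "b \<in> B" for b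
  proof (cases "\<theta> b = 0 \<and> log_deriv b h = 0")
    case True then show ?thesis by (intro exI[of _ 0]) simp
  next
    case False
    have "res' N (\<theta> b - h' * log_deriv b h) = res' N (\<theta> b) - res' N h' * der b f"
      by (simp add: res_simps h_def der_def)
    also have "\<dots> = res' N (\<theta> b) * (1 - f * res' N h')" by (simp add: f(2)[OF that] algebra_simps)
    also have "\<dots> = 0" by (simp add: resh')
    finally obtain r where "ev' N (\<theta> b - h' * log_deriv b h) - of_nat p * ev' N r \<in> vfil (Suc k)"
      using res_zero_divide[OF k(2)] by blast
    then have "\<theta> b - (h' * log_deriv b h + of_nat p * r) \<in> eval_ideal (Suc k)" by (simp add: eval_ideal_def ev_simps algebra_simps)
    then show ?thesis using False by blast
  qed
  then obtain \<rho> where \<rho>: "\<And>b. b \<in> B \<Longrightarrow> \<theta> b - (h' * log_deriv b h + of_nat p * \<rho> b) \<in> eval_ideal (Suc k)"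
    "\<And>b. b \<in> B \<Longrightarrow> \<theta> b = 0 \<Longrightarrow> log_deriv b h = 0 \<Longrightarrow> \<rho> b = 0" by metis
  \<comment> \<open>Subtract the lift \<open>h' d h\<close> of \<open>dlog f\<close>; what remains of \<open>\<theta>\<close> is \<open>p \<rho>\<close>.\<close>
  define \<rho>' where "\<rho>' = (\<lambda>b. if b \<in> B then \<rho> b else 0)"
  obtain L where L: "\<And>b. phi (h' * log_deriv b h) - h' * log_deriv b h - log_deriv b L \<in> eval_ideal (Suc k)"
    using dlog_phi[OF k(2) h'] by blast
  define g' where "g' = g + L"
  have 2: "of_nat p * \<eta> b - (of_nat p * (phi (\<rho>' b) - \<rho>' b) + log_deriv b g') \<in> eval_ideal (Suc k)" if "b \<in> B" for b
  proof -
    have e: "of_nat p * \<eta> b - (of_nat p * (phi (\<rho>' b) - \<rho>' b) + log_deriv b g') =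
      (of_nat p * \<eta> b - (phi (\<theta> b) - \<theta> b + log_deriv b g)) + phi (\<theta> b - (h' * log_deriv b h + of_nat p * \<rho> b))
       - (\<theta> b - (h' * log_deriv b h + of_nat p * \<rho> b)) + (phi (h' * log_deriv b h) - h' * log_deriv b h - log_deriv b L)"
      using that by (simp add: g'_def \<rho>'_def phi_simps log_deriv_add algebra_simps)
    show ?thesis unfolding e by (intro eval_ideal_add eval_ideal_diff eval_ideal_phi z \<rho>(1) L that)
  qed
  have "der b (res' N g') = 0" if "b \<in> B" for b
  proof -
    have "of_nat p * \<eta> b - (of_nat p * (phi (\<rho>' b) - \<rho>' b) + log_deriv b g') \<in> eval_ideal (Suc 0)"
      by (rule eval_ideal_mono[OF _ 2[OF that]]) simp
    then show ?thesis by (simp add: eval_ideal_Suc_0 res_simps der_res)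
  qed
  \<comment> \<open>Everything else is divisible by \<open>p\<close>, so the residue of \<open>g'\<close> is killed by all derivations.\<close>
  then obtain y where y: "res' N g' = y ^ p" using der_zero_pth_power by blast
  define c where "c = lift N y"
  have "res' N (g' - phi c) = 0" by (simp add: res_simps res_phi c_def y)
  then obtain e where "ev' N (g' - phi c) - of_nat p * ev' N e \<in> vfil (Suc k)"
    using res_zero_divide[OF k(2)] by blast
  then have e: "g' - (phi c + of_nat p * e) \<in> eval_ideal (Suc k)" by (simp add: eval_ideal_def ev_simps algebra_simps)
  show ?thesis
  proof (rule trivial_formsI[of "\<lambda>b. \<rho>' b + log_deriv b c" _ "c + e"])
    show "finite {b. \<rho>' b + log_deriv b c \<noteq> 0}"
    proof (rule finite_subset)
      show "{b. \<rho>' b + log_deriv b c \<noteq> 0} \<subseteq> {b. \<theta> b \<noteq> 0} \<union> {b. log_deriv b h \<noteq> 0} \<union> {b. log_deriv b c \<noteq> 0}"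
        using \<rho>(2) by (auto simp: \<rho>'_def)
    qed (use fin finite_log_deriv_support in blast)
    fix b assume b: "b \<in> B"
    have "of_nat p * (\<eta> b - (phi (\<rho>' b + log_deriv b c) - (\<rho>' b + log_deriv b c) + log_deriv b (c + e))) =
      (of_nat p * \<eta> b - (of_nat p * (phi (\<rho>' b) - \<rho>' b) + log_deriv b g')) + log_deriv b (g' - (phi c + of_nat p * e))"
      by (simp add: phi_simps log_deriv_add log_deriv_diff log_deriv_phi log_deriv_mult algebra_simps)
    also have "\<dots> \<in> eval_ideal (Suc k)" using 2[OF b] eval_ideal_log_deriv[OF k(2) e] by (rule eval_ideal_add)
    finally show "\<eta> b - (phi (\<rho>' b + log_deriv b c) - (\<rho>' b + log_deriv b c) + log_deriv b (c + e)) \<in> eval_ideal k"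
      unfolding eval_ideal_p .
  qed
qed

lemma trivial_forms_divide_power:
  assumes "Suc k \<le> N" "(\<lambda>b. of_nat p ^ k * \<eta> b) \<in> trivial_forms (Suc k)" shows "\<eta> \<in> trivial_forms (Suc 0)"
  using assms
proof (induction k)
  case (Suc k)
  have "(\<lambda>b. of_nat p * (of_nat p ^ k * \<eta> b)) \<in> trivial_forms (Suc (Suc k))" using Suc.prems(2) by (simp add: mult.assoc)
  from trivial_forms_divide[OF _ Suc.prems(1) this] have "(\<lambda>b. of_nat p ^ k * \<eta> b) \<in> trivial_forms (Suc k)" by simp
  then show ?case using Suc by simp
qed simp

definition inverse_lift :: "nat \<Rightarrow> 'a \<Rightarrow> ('a, 'a) wpoly" where
  "inverse_lift n \<beta> = (SOME a'. lift N \<beta> * a' - 1 \<in> eval_ideal n)"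

lemma inverse_lift: "\<beta> \<noteq> 0 \<Longrightarrow> lift N \<beta> * inverse_lift n \<beta> - 1 \<in> eval_ideal n"
  unfolding inverse_lift_def by (rule someI_ex[OF inverse_exists]) simp

definition dlog :: "nat \<Rightarrow> 'a \<Rightarrow> 'a \<Rightarrow> ('a, 'a) wpoly" where
  "dlog n b \<beta> = inverse_lift n \<beta> * log_deriv b (lift N \<beta>)"

text \<open>The form \<open>\<omega> dlog \<beta>\<close> of a symbol, where \<open>\<omega>\<close> enters through \<open>F^(n-1) \<omega>\<close>.\<close>

definition log_form :: "nat \<Rightarrow> 'a \<Rightarrow> 'a witt \<times> 'a \<Rightarrow> ('a, 'a) wpoly" where
  "log_form n b s = witt_lift N n (fst s) * dlog n b (snd s)"

lemma witt_lift_eval_ideal: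
  assumes "ev' N a - (frobenius ^^ (n - 1)) w \<in> vfil n"
  shows "witt_lift N n w - a \<in> eval_ideal n"
  using vfil_diff[OF ev_witt_lift[of N n w] assms] by (simp add: eval_ideal_def ev_simps)

lemma witt_lift_add: "witt_lift N n (w + w') - (witt_lift N n w + witt_lift N n w') \<in> eval_ideal n"
proof (rule witt_lift_eval_ideal)
  have "ev' N (witt_lift N n w + witt_lift N n w') - (frobenius ^^ (n - 1)) (w + w') =
     (ev' N (witt_lift N n w) - (frobenius ^^ (n - 1)) w) + (ev' N (witt_lift N n w') - (frobenius ^^ (n - 1)) w')"
    by (simp add: ev_simps ringmap_add[OF ringmap_frobenius_funpow])
  then show "ev' N (witt_lift N n w + witt_lift N n w') - (frobenius ^^ (n - 1)) (w + w') \<in> vfil n"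
    by (simp only: vfil_add ev_witt_lift)
qed

lemma witt_lift_artin_schreier: "witt_lift N n (frobenius w - w) - (phi (witt_lift N n w) - witt_lift N n w) \<in> eval_ideal n"
proof (rule witt_lift_eval_ideal)
  have "ev' N (phi (witt_lift N n w) - witt_lift N n w) - (frobenius ^^ (n - 1)) (frobenius w - w) =
     frobenius (ev' N (witt_lift N n w) - (frobenius ^^ (n - 1)) w) - (ev' N (witt_lift N n w) - (frobenius ^^ (n - 1)) w)"
    by (simp add: ev_simps ev_phi frobenius_simps ringmap_diff[OF ringmap_frobenius_funpow] funpow_swap1)
  then show "ev' N (phi (witt_lift N n w) - witt_lift N n w) - (frobenius ^^ (n - 1)) (frobenius w - w) \<in> vfil n"
    by (simp only: vfil_diff vfil_frobenius ev_witt_lift)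
qed

lemma witt_lift_vfil: "w \<in> vfil n \<Longrightarrow> witt_lift N n w \<in> eval_ideal n"
  using witt_lift_eval_ideal[of 0 n w] vfil_uminus[of "(frobenius ^^ (n - 1)) w" n]
  by (simp add: vfil_frobenius_funpow ev_simps)

lemma witt_lift_verschiebung_teich:
  assumes "i < n"
  shows "witt_lift N n ((verschiebung ^^ i) (teich \<beta>)) - of_nat p ^ i * lift N \<beta> ^ (p ^ (n - 1 - i)) \<in> eval_ideal n"
proof (rule witt_lift_eval_ideal)
  have n: "n = i + Suc (n - 1 - i)" using assms by simp
  have "of_nat p ^ i * (ev' N (lift N \<beta>) ^ (p ^ (n - 1 - i)) - teich \<beta> ^ (p ^ (n - 1 - i))) \<in> vfil (i + Suc (n - 1 - i))"
    by (rule vfil_p_power_mult[OF ev_power_teich[OF res_lift]])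
  then show "ev' N (of_nat p ^ i * lift N \<beta> ^ (p ^ (n - 1 - i))) - (frobenius ^^ (n - 1)) ((verschiebung ^^ i) (teich \<beta>)) \<in> vfil n"
    using n assms by (simp add: frobenius_verschiebung_teich ev_simps right_diff_distrib)
qed

text \<open>In \<open>p^j x^(p^(n-1-j))\<close> the derivation produces the factor \<open>p^(n-1)\<close>.\<close>

lemma log_deriv_witt_lift: "of_nat p * log_deriv b (witt_lift N n w) \<in> eval_ideal n"
proof -
  have "of_nat p * log_deriv b (witt_lift N n w) = (\<Sum>j<n. of_nat p ^ n *
      (lift N (wcomp w j) ^ (p ^ (n - 1 - j) - 1) * log_deriv b (lift N (wcomp w j))))"
    unfolding witt_lift_def log_deriv_sum sum_distrib_left
  proof (rule sum.cong)
    fix j assume "j \<in> {..<n}"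
    then have "(of_nat p :: ('a, 'a) wpoly) ^ n = of_nat p * (of_nat p ^ j * of_nat p ^ (n - 1 - j))"
      by (simp flip: power_Suc power_add)
    then show "of_nat p * log_deriv b (of_nat p ^ j * lift N (wcomp w j) ^ (p ^ (n - 1 - j))) =
        of_nat p ^ n * (lift N (wcomp w j) ^ (p ^ (n - 1 - j) - 1) * log_deriv b (lift N (wcomp w j)))"
      by (simp add: log_deriv_power algebra_simps)
  qed simp
  then show ?thesis by (simp add: eval_ideal_sum eval_ideal_p_power)
qed

text \<open>Relation by relation. Multiplicativity in \<open>\<beta>\<close> holds up to \<open>y p d L\<close> with \<open>y = witt_lift \<omega>\<close>
  (\<open>dlog_change\<close>), which is exact as \<open>p d y = 0\<close>. For \<open>V^i [\<beta>] \<otimes> \<beta>\<close> see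
  \<open>power_log_deriv_trivial\<close>. An Artin-Schreier relation goes to \<open>(phi y - y) dlog \<beta>\<close>, which is
  \<open>phi \<theta> - \<theta>\<close> for \<open>\<theta> = y dlog \<beta>\<close> up to \<open>phi y (phi - 1) dlog \<beta> = phi y d L\<close> (\<open>dlog_phi\<close>); this is
  exact because \<open>d (phi y) = p phi (d y) = 0\<close>.\<close>

lemma log_form_Rel:
  assumes "x \<in> Rel n" and n: "n \<le> N" "n > 0"
  shows "(\<lambda>b. linear_ext (log_form n b) x) \<in> trivial_forms n"
  using assms(1)
proof (induction rule: Rel.induct)
  case Rel_zero
  show ?case by (simp add: trivial_forms_zero)
next
  case (Rel_add x y)
  then show ?case by (simp add: linear_ext_add trivial_forms_add)
next
  case (Rel_uminus x)
  then show ?case by (simp add: linear_ext_uminus trivial_forms_uminus)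
next
  case (Rel_left \<beta> w w')
  show ?case
  proof (rule trivial_forms_cong[OF trivial_forms_zero])
    fix b
    have "linear_ext (log_form n b) (sy (w + w') \<beta> - sy w \<beta> - sy w' \<beta>) - 0 =
        (witt_lift N n (w + w') - (witt_lift N n w + witt_lift N n w')) * dlog n b \<beta>"
      by (simp add: linear_ext_diff linear_ext_add log_form_def algebra_simps)
    then show "linear_ext (log_form n b) (sy (w + w') \<beta> - sy w \<beta> - sy w' \<beta>) - 0 \<in> eval_ideal n"
      by (simp only: eval_ideal_mult witt_lift_add)
  qed
next
  case (Rel_right \<beta> \<beta>' w)
  define u where "u = lift N \<beta> * lift N \<beta>'"
  define u' where "u' = inverse_lift n \<beta> * inverse_lift n \<beta>'"
  have 1: "lift N \<beta> * inverse_lift n \<beta> - 1 \<in> eval_ideal n" "lift N \<beta>' * inverse_lift n \<beta>' - 1 \<in> eval_ideal n" "lift N (\<beta> * \<beta>') * inverse_lift n (\<beta> * \<beta>') - 1 \<in> eval_ideal n"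
    using Rel_right by (auto intro: inverse_lift)
  have "u * u' - 1 = (lift N \<beta> * inverse_lift n \<beta> - 1) * (lift N \<beta>' * inverse_lift n \<beta>') + (lift N \<beta>' * inverse_lift n \<beta>' - 1)"
    by (simp add: u_def u'_def algebra_simps)
  then have 2: "u * u' - 1 \<in> eval_ideal n" using 1 by (simp only: eval_ideal_add eval_ideal_mult)
  have 3: "res' N u = res' N (lift N (\<beta> * \<beta>'))" by (simp add: u_def res_simps)
  obtain L where L: "\<And>b. inverse_lift n (\<beta> * \<beta>') * log_deriv b (lift N (\<beta> * \<beta>')) - u' * log_deriv b u - of_nat p * log_deriv b L \<in> eval_ideal n"
    using dlog_change[OF n(1) 2 1(3) 3] by blast
  define y where "y = witt_lift N n w"
  show ?case
  proof (rule trivial_forms_cong[OF trivial_forms_exact[of "of_nat p * y * L"]])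
    fix b
    have "linear_ext (log_form n b) (sy w (\<beta> * \<beta>') - sy w \<beta> - sy w \<beta>') - log_deriv b (of_nat p * y * L) =
      y * (inverse_lift n (\<beta> * \<beta>') * log_deriv b (lift N (\<beta> * \<beta>')) - u' * log_deriv b u - of_nat p * log_deriv b L)
      + y * inverse_lift n \<beta> * log_deriv b (lift N \<beta>) * (lift N \<beta>' * inverse_lift n \<beta>' - 1)
      + y * inverse_lift n \<beta>' * log_deriv b (lift N \<beta>') * (lift N \<beta> * inverse_lift n \<beta> - 1)
      - of_nat p * log_deriv b y * L"
      by (simp add: linear_ext_diff linear_ext_add log_form_def dlog_def y_def u_def u'_def log_deriv_mult algebra_simps)
    also have "\<dots> \<in> eval_ideal n"
      unfolding y_def
      by (rule eval_ideal_diff[OF eval_ideal_add[OF eval_ideal_add[OF eval_ideal_mult'[OF L] eval_ideal_mult'[OF 1(2)]] eval_ideal_mult'[OF 1(1)]] eval_ideal_mult[OF log_deriv_witt_lift]])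
    finally show "linear_ext (log_form n b) (sy w (\<beta> * \<beta>') - sy w \<beta> - sy w \<beta>') - log_deriv b (of_nat p * y * L) \<in> eval_ideal n" .
  qed
next
  case (Rel_self \<beta> i)
  define a where "a = lift N \<beta>"
  show ?case
  proof (cases "i < n")
    case True
    define q where "q = p ^ (n - 1 - i)"
    have q: "a ^ q = a ^ (q - 1) * a" using p_gt_0 unfolding q_def by (metis Suc_diff_1 power_Suc2 zero_less_power)
    obtain \<theta> z where t: "\<And>v. log_deriv v a = 0 \<Longrightarrow> \<theta> v = 0" "\<And>v. a ^ (q - 1) * log_deriv v a = phi (\<theta> v) - \<theta> v + log_deriv v z"
      using power_log_deriv_trivial[of a "n - 1 - i"] unfolding q_def by blast
    have trivial_forms: "(\<lambda>b. of_nat p ^ i * (a ^ (q - 1) * log_deriv b a)) \<in> trivial_forms n"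
    proof (rule trivial_formsI[of "\<lambda>b. of_nat p ^ i * \<theta> b" _ "of_nat p ^ i * z"])
      show "finite {b. of_nat p ^ i * \<theta> b \<noteq> 0}"
        by (rule finite_subset[OF _ finite_log_deriv_support[of a]]) (use t(1) in auto)
      fix b
      show "of_nat p ^ i * (a ^ (q - 1) * log_deriv b a) - (phi (of_nat p ^ i * \<theta> b) - of_nat p ^ i * \<theta> b + log_deriv b (of_nat p ^ i * z)) \<in> eval_ideal n"
        unfolding t(2) log_deriv_of_nat_power_mult by (simp add: phi_simps algebra_simps)
    qed
    show ?thesis
    proof (rule trivial_forms_cong[OF trivial_forms])
      fix b
      have "linear_ext (log_form n b) (sy ((verschiebung ^^ i) (teich \<beta>)) \<beta>) - of_nat p ^ i * (a ^ (q - 1) * log_deriv b a) =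
        (witt_lift N n ((verschiebung ^^ i) (teich \<beta>)) - of_nat p ^ i * lift N \<beta> ^ q) * dlog n b \<beta>
        + of_nat p ^ i * a ^ (q - 1) * log_deriv b a * (lift N \<beta> * inverse_lift n \<beta> - 1)"
        by (simp add: log_form_def dlog_def q[unfolded a_def] a_def algebra_simps)
      also have "\<dots> \<in> eval_ideal n"
        unfolding q_def
        by (rule eval_ideal_add[OF eval_ideal_mult[OF witt_lift_verschiebung_teich[OF True]] eval_ideal_mult'[OF inverse_lift[OF Rel_self]]])
      finally show "linear_ext (log_form n b) (sy ((verschiebung ^^ i) (teich \<beta>)) \<beta>) - of_nat p ^ i * (a ^ (q - 1) * log_deriv b a) \<in> eval_ideal n" .
    qed
  next
    case False
    then have "(verschiebung ^^ i) (teich \<beta>) \<in> vfil n"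
      by (intro vfil_mono[of n i]) (auto simp: vfil_iff)
    then show ?thesis
      by (intro trivial_forms_cong[OF trivial_forms_zero]) (simp add: log_form_def eval_ideal_mult witt_lift_vfil)
  qed
next
  case (Rel_frobenius \<beta> w)
  define y where "y = witt_lift N n w"
  obtain L where L: "\<And>b. phi (dlog n b \<beta>) - dlog n b \<beta> - log_deriv b L \<in> eval_ideal n"
    using dlog_phi[OF n(1) inverse_lift[OF Rel_frobenius]] unfolding dlog_def by blast
  have trivial_forms: "(\<lambda>b. phi (y * dlog n b \<beta>) - y * dlog n b \<beta> + log_deriv b (- phi y * L)) \<in> trivial_forms n"
  proof (rule trivial_formsI[of "\<lambda>b. y * dlog n b \<beta>" _ "- phi y * L"])
    show "finite {b. y * dlog n b \<beta> \<noteq> 0}"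
      by (rule finite_subset[OF _ finite_log_deriv_support[of "lift N \<beta>"]]) (auto simp: dlog_def)
  qed simp
  show ?case
  proof (rule trivial_forms_cong[OF trivial_forms])
    fix b
    have "linear_ext (log_form n b) (sy (frobenius w - w) \<beta>) - (phi (y * dlog n b \<beta>) - y * dlog n b \<beta> + log_deriv b (- phi y * L)) =
      (witt_lift N n (frobenius w - w) - (phi y - y)) * dlog n b \<beta> - phi y * (phi (dlog n b \<beta>) - dlog n b \<beta> - log_deriv b L)
      + phi (of_nat p * log_deriv b y) * L"
      by (simp add: log_form_def phi_simps log_deriv_mult log_deriv_uminus log_deriv_phi algebra_simps)
    also have "\<dots> \<in> eval_ideal n"
      unfolding y_def
      by (rule eval_ideal_add[OF eval_ideal_diff[OF eval_ideal_mult[OF witt_lift_artin_schreier] eval_ideal_mult'[OF L]] eval_ideal_mult[OF eval_ideal_phi[OF log_deriv_witt_lift]]])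
    finally show "linear_ext (log_form n b) (sy (frobenius w - w) \<beta>) - (phi (y * dlog n b \<beta>) - y * dlog n b \<beta> + log_deriv b (- phi y * L)) \<in> eval_ideal n" .
  qed
next
  case (Rel_trunc \<beta> w)
  have "(verschiebung ^^ n) w \<in> vfil n" by (auto simp: vfil_iff)
  then show ?case
    by (intro trivial_forms_cong[OF trivial_forms_zero]) (simp add: log_form_def eval_ideal_mult witt_lift_vfil)
qed

text \<open>The form of \<open>V^(n-1) [a] \<otimes> \<beta>\<close> is \<open>p^(n-1) a dlog \<beta>\<close>, and trivial forms can be divided by
  \<open>p^(n-1)\<close>.\<close>

lemma log_form_trivial:
  assumes n: "n \<le> N" "n > 0" and \<beta>: "\<And>i. i \<in> I \<Longrightarrow> \<beta> i \<noteq> 0"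
    and rel: "(\<Sum>i\<in>I. sy ((verschiebung ^^ (n - 1)) (teich (a i))) (\<beta> i)) \<in> Rel n"
  shows "\<exists>\<theta> g. finite {b. \<theta> b \<noteq> 0} \<and>
    (\<forall>b\<in>B. (\<Sum>i\<in>I. a i * (der b (\<beta> i) / \<beta> i)) = \<theta> b ^ p - \<theta> b + der b g)"
proof -
  obtain m where m: "n = Suc m" using n(2) by (cases n) auto
  let ?\<eta> = "\<lambda>b. \<Sum>i\<in>I. lift N (a i) * dlog n b (\<beta> i)"
  have "(\<lambda>b. of_nat p ^ m * ?\<eta> b) \<in> trivial_forms (Suc m)"
  proof (rule trivial_forms_cong[OF log_form_Rel[OF rel n, unfolded m]])
    fix b
    have "of_nat p ^ m * ?\<eta> b - linear_ext (log_form (Suc m) b) (\<Sum>i\<in>I. sy ((verschiebung ^^ (Suc m - 1)) (teich (a i))) (\<beta> i)) =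
      (\<Sum>i\<in>I. - (witt_lift N n ((verschiebung ^^ m) (teich (a i))) - of_nat p ^ m * lift N (a i) ^ (p ^ (n - 1 - m))) * dlog n b (\<beta> i))"
      by (simp add: linear_ext_sum log_form_def m sum_distrib_left sum_subtractf[symmetric] algebra_simps)
    also have "\<dots> \<in> eval_ideal (Suc m)"
    proof (intro eval_ideal_sum eval_ideal_mult eval_ideal_uminus)
      fix i
      have "m < n" by (simp add: m)
      from witt_lift_verschiebung_teich[OF this]
      show "witt_lift N n ((verschiebung ^^ m) (teich (a i))) - of_nat p ^ m * lift N (a i) ^ (p ^ (n - 1 - m)) \<in> eval_ideal (Suc m)"
        unfolding m .
    qed
    finally show "of_nat p ^ m * ?\<eta> b - linear_ext (log_form (Suc m) b) (\<Sum>i\<in>I. sy ((verschiebung ^^ (Suc m - 1)) (teich (a i))) (\<beta> i)) \<in> eval_ideal (Suc m)" .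
  qed
  then have "?\<eta> \<in> trivial_forms (Suc 0)" using n(1) m by (intro trivial_forms_divide_power[of m]) auto
  then obtain \<theta> g where t: "finite {b. \<theta> b \<noteq> 0}" "\<And>b. b \<in> B \<Longrightarrow> ?\<eta> b - (phi (\<theta> b) - \<theta> b + log_deriv b g) \<in> eval_ideal (Suc 0)"
    unfolding trivial_forms_def by blast
  have dlog: "res' N (dlog n b (\<beta> i)) = der b (\<beta> i) / \<beta> i" if "i \<in> I" for b i
  proof -
    have "lift N (\<beta> i) * inverse_lift n (\<beta> i) - 1 \<in> eval_ideal (Suc 0)"
      using eval_ideal_mono[OF _ inverse_lift[OF \<beta>[OF that], of n], of "Suc 0"] n by simp
    then have "\<beta> i * res' N (inverse_lift n (\<beta> i)) = 1" by (simp add: eval_ideal_Suc_0 res_simps)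
    then have "res' N (inverse_lift n (\<beta> i)) = inverse (\<beta> i)" by (metis inverse_unique)
    then show ?thesis by (simp add: dlog_def res_simps der_def divide_inverse mult.commute)
  qed
  show ?thesis
  proof (intro exI[of _ "\<lambda>b. res' N (\<theta> b)"] exI[of _ "res' N g"] conjI ballI)
    show "finite {b. res' N (\<theta> b) \<noteq> 0}" by (rule finite_subset[OF _ t(1)]) (auto simp: res_simps)
    fix b assume "b \<in> B"
    from t(2)[OF this] have "(\<Sum>i\<in>I. res' N (lift N (a i) * dlog n b (\<beta> i))) = res' N (\<theta> b) ^ p - res' N (\<theta> b) + der b (res' N g)"
      by (simp add: eval_ideal_Suc_0 res_simps res_phi der_res)
    moreover have "(\<Sum>i\<in>I. res' N (lift N (a i) * dlog n b (\<beta> i))) = (\<Sum>i\<in>I. a i * (der b (\<beta> i) / \<beta> i))"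
      by (intro sum.cong) (simp_all add: dlog res_simps)
    ultimately show "(\<Sum>i\<in>I. a i * (der b (\<beta> i) / \<beta> i)) = res' N (\<theta> b) ^ p - res' N (\<theta> b) + der b (res' N g)"
      by simp
  qed
qed

end

section \<open>Existence of p-bases\<close>

definition cutv :: "'v set \<Rightarrow> ('v \<Rightarrow> 'a) \<Rightarrow> 'v \<Rightarrow> 'a::comm_ring_1" where
  "cutv S g v = (if v \<in> S then g v else 0)"

lemma mon_cutv: "mon (cutv S g) e = (if Poly_Mapping.keys e \<subseteq> S then mon g e else 0)"
proof (cases "Poly_Mapping.keys e \<subseteq> S")
  case True
  then show ?thesis by (auto simp: mon_def cutv_def intro!: prod.cong)
next
  case False
  then obtain v where "v \<in> Poly_Mapping.keys e" "v \<notin> S" by auto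
  then have "mon (cutv S g) e = 0"
    unfolding mon_def by (intro prod_zero) (auto simp: cutv_def in_keys_iff zero_power)
  then show ?thesis using False by simp
qed

lemma dvd_linear_power:
  fixes R :: "'a::field poly"
  assumes "R dvd [:- x, 1:] ^ n" "poly R x \<noteq> 0" shows "degree R = 0"
  using assms
proof (induction n)
  case 0
  then have "R \<noteq> 0" by auto
  then show ?case using 0 by (simp add: is_unit_iff_degree)
next
  case (Suc n)
  then obtain S where S: "[:- x, 1:] ^ Suc n = R * S" by (auto elim: dvdE)
  have "poly ([:- x, 1:] ^ Suc n) x = 0" by simp
  then have "poly S x = 0" unfolding S using Suc.prems(2) by simp
  then obtain T where "S = [:- x, 1:] * T" by (metis dvdE poly_eq_0_iff_dvd)
  then have "[:- x, 1:] * [:- x, 1:] ^ n = [:- x, 1:] * (R * T)" using S by (simp add: mult.left_commute)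
  then have "[:- x, 1:] ^ n = R * T" using mult_left_cancel[of "[:- x, 1:]"] by (metis pCons_eq_0_iff zero_neq_one)
  then show ?case using Suc by simp
qed

context char_p
begin

definition reduced_in :: "'v set \<Rightarrow> ('v \<Rightarrow>\<^sub>0 nat) set" where
  "reduced_in S = {e. Poly_Mapping.keys e \<subseteq> S \<and> (\<forall>v. Poly_Mapping.lookup e v < p)}"

text \<open>Values and derivations at level \<open>1\<close> depend on the exponents modulo \<open>p\<close> only, up to factors that
  are \<open>p\<close>-th powers.\<close>

lemma res_reduced:
  "\<exists>c. \<forall>i. res (cutv S g) (Suc 0) (log_deriv i P) = (\<Sum>e\<in>emod p ` Poly_Mapping.keys P \<inter> reduced_in S.
      of_nat (Poly_Mapping.lookup e i) * (c e ^ p * mon g e))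
     \<and> res (cutv S g) (Suc 0) P = (\<Sum>e\<in>emod p ` Poly_Mapping.keys P \<inter> reduced_in S. c e ^ p * mon g e)"
proof -
  let ?K = "{e \<in> Poly_Mapping.keys P. Poly_Mapping.keys e \<subseteq> S}"
  let ?G = "\<lambda>d. {e \<in> ?K. emod p e = d}"
  define w where "w = (\<lambda>e. wcomp (Poly_Mapping.lookup P e) 0)"
  define c where "c = (\<lambda>d. \<Sum>e\<in>?G d. w e * mon g (ediv p e))"
  have fin: "finite ?K" by simp
  have sub: "emod p ` ?K \<subseteq> emod p ` Poly_Mapping.keys P \<inter> reduced_in S"
    using p_gt_0 by (auto simp: reduced_in_def dest!: subsetD[OF keys_emod])
  have main: "(\<Sum>e\<in>Poly_Mapping.keys P. f (emod p e) * (w e ^ p * mon (cutv S g) e)) =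
      (\<Sum>d\<in>emod p ` Poly_Mapping.keys P \<inter> reduced_in S. f d * (c d ^ p * mon g d))" for f :: "_ \<Rightarrow> 'a"
  proof -
    have "(\<Sum>e\<in>Poly_Mapping.keys P. f (emod p e) * (w e ^ p * mon (cutv S g) e)) =
        (\<Sum>e\<in>?K. f (emod p e) * (w e ^ p * mon g e))"
      by (intro sum.mono_neutral_cong_right) (auto simp: mon_cutv)
    also have "\<dots> = (\<Sum>d\<in>emod p ` ?K. \<Sum>e\<in>?G d. f (emod p e) * (w e ^ p * mon g e))"
      by (rule sum_group_by[OF fin])
    also have "\<dots> = (\<Sum>d\<in>emod p ` ?K. f d * (c d ^ p * mon g d))"
    proof (rule sum.cong)
      fix d
      have "(\<Sum>e\<in>?G d. f (emod p e) * (w e ^ p * mon g e)) =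
          (\<Sum>e\<in>?G d. f d * ((w e * mon g (ediv p e)) ^ p * mon g d))"
      proof (intro sum.cong refl)
        fix e assume "e \<in> ?G d"
        then have "emod p e = d" "mon g e = mon g d * mon g (ediv p e) ^ p"
          using mon_emod_ediv[of g e p] by auto
        then show "f (emod p e) * (w e ^ p * mon g e) = f d * ((w e * mon g (ediv p e)) ^ p * mon g d)"
          by (simp add: power_mult_distrib algebra_simps)
      qed
      then show "(\<Sum>e\<in>?G d. f (emod p e) * (w e ^ p * mon g e)) = f d * (c d ^ p * mon g d)"
        by (simp add: c_def ringmap_sum[OF ringmap_pth_power] sum_distrib_left sum_distrib_right)
    qed simp
    also have "\<dots> = (\<Sum>d\<in>emod p ` Poly_Mapping.keys P \<inter> reduced_in S. f d * (c d ^ p * mon g d))"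
    proof (intro sum.mono_neutral_left sub ballI)
      fix d assume "d \<in> emod p ` Poly_Mapping.keys P \<inter> reduced_in S - emod p ` ?K"
      then have "?G d = {}" by (auto simp: image_iff)
      then have "c d = 0" unfolding c_def by (metis sum.empty)
      then show "f d * (c d ^ p * mon g d) = 0" by (simp add: zero_power)
    qed auto
    finally show ?thesis .
  qed
  have ex: "res (cutv S g) (Suc 0) Q = (\<Sum>e\<in>Poly_Mapping.keys P. wcomp (Poly_Mapping.lookup Q e) 0 ^ p * mon (cutv S g) e)"
    if "Poly_Mapping.keys Q \<subseteq> Poly_Mapping.keys P" for Q
  proof -
    have "res (cutv S g) (Suc 0) Q = (\<Sum>e\<in>Poly_Mapping.keys Q. wcomp (Poly_Mapping.lookup Q e) 0 ^ p * mon (cutv S g) e)"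
      by (subst poly_expand[of Q]) (simp only: ringmap_sum[OF ringmap_res] res_single power_one_right power_Suc0_right)
    then show ?thesis using that
      by (simp only:) (intro sum.mono_neutral_left, auto simp: in_keys_iff zero_power)
  qed
  have "res (cutv S g) (Suc 0) (log_deriv i P) = (\<Sum>e\<in>emod p ` Poly_Mapping.keys P \<inter> reduced_in S.
      of_nat (Poly_Mapping.lookup e i) * (c e ^ p * mon g e))" for i
  proof -
    have n: "(of_nat k :: 'a) ^ p = of_nat (k mod p)" for k
      using ringmap_of_nat[OF ringmap_pth_power, of k] by simp
    have "res (cutv S g) (Suc 0) (log_deriv i P) =
       (\<Sum>e\<in>Poly_Mapping.keys P. of_nat (Poly_Mapping.lookup (emod p e) i) * (w e ^ p * mon (cutv S g) e))"
      by (subst ex) (auto simp: lookup_log_deriv in_keys_iff wcomp0_simps power_mult_distrib w_def n mult.assoc)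
    then show ?thesis using main[of "\<lambda>e. of_nat (Poly_Mapping.lookup e i)"] by simp
  qed
  moreover have "res (cutv S g) (Suc 0) P = (\<Sum>e\<in>emod p ` Poly_Mapping.keys P \<inter> reduced_in S. c e ^ p * mon g e)"
    using main[of "\<lambda>_. 1"] by (simp add: ex w_def)
  ultimately show ?thesis by blast
qed

text \<open>The field generated by \<open>S\<close> over the \<open>p\<close>-th powers, as the set of values of polynomials at level
  \<open>1\<close>.\<close>

definition pgen :: "'a set \<Rightarrow> 'a set" where
  "pgen S = range (res (cutv S (\<lambda>v. v)) (Suc 0) :: ('a, 'a) wpoly \<Rightarrow> 'a)"

lemma pgenI: "res (cutv S (\<lambda>v. v)) (Suc 0) P = x \<Longrightarrow> x \<in> pgen S"
  unfolding pgen_def by blast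

lemma pgen_expand:
  assumes "x \<in> pgen S"
  shows "\<exists>E c. finite E \<and> E \<subseteq> reduced_in S \<and> x = (\<Sum>e\<in>E. c e ^ p * mon (\<lambda>v. v) e)"
proof -
  obtain P where "x = res (cutv S (\<lambda>v. v)) (Suc 0) P" using assms unfolding pgen_def by blast
  then show ?thesis using res_reduced[of S "\<lambda>v. v" P]
    by (metis (no_types, lifting) finite_Int finite_imageI finite_keys inf_le2)
qed

lemma pgen_sum_mon:
  assumes "\<And>e. e \<in> E \<Longrightarrow> Poly_Mapping.keys e \<subseteq> S"
  shows "(\<Sum>e\<in>E. c e ^ p * mon (\<lambda>v. v) e) \<in> pgen S"
  by (rule pgenI[of _ "\<Sum>e\<in>E. Poly_Mapping.single e (teich (c e))"])
     (simp add: res_simps res_single wcomp_teich mon_cutv assms)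

lemma pgenE: assumes "x \<in> pgen S" obtains P where "x = res (cutv S (\<lambda>v. v)) (Suc 0) P"
  using assms unfolding pgen_def by blast

lemma pgen_add: "x \<in> pgen S \<Longrightarrow> y \<in> pgen S \<Longrightarrow> x + y \<in> pgen S"
  by (elim pgenE) (rule pgenI, simp flip: res_simps)

lemma pgen_mult: "x \<in> pgen S \<Longrightarrow> y \<in> pgen S \<Longrightarrow> x * y \<in> pgen S"
  by (elim pgenE) (rule pgenI, simp flip: res_simps)

lemma pgen_uminus: "x \<in> pgen S \<Longrightarrow> - x \<in> pgen S"
  by (elim pgenE) (rule pgenI, simp flip: res_simps)

lemma pgen_diff: "x \<in> pgen S \<Longrightarrow> y \<in> pgen S \<Longrightarrow> x - y \<in> pgen S"
  by (elim pgenE) (rule pgenI, simp flip: res_simps)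

lemma pgen_one: "1 \<in> pgen S" and pgen_zero: "0 \<in> pgen S" and pgen_of_nat: "of_nat n \<in> pgen S"
  by (rule pgenI[OF res_simps(1)], rule pgenI[OF res_simps(4)], rule pgenI[OF res_simps(10)])

lemma pgen_pth_power: "x ^ p \<in> pgen S"
  by (rule pgenI[of _ "Poly_Mapping.single 0 (teich x)"]) (simp add: res_single wcomp_teich)

lemma pgen_basis: "b \<in> S \<Longrightarrow> b \<in> pgen S"
  by (rule pgenI[of _ "Poly_Mapping.single (Poly_Mapping.single b 1) 1"])
     (simp add: res_single cutv_def wcomp0_simps)

lemma pgen_power: "x \<in> pgen S \<Longrightarrow> x ^ n \<in> pgen S"
  by (induction n) (simp_all add: pgen_one pgen_mult)

lemma pgen_inverse: assumes "x \<in> pgen S" shows "inverse x \<in> pgen S"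
proof (cases "x = 0")
  case False
  have "x ^ p = x ^ (p - 1) * x" using p_gt_0 by (metis Suc_diff_1 power_Suc2)
  then have "inverse x = x ^ (p - 1) * inverse x ^ p"
    using False by (simp add: field_simps)
  then show ?thesis by (metis assms pgen_mult pgen_power pgen_pth_power)
qed (simp add: pgen_zero)

text \<open>An element outside a field \<open>K\<close> that contains all \<open>p\<close>-th powers has degree \<open>p\<close> over \<open>K\<close>. Its
  minimal polynomial \<open>Q\<close> divides \<open>(X - x)^p\<close>. If the degree is less than \<open>p\<close>, then \<open>Q'\<close> is not
  zero, so \<open>Q'\<close> does not vanish at \<open>x\<close> by minimality; thus \<open>x\<close> is a simple root and \<open>Q\<close> is
  linear.\<close>

lemma pgen_degree:
  assumes x: "x \<notin> pgen S" and P: "\<And>k. coeff P k \<in> pgen S" "degree P < p" "poly P x = 0"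
  shows "P = 0"
proof (rule ccontr)
  let ?ok = "\<lambda>Q. (\<forall>k. coeff Q k \<in> pgen S) \<and> Q \<noteq> 0 \<and> poly Q x = 0"
  assume "P \<noteq> 0"
  then have "\<exists>Q. ?ok Q" using P by blast
  then obtain Q where Q: "?ok Q" and min: "\<And>R. ?ok R \<Longrightarrow> degree Q \<le> degree R"
    using ex_has_least_nat[of ?ok _ degree] by blast
  have dQ: "degree Q < p" using min[of P] P \<open>P \<noteq> 0\<close> by auto
  have "Q dvd R" if "\<forall>k. coeff R k \<in> pgen S" "poly R x = 0" for R
    using that
  proof (induction "degree R" arbitrary: R rule: less_induct)
    case less
    show ?case
    proof (cases "R = 0")
      case False
      then have le: "degree Q \<le> degree R" using min less by blast
      define c where "c = lead_coeff R * inverse (lead_coeff Q)"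
      have cK: "c \<in> pgen S" unfolding c_def using less.prems(1) Q by (intro pgen_mult pgen_inverse) auto
      have c0: "c \<noteq> 0" using False Q by (simp add: c_def)
      define T where "T = monom c (degree R - degree Q) * Q"
      define R' where "R' = R - T"
      have dm: "degree (monom c n) = n" for n using c0 by (rule Polynomial.degree_monom_eq)
      then have dT: "degree T = degree R" unfolding T_def using c0 Q le by (subst degree_mult_eq) auto
      have "lead_coeff T = c * lead_coeff Q" unfolding T_def lead_coeff_mult by (simp add: dm)
      then have lT: "lead_coeff T = lead_coeff R" using Q by (simp add: c_def)
      have K: "\<forall>k. coeff R' k \<in> pgen S"
        unfolding R'_def T_def using less.prems(1) Q cK
        by (auto simp: coeff_monom_mult intro!: pgen_diff pgen_mult simp: pgen_zero)
      have r: "poly R' x = 0" using less.prems(2) Q by (simp add: R'_def T_def)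
      have "Q dvd R'"
      proof (cases "R' = 0")
        case False
        have "degree R' \<le> degree R" unfolding R'_def using dT by (intro degree_diff_le) auto
        moreover have "coeff R' (degree R) = 0" unfolding R'_def using lT dT by simp
        ultimately have "degree R' < degree R" using False by (metis leading_coeff_0_iff le_neq_implies_less)
        then show ?thesis using less.hyps K r by blast
      qed simp
      then show ?thesis unfolding R'_def T_def by (metis diff_add_cancel dvd_add dvd_triv_right)
    qed simp
  qed
  note div = this
  have "[:- x, 1:] ^ p = (monom 1 1 + [:- x:]) ^ p"
    by (simp add: monom_altdef)
  also have "\<dots> = monom 1 1 ^ p + [:- x:] ^ p"
    by (rule freshmans_dream) (simp_all add: prime_p char_eq)
  also have "\<dots> = monom 1 p + [:- (x ^ p):]"
    by (simp add: monom_power poly_const_pow ringmap_uminus[OF ringmap_pth_power])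
  finally have linear_ext: "[:- x, 1:] ^ p = monom 1 p + [:- (x ^ p):]" .
  have "Q dvd [:- x, 1:] ^ p"
  proof (rule div)
    show "\<forall>k. coeff ([:- x, 1:] ^ p) k \<in> pgen S"
      unfolding linear_ext by (auto simp: coeff_pCons pgen_zero pgen_one pgen_uminus pgen_pth_power split: nat.split
          intro!: pgen_add)
  qed (use p_gt_0 in \<open>simp add: zero_power\<close>)
  have dQ1: "degree Q > 0"
  proof (rule ccontr)
    assume "\<not> degree Q > 0"
    then obtain c where "Q = [:c:]" by (metis degree_eq_zeroE neq0_conv)
    then show False using Q by simp
  qed
  show False
  proof (cases "poly (pderiv Q) x = 0")
    case True
    have "coeff (pderiv Q) (degree Q - 1) = of_nat (degree Q) * lead_coeff Q"
      using dQ1 by (simp add: coeff_pderiv del: of_nat_Suc)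
    moreover have "(of_nat (degree Q) :: 'a) \<noteq> 0" using of_nat_eq_0_lt[OF dQ] dQ1 by simp
    ultimately have "pderiv Q \<noteq> 0" using Q by (metis coeff_0 leading_coeff_0_iff mult_eq_0_iff)
    moreover have "\<forall>k. coeff (pderiv Q) k \<in> pgen S"
      using Q by (auto simp: coeff_pderiv simp del: of_nat_Suc intro!: pgen_mult pgen_of_nat)
    ultimately have "degree Q \<le> degree (pderiv Q)" using min True by blast
    moreover have "degree (pderiv Q) \<le> degree Q - 1"
      by (rule degree_le) (auto simp: coeff_pderiv coeff_eq_0)
    ultimately show False using dQ1 by simp
  next
    case False
    obtain R where R: "Q = [:- x, 1:] * R" using Q by (metis dvdE poly_eq_0_iff_dvd)
    have "poly R x \<noteq> 0" using False unfolding R pderiv_mult by (simp add: pderiv_pCons)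
    moreover have "R dvd [:- x, 1:] ^ p" using \<open>Q dvd _\<close> R by (metis dvd_mult_right)
    ultimately have "degree R = 0" by (rule dvd_linear_power[rotated])
    then obtain c where "R = [:c:]" by (metis degree_eq_zeroE)
    then have c: "coeff Q 1 = c" "coeff Q 0 = - x * c" "c \<noteq> 0" using R Q by auto
    have "- coeff Q 0 * inverse (coeff Q 1) \<in> pgen S"
      using Q by (intro pgen_mult pgen_inverse pgen_uminus) auto
    then show False using x c by (simp add: mult.assoc)
  qed
qed

text \<open>Only finitely many monomials occur in each condition, so \<open>p\<close>-independence is preserved by
  unions of chains.\<close>

definition pindep :: "'a set \<Rightarrow> bool" where
  "pindep S \<longleftrightarrow> (\<forall>E c. finite E \<longrightarrow> E \<subseteq> reduced_in S \<longrightarrow> (\<Sum>e\<in>E. c e ^ p * mon (\<lambda>v. v) e) = 0 \<longrightarrow> (\<forall>e\<in>E. c e = 0))"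

lemma pindep_empty: "pindep {}"
  unfolding pindep_def
proof (intro allI impI ballI)
  fix E :: "('a \<Rightarrow>\<^sub>0 nat) set" and c :: "_ \<Rightarrow> 'a" and e
  assume E: "E \<subseteq> reduced_in {}" and s: "(\<Sum>e\<in>E. c e ^ p * mon (\<lambda>v. v) e) = 0" and e: "e \<in> E"
  have "E = {0}" "e = 0" using E e by (auto simp: reduced_in_def)
  then show "c e = 0" using s by simp
qed

text \<open>Collect a relation by the powers of \<open>x\<close>; the resulting polynomial over \<open>pgen S\<close> has degree less
  than \<open>p\<close>.\<close>

lemma pindep_insert:
  assumes S: "pindep S" and x: "x \<notin> pgen S"
  shows "pindep (insert x S)"
  unfolding pindep_def
proof (intro allI impI ballI)
  fix E :: "('a \<Rightarrow>\<^sub>0 nat) set" and c :: "_ \<Rightarrow> 'a" and e0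
  assume fin: "finite E" and E: "E \<subseteq> reduced_in (insert x S)"
    and sum: "(\<Sum>e\<in>E. c e ^ p * mon (\<lambda>v. v) e) = 0" and e0: "e0 \<in> E"
  have xS: "x \<notin> S" using x pgen_basis by blast
  define del where "del = (\<lambda>e :: 'a \<Rightarrow>\<^sub>0 nat. Poly_Mapping.update x 0 e)"
  let ?deg = "\<lambda>e :: 'a \<Rightarrow>\<^sub>0 nat. Poly_Mapping.lookup e x"
  have split: "e = del e + Poly_Mapping.single x (?deg e)" for e
    by (rule poly_mapping_eqI) (simp add: del_def lookup_update lookup_add lookup_single when_def)
  have mon: "mon (\<lambda>v. v) e = mon (\<lambda>v. v) (del e) * x ^ ?deg e" for e
    by (subst split[of e], subst mon_add) simp
  have del: "del e \<in> reduced_in S" if "e \<in> E" for e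
    using that E p_gt_0 by (auto simp: reduced_in_def del_def keys_update lookup_update)
  have deg: "?deg e < p" if "e \<in> E" for e using that E by (auto simp: reduced_in_def)
  \<comment> \<open>The coefficients of the relation, regarded as a polynomial in \<open>x\<close>.\<close>
  define \<kappa> where "\<kappa> = (\<lambda>k. \<Sum>e | e \<in> E \<and> ?deg e = k. c e ^ p * mon (\<lambda>v. v) (del e))"
  have \<kappa>K: "\<kappa> k \<in> pgen S" for k
  proof -
    have "(\<Sum>e\<in>G. c e ^ p * mon (\<lambda>v. v) (del e)) \<in> pgen S" if "finite G" "G \<subseteq> E" for G
      using that
    proof (induction G rule: finite_induct)
      case (insert e G)
      have "c e ^ p * mon (\<lambda>v. v) (del e) \<in> pgen S"
        using pgen_sum_mon[of "{del e}" S "\<lambda>_. c e"] del insert by (auto simp: reduced_in_def)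
      then show ?case using insert by (simp add: pgen_add)
    qed (simp add: pgen_zero)
    then show ?thesis unfolding \<kappa>_def using fin by (metis (no_types, lifting) finite_subset mem_Collect_eq subsetI)
  qed
  define P where "P = (\<Sum>k<p. monom (\<kappa> k) k)"
  have cP: "coeff P k = (if k < p then \<kappa> k else 0)" for k
    unfolding P_def by (auto simp: coeff_sum)
  have "degree P \<le> p - 1" by (rule degree_le) (use cP in auto)
  then have dP: "degree P < p" using p_gt_0 by linarith
  have "poly P x = (\<Sum>k<p. \<kappa> k * x ^ k)" unfolding P_def by (simp add: poly_sum poly_monom)
  also have "\<dots> = (\<Sum>k<p. \<Sum>e | e \<in> E \<and> ?deg e = k. c e ^ p * mon (\<lambda>v. v) e)"
    unfolding \<kappa>_def sum_distrib_right
  proof (intro sum.cong refl)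
    fix k e assume "e \<in> {e \<in> E. ?deg e = k}"
    then have "mon (\<lambda>v. v) e = mon (\<lambda>v. v) (del e) * x ^ k" using mon[of e] by simp
    then show "c e ^ p * mon (\<lambda>v. v) (del e) * x ^ k = c e ^ p * mon (\<lambda>v. v) e" by (simp only: mult.assoc)
  qed
  also have "\<dots> = (\<Sum>k\<in>?deg ` E. \<Sum>e | e \<in> E \<and> ?deg e = k. c e ^ p * mon (\<lambda>v. v) e)"
    by (intro sum.mono_neutral_right) (use deg in \<open>auto intro!: sum.neutral\<close>)
  also have "\<dots> = (\<Sum>e\<in>E. c e ^ p * mon (\<lambda>v. v) e)" by (rule sum_group_by[OF fin, symmetric])
  also note sum
  finally have "P = 0" using pgen_degree[OF x _ dP] cP \<kappa>K pgen_zero by auto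
  then have "\<kappa> (?deg e0) = 0" using cP[of "?deg e0"] deg[OF e0] by simp
  let ?G = "{e \<in> E. ?deg e = ?deg e0}"
  have inj: "inj_on del ?G"
  proof (rule inj_onI)
    fix e f assume "e \<in> ?G" "f \<in> ?G" "del e = del f"
    then show "e = f" using split[of e] split[of f] by simp
  qed
  define c' where "c' = (\<lambda>d. c (the_inv_into ?G del d))"
  have c': "c' (del e) = c e" if "e \<in> ?G" for e
    unfolding c'_def using the_inv_into_f_f[OF inj that] by simp
  have "(\<Sum>d\<in>del ` ?G. c' d ^ p * mon (\<lambda>v. v) d) = \<kappa> (?deg e0)"
    unfolding \<kappa>_def by (subst sum.reindex[OF inj]) (intro sum.cong, simp_all add: c')
  then have "(\<Sum>d\<in>del ` ?G. c' d ^ p * mon (\<lambda>v. v) d) = 0" using \<open>\<kappa> (?deg e0) = 0\<close> by simp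
  moreover have "finite (del ` ?G)" "del ` ?G \<subseteq> reduced_in S" using fin del by auto
  ultimately have "\<forall>d\<in>del ` ?G. c' d = 0" using S unfolding pindep_def by blast
  then have "c' (del e0) = 0" using e0 by blast
  then show "c e0 = 0" using c'[of e0] e0 by simp
qed

text \<open>By Zorn's lemma. A maximal \<open>p\<close>-independent set generates the field, since any element outside
  could be added.\<close>

lemma p_basis_exists:
  assumes "pindep B0" shows "\<exists>B. B0 \<subseteq> B \<and> p_basis p B"
proof -
  let ?A = "{S. pindep S \<and> B0 \<subseteq> S}"
  have "\<exists>M\<in>?A. \<forall>R\<in>?A. M \<subseteq> R \<longrightarrow> R = M"
  proof (rule subset_Zorn_nonempty)
    show "?A \<noteq> {}" using assms by blast
    fix C assume C: "C \<noteq> {}" "subset.chain ?A C"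
    have "pindep (\<Union>C)"
      unfolding pindep_def
    proof (intro allI impI)
      fix E :: "('a \<Rightarrow>\<^sub>0 nat) set" and c :: "_ \<Rightarrow> 'a"
      assume fin: "finite E" and E: "E \<subseteq> reduced_in (\<Union>C)"
        and s: "(\<Sum>e\<in>E. c e ^ p * mon (\<lambda>v. v) e) = 0"
      have "finite (\<Union>e\<in>E. Poly_Mapping.keys e)" "(\<Union>e\<in>E. Poly_Mapping.keys e) \<subseteq> \<Union>C"
        using fin E by (auto simp: reduced_in_def)
      then obtain T where T: "T \<in> C" "(\<Union>e\<in>E. Poly_Mapping.keys e) \<subseteq> T"
        using finite_subset_Union_chain C by metis
      have "E \<subseteq> reduced_in T" using E T(2) by (auto simp: reduced_in_def)
      moreover have "pindep T" using T(1) C(2) by (auto simp: subset.chain_def)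
      ultimately show "\<forall>e\<in>E. c e = 0" using fin s unfolding pindep_def by blast
    qed
    moreover obtain T where "T \<in> C" "B0 \<subseteq> T" using C by (auto simp: subset.chain_def)
    then have "B0 \<subseteq> \<Union>C" by blast
    ultimately show "\<Union>C \<in> ?A" by blast
  qed
  then obtain B where B: "pindep B" "B0 \<subseteq> B" and max: "\<And>R. pindep R \<Longrightarrow> B \<subseteq> R \<Longrightarrow> R = B" by auto
  have gen: "x \<in> pgen B" for x
  proof (rule ccontr)
    assume x: "x \<notin> pgen B"
    then have "insert x B = B" using max[OF pindep_insert[OF B(1) x]] by blast
    then show False using x pgen_basis by blast
  qed
  have "p_basis p B"
  proof unfold_locales
    fix E :: "('a \<Rightarrow>\<^sub>0 nat) set" and c :: "_ \<Rightarrow> 'a" and e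
    assume "finite E" "\<And>e. e \<in> E \<Longrightarrow> Poly_Mapping.keys e \<subseteq> B" "\<And>e v. e \<in> E \<Longrightarrow> Poly_Mapping.lookup e v < p"
      "(\<Sum>e\<in>E. c e ^ p * mon (\<lambda>v. v) e) = 0" "e \<in> E"
    moreover from this have "E \<subseteq> reduced_in B" by (auto simp: reduced_in_def)
    ultimately show "c e = 0" using B(1) unfolding pindep_def by blast
  next
    fix x
    obtain E c where "finite E" "E \<subseteq> reduced_in B" "x = (\<Sum>e\<in>E. c e ^ p * mon (\<lambda>v. v) e)"
      using pgen_expand[OF gen[of x]] by blast
    then show "\<exists>E c. finite E \<and> (\<forall>e\<in>E. Poly_Mapping.keys e \<subseteq> B) \<and>
      (\<forall>e\<in>E. \<forall>v. Poly_Mapping.lookup e v < p) \<and> x = (\<Sum>e\<in>E. c e ^ p * mon (\<lambda>v. v) e)"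
      by (intro exI[of _ E] exI[of _ c]) (auto simp: reduced_in_def)
  qed
  then show ?thesis using B(2) by blast
qed

lemma pindep_subset_exists:
  assumes "finite T" shows "\<exists>S\<subseteq>T. pindep S \<and> T \<subseteq> pgen S"
proof -
  have "finite {S. S \<subseteq> T \<and> pindep S}" using assms by simp
  moreover have "{} \<in> {S. S \<subseteq> T \<and> pindep S}" by (simp add: pindep_empty)
  ultimately obtain S where S: "S \<subseteq> T" "pindep S" and max: "\<And>R. R \<subseteq> T \<Longrightarrow> pindep R \<Longrightarrow> S \<subseteq> R \<Longrightarrow> R = S"
    using finite_has_maximal[of "{S. S \<subseteq> T \<and> pindep S}"] by (metis (mono_tags, lifting) emptyE mem_Collect_eq)
  have "x \<in> pgen S" if "x \<in> T" for x
  proof (rule ccontr)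
    assume x: "x \<notin> pgen S"
    then have "insert x S = S" using max[of "insert x S"] pindep_insert[OF S(2) x] S(1) that by blast
    then show False using x pgen_basis by blast
  qed
  then show ?thesis using S by blast
qed

end

section \<open>Families of symbols with trivial sum\<close>

lemma log_deriv_mon:
  assumes "\<And>v. v \<in> Poly_Mapping.keys e \<Longrightarrow> log_deriv i (h v) = of_nat (n v) * h v"
  shows "log_deriv i (mon h e) = of_nat (\<Sum>v\<in>Poly_Mapping.keys e. n v * Poly_Mapping.lookup e v) * mon h e"
proof -
  have pw: "log_deriv i (h v ^ k) = of_nat (n v * k) * h v ^ k" if "log_deriv i (h v) = of_nat (n v) * h v" for v k
    unfolding log_deriv_power that by (cases k) (simp_all add: algebra_simps)
  have "log_deriv i (\<Prod>v\<in>S. h v ^ f v) = of_nat (\<Sum>v\<in>S. n v * f v) * (\<Prod>v\<in>S. h v ^ f v)"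
    if "\<And>v. v \<in> S \<Longrightarrow> log_deriv i (h v) = of_nat (n v) * h v" "finite S" for S and f :: "_ \<Rightarrow> nat"
    using that(2,1)
  proof (induction S rule: finite_induct)
    case (insert v S)
    then show ?case by (simp add: log_deriv_mult pw algebra_simps)
  qed simp
  then show ?thesis unfolding mon_def using assms by simp
qed

context p_basis_level
begin

abbreviation wvar :: "'v \<Rightarrow> ('v, 'a) wpoly" where
  "wvar i \<equiv> Poly_Mapping.single (Poly_Mapping.single i 1) 1"

lemma log_deriv_wvar: "log_deriv i (wvar j :: ('v, 'a) wpoly) = of_nat (if i = j then 1 else 0) * wvar j"
  by (auto simp: log_deriv_single lookup_single when_def)

text \<open>Elements of the field generated by \<open>B0\<close> over the \<open>p\<close>-th powers become polynomials in variables
  indexed by the family \<open>\<beta>\<close>, where \<open>\<iota>\<close> selects an index for each element of \<open>B0\<close>.\<close>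

lemma transport:
  fixes \<beta> :: "'v \<Rightarrow> 'a" and \<iota> :: "'a \<Rightarrow> 'v"
  assumes B0: "B0 \<subseteq> B" and \<iota>: "\<And>b. b \<in> B0 \<Longrightarrow> \<beta> (\<iota> b) = b"
    and x: "finite E" "\<And>e. e \<in> E \<Longrightarrow> Poly_Mapping.keys e \<subseteq> B0" "x = (\<Sum>e\<in>E. c e ^ p * mon (\<lambda>v. v) e)"
  shows "\<exists>P. res \<beta> (Suc 0) P = x \<and> (\<forall>b\<in>B0. res \<beta> (Suc 0) (log_deriv (\<iota> b) P) = der b x) \<and>
    (\<forall>i. i \<notin> \<iota> ` B0 \<longrightarrow> log_deriv i P = 0)"
proof -
  define P where "P = (\<Sum>e\<in>E. Poly_Mapping.single 0 (teich (c e)) * mon (\<lambda>b. wvar (\<iota> b)) e)"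
  have rm: "res \<beta> (Suc 0) (mon (\<lambda>b. wvar (\<iota> b)) e) = mon (\<lambda>v. v) e" if "e \<in> E" for e
  proof -
    have "res \<beta> (Suc 0) (mon (\<lambda>b. wvar (\<iota> b)) e) = mon (\<lambda>b. \<beta> (\<iota> b)) e"
      by (simp add: ringmap_mon[OF ringmap_res] res_single wcomp0_simps)
    also have "\<dots> = mon (\<lambda>v. v) e"
      unfolding mon_def using x(2)[OF that] \<iota> by (intro prod.cong) auto
    finally show ?thesis .
  qed
  have inj: "inj_on \<iota> B0" by (rule inj_onI) (metis \<iota>)
  have pdm: "log_deriv i (mon (\<lambda>b. wvar (\<iota> b)) e :: ('v, 'a) wpoly) =
      of_nat (\<Sum>b\<in>Poly_Mapping.keys e. (if i = \<iota> b then 1 else 0) * Poly_Mapping.lookup e b) * mon (\<lambda>b. wvar (\<iota> b)) e" for i e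
    by (rule log_deriv_mon) (rule log_deriv_wvar)
  have pdP: "log_deriv i P = (\<Sum>e\<in>E. of_nat (\<Sum>b\<in>Poly_Mapping.keys e. (if i = \<iota> b then 1 else 0) * Poly_Mapping.lookup e b) *
      (Poly_Mapping.single 0 (teich (c e)) * mon (\<lambda>b. wvar (\<iota> b)) e))" for i
    unfolding P_def log_deriv_sum log_deriv_mult pdm by (intro sum.cong refl) (simp add: log_deriv_single algebra_simps)
  have "res \<beta> (Suc 0) P = x"
    unfolding P_def x(3) by (simp add: res_simps rm res_single wcomp_teich del: One_nat_def)
  moreover have "res \<beta> (Suc 0) (log_deriv (\<iota> b) P) = der b x" if b: "b \<in> B0" for b
  proof -
    have s: "(\<Sum>v\<in>Poly_Mapping.keys e. (if \<iota> b = \<iota> v then 1 else 0) * Poly_Mapping.lookup e v) = Poly_Mapping.lookup e b"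
      if "e \<in> E" for e
    proof -
      have "(\<Sum>v\<in>Poly_Mapping.keys e. (if \<iota> b = \<iota> v then 1 else 0) * Poly_Mapping.lookup e v)
          = (\<Sum>v\<in>Poly_Mapping.keys e. if v = b then Poly_Mapping.lookup e b else 0)"
        using x(2)[OF that] b inj by (intro sum.cong refl) (auto dest: inj_onD)
      also have "\<dots> = Poly_Mapping.lookup e b" by (simp add: in_keys_iff)
      finally show ?thesis .
    qed
    have "res \<beta> (Suc 0) (log_deriv (\<iota> b) P) = (\<Sum>e\<in>E. of_nat (Poly_Mapping.lookup e b) * (c e ^ p * mon (\<lambda>v. v) e))"
      unfolding pdP by (simp add: res_simps rm res_single wcomp_teich s del: of_nat_sum One_nat_def)
    also have "\<dots> = der b x"
      unfolding x(3) der_sum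
    proof (intro sum.cong refl)
      fix e assume "e \<in> E"
      then have "Poly_Mapping.keys e \<subseteq> B" using x(2) B0 by blast
      then show "of_nat (Poly_Mapping.lookup e b) * (c e ^ p * mon (\<lambda>v. v) e) = der b (c e ^ p * mon (\<lambda>v. v) e)"
        by (simp add: der_mon)
    qed
    finally show ?thesis .
  qed
  moreover have "log_deriv i P = 0" if "i \<notin> \<iota> ` B0" for i
    unfolding pdP
  proof (intro sum.neutral ballI)
    fix e assume "e \<in> E"
    then have z: "(\<Sum>b\<in>Poly_Mapping.keys e. (if i = \<iota> b then 1 else 0) * Poly_Mapping.lookup e b) = 0"
      using x(2) that by (intro sum.neutral) auto
    show "of_nat (\<Sum>b\<in>Poly_Mapping.keys e. (if i = \<iota> b then 1 else 0) * Poly_Mapping.lookup e b) *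
      (Poly_Mapping.single 0 (teich (c e)) * mon (\<lambda>b. wvar (\<iota> b)) e) = 0"
      unfolding z by simp
  qed
  ultimately show ?thesis by blast
qed

text \<open>The identity of forms is turned into a description of the \<open>a i\<close>. First \<open>\<theta>\<close> is made to vanish in
  the directions outside \<open>B0\<close>, in which no \<open>\<beta> i\<close> varies. If the \<open>\<beta> i\<close> were just the elements of
  \<open>B0\<close>, the identity would express each \<open>a i\<close>. In general there are relations between the \<open>\<beta> i\<close>,
  given by polynomials \<open>v_i - Q i\<close> with value zero; the \<open>a i\<close> are determined up to combinations
  of the differentials of these relations. The \<open>p\<close>-th power of such a differential is exact, by
  \<open>res_inverse_cartier\<close>; so a combination \<open>a' = (a' - a'^p) + a'^p\<close> of them is the sum of an
  Artin-Schreier part and of a part that comes from a polynomial.\<close>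

lemma trivial_family:
  fixes \<beta> :: "'v \<Rightarrow> 'a"
  assumes I: "finite I" "\<And>i. i \<in> I \<Longrightarrow> \<beta> i \<noteq> 0"
    and B0: "B0 \<subseteq> B" "B0 \<subseteq> \<beta> ` I" "\<beta> ` I \<subseteq> pgen B0"
    and fin: "finite {b. \<theta> b \<noteq> 0}"
    and eq: "\<And>b. b \<in> B \<Longrightarrow> (\<Sum>i\<in>I. a i * (der b (\<beta> i) / \<beta> i)) = \<theta> b ^ p - \<theta> b + der b g"
  shows "\<exists>x P. \<forall>i\<in>I. a i = x i ^ p - x i + res (cutv I \<beta>) (Suc 0) (log_deriv i P)"
proof -
  have ex: "\<exists>E c. finite E \<and> (\<forall>e\<in>E. Poly_Mapping.keys e \<subseteq> B0) \<and> \<beta> i = (\<Sum>e\<in>E. c e ^ p * mon (\<lambda>v. v) e)"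
    if "i \<in> I" for i
  proof -
    have "\<beta> i \<in> pgen B0" using B0(3) that by blast
    from pgen_expand[OF this] obtain E c where "finite E" "E \<subseteq> reduced_in B0"
      "\<beta> i = (\<Sum>e\<in>E. c e ^ p * mon (\<lambda>v. v) e)" by blast
    then show ?thesis by (intro exI[of _ E] exI[of _ c]) (auto simp: reduced_in_def)
  qed
  have der0: "der b (\<beta> i) = 0" if b: "b \<in> B - B0" and i: "i \<in> I" for b i
  proof -
    obtain E c where E: "finite E" "\<forall>e\<in>E. Poly_Mapping.keys e \<subseteq> B0" "\<beta> i = (\<Sum>e\<in>E. c e ^ p * mon (\<lambda>v. v) e)"
      using ex[OF i] by blast
    show ?thesis unfolding E(3) der_sum
    proof (intro sum.neutral ballI)
      fix e assume "e \<in> E"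
      then have "Poly_Mapping.keys e \<subseteq> B" "b \<notin> Poly_Mapping.keys e"
        using E(2) B0(1) b by blast+
      then have "Poly_Mapping.keys e \<subseteq> B" "Poly_Mapping.lookup e b = 0"
        by (simp_all add: in_keys_iff)
      then show "der b (c e ^ p * mon (\<lambda>v. v) e) = 0" by (simp add: der_mon)
    qed
  qed
  \<comment> \<open>Remove the directions outside \<open>B0\<close>: there \<open>\<theta>\<close> is logarithmic, and \<open>dlog f\<close> may be subtracted
     from it.\<close>
  have fin': "finite {b \<in> B - B0. \<theta> b \<noteq> 0}" by (rule finite_subset[OF _ fin]) auto
  have "\<theta> b = \<theta> b ^ p + der b g" if "b \<in> B - B0" for b
    using eq[of b] that by (simp add: der0 algebra_simps)
  from jacobson_cartier[OF fin' Diff_subset this] obtain f where f: "f \<noteq> 0" "\<And>b. b \<in> B - B0 \<Longrightarrow> der b f = \<theta> b * f"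
    by blast
  obtain z where z: "\<And>b. (der b f / f) ^ p - der b f / f = der b z"
    using der_inverse_cartier[OF f(1)] by blast
  define \<theta>' where "\<theta>' = (\<lambda>b. \<theta> b - der b f / f)"
  define g' where "g' = g + z"
  have eq': "(\<Sum>i\<in>I. a i * (der b (\<beta> i) / \<beta> i)) = \<theta>' b ^ p - \<theta>' b + der b g'" if "b \<in> B" for b
    unfolding eq[OF that] \<theta>'_def g'_def
    by (simp add: ringmap_diff[OF ringmap_pth_power] der_add z[symmetric])
  have "der b g' = 0" if b: "b \<in> B - B0" for b
  proof -
    have "\<theta>' b = 0" using f b by (simp add: \<theta>'_def)
    then show ?thesis using eq'[of b] b by (simp add: der0 zero_power)
  qed
  then obtain Eg cg where Eg: "finite Eg" "\<forall>e\<in>Eg. Poly_Mapping.keys e \<subseteq> B \<inter> B0" "g' = (\<Sum>e\<in>Eg. cg e ^ p * mon (\<lambda>v. v) e)"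
    using der_zero_span[of B0 g'] by blast
  have "\<forall>b\<in>B0. \<exists>i. i \<in> I \<and> \<beta> i = b" using B0(2) by blast
  then obtain \<iota> where "\<forall>b\<in>B0. \<iota> b \<in> I \<and> \<beta> (\<iota> b) = b" by metis
  then have \<iota>: "\<And>b. b \<in> B0 \<Longrightarrow> \<iota> b \<in> I" "\<And>b. b \<in> B0 \<Longrightarrow> \<beta> (\<iota> b) = b" by auto
  let ?\<beta> = "cutv I \<beta>"
  let ?r = "res ?\<beta> (Suc 0)"
  have \<iota>': "?\<beta> (\<iota> b) = b" if "b \<in> B0" for b using \<iota> that by (simp add: cutv_def)
  have inj: "inj_on \<iota> B0" by (rule inj_onI) (metis \<iota>(2))
  obtain Pg where Pg: "?r Pg = g'" "\<And>b. b \<in> B0 \<Longrightarrow> ?r (log_deriv (\<iota> b) Pg) = der b g'" "\<And>i. i \<notin> \<iota> ` B0 \<Longrightarrow> log_deriv i Pg = 0"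
    using transport[of B0 ?\<beta> \<iota> Eg g' cg, OF B0(1) \<iota>' Eg(1) _ Eg(3)] Eg(2) by auto
  have "\<exists>P. ?r P = \<beta> i \<and> (\<forall>b\<in>B0. ?r (log_deriv (\<iota> b) P) = der b (\<beta> i)) \<and> (\<forall>j. j \<notin> \<iota> ` B0 \<longrightarrow> log_deriv j P = 0)" if iI: "i \<in> I" for i
  proof -
    obtain E c where E: "finite E" "\<forall>e\<in>E. Poly_Mapping.keys e \<subseteq> B0" "\<beta> i = (\<Sum>e\<in>E. c e ^ p * mon (\<lambda>v. v) e)"
      using ex[OF iI] by blast
    show ?thesis using transport[of B0 ?\<beta> \<iota> E "\<beta> i" c, OF B0(1) \<iota>' E(1) _ E(3)] E(2) by auto
  qed
  then obtain Q where Q: "\<And>i. i \<in> I \<Longrightarrow> ?r (Q i) = \<beta> i"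
    "\<And>i b. i \<in> I \<Longrightarrow> b \<in> B0 \<Longrightarrow> ?r (log_deriv (\<iota> b) (Q i)) = der b (\<beta> i)"
    "\<And>i j. i \<in> I \<Longrightarrow> j \<notin> \<iota> ` B0 \<Longrightarrow> log_deriv j (Q i) = 0" by metis
  \<comment> \<open>Subtract the part given by \<open>\<theta>'\<close> and \<open>g'\<close>.\<close>
  define x0 where "x0 = (\<lambda>i. if i \<in> \<iota> ` B0 then \<theta>' (\<beta> i) else 0)"
  define s where "s = (\<lambda>i. x0 i ^ p - x0 i + ?r (log_deriv i Pg))"
  have s_in: "s (\<iota> b) = \<theta>' b ^ p - \<theta>' b + der b g'" if "b \<in> B0" for b
    using that \<iota> by (simp add: s_def x0_def Pg)
  have s_out: "s i = 0" if "i \<notin> \<iota> ` B0" for i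
    using that by (simp add: s_def x0_def Pg res_simps zero_power)
  define a' where "a' = (\<lambda>i. a i - s i)"
  define J where "J = I - \<iota> ` B0"
  have sumI: "(\<Sum>i\<in>I. h i) = (\<Sum>i\<in>J. h i) + (\<Sum>b\<in>B0. h (\<iota> b))" for h :: "'v \<Rightarrow> 'a"
  proof -
    have "\<iota> ` B0 \<subseteq> I" using \<iota>(1) by blast
    then have "(\<Sum>i\<in>I. h i) = (\<Sum>i\<in>J. h i) + (\<Sum>i\<in>\<iota> ` B0. h i)"
      unfolding J_def by (rule sum.subset_diff[OF _ I(1)])
    then show ?thesis by (simp add: sum.reindex[OF inj])
  qed
  have diag: "(\<Sum>c\<in>B0. h (\<iota> c) * (der b (\<beta> (\<iota> c)) / \<beta> (\<iota> c))) = h (\<iota> b)" if b: "b \<in> B0" for b and h :: "'v \<Rightarrow> 'a"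
  proof -
    have "finite B0" using finite_subset[OF B0(2)] I(1) by simp
    have "(\<Sum>c\<in>B0. h (\<iota> c) * (der b (\<beta> (\<iota> c)) / \<beta> (\<iota> c))) = (\<Sum>c\<in>B0. if c = b then h (\<iota> b) else 0)"
    proof (intro sum.cong refl)
      fix c assume c: "c \<in> B0"
      have "\<beta> (\<iota> c) = c" "c \<noteq> 0" using \<iota>[OF c] I(2) by metis+
      then show "h (\<iota> c) * (der b (\<beta> (\<iota> c)) / \<beta> (\<iota> c)) = (if c = b then h (\<iota> b) else 0)"
        using c B0(1) der_basis[of c b] by auto
    qed
    also have "\<dots> = h (\<iota> b)" using b \<open>finite B0\<close> by simp
    finally show ?thesis .
  qed
  have a'0: "a' (\<iota> b) = - (\<Sum>i\<in>J. a' i * (der b (\<beta> i) / \<beta> i))" if b: "b \<in> B0" for b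
  proof -
    have "(\<Sum>i\<in>I. a' i * (der b (\<beta> i) / \<beta> i)) =
        (\<Sum>i\<in>I. a i * (der b (\<beta> i) / \<beta> i)) - (\<Sum>i\<in>I. s i * (der b (\<beta> i) / \<beta> i))"
      by (simp only: a'_def left_diff_distrib sum_subtractf)
    also have "(\<Sum>i\<in>I. s i * (der b (\<beta> i) / \<beta> i)) = s (\<iota> b)"
      unfolding sumI diag[OF b] by (simp add: J_def s_out)
    also have "(\<Sum>i\<in>I. a i * (der b (\<beta> i) / \<beta> i)) = s (\<iota> b)" using eq'[of b] b B0(1) s_in[OF b] by auto
    finally have "(\<Sum>i\<in>J. a' i * (der b (\<beta> i) / \<beta> i)) + a' (\<iota> b) = 0"
      unfolding sumI diag[OF b] by simp
    then show ?thesis by (simp add: eq_neg_iff_add_eq_0 add.commute)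
  qed
  \<comment> \<open>The remaining part \<open>a'\<close> is a combination of the differentials of the relations \<open>v_i - Q i\<close> for
     \<open>i \<in> J\<close>.\<close>
  have "\<exists>zi. \<forall>v. ?r (log_deriv v (wvar i - Q i)) ^ p = ?r (log_deriv v zi)" if "i \<in> J" for i
  proof -
    have "i \<in> I" using that by (simp add: J_def)
    then have "?r (wvar i - Q i) = 0" by (simp add: res_simps Q res_single cutv_def wcomp0_simps)
    moreover have "p - 1 > 0" using p_gt_1 by simp
    ultimately show ?thesis
      using res_inverse_cartier[of ?\<beta> "Suc 0" "wvar i - Q i"] by (simp add: zero_power)
  qed
  then obtain \<zeta> where \<zeta>: "\<And>i v. i \<in> J \<Longrightarrow> ?r (log_deriv v (wvar i - Q i)) ^ p = ?r (log_deriv v (\<zeta> i))" by metis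
  define R where "R = (\<Sum>i\<in>J. Poly_Mapping.single 0 (teich (a' i / \<beta> i)) * \<zeta> i)"
  have rR: "?r (log_deriv v R) = (\<Sum>i\<in>J. (a' i / \<beta> i) * ?r (log_deriv v (wvar i - Q i))) ^ p" for v
    unfolding R_def log_deriv_sum ringmap_sum[OF ringmap_res] ringmap_sum[OF ringmap_pth_power]
    by (intro sum.cong refl)
       (simp add: log_deriv_mult log_deriv_single ringmap_mult[OF ringmap_res] ringmap_add[OF ringmap_res]
          ringmap_zero[OF ringmap_res] res_single wcomp_teich power_mult_distrib power_divide \<zeta>[symmetric])
  have a'p: "a' v ^ p = ?r (log_deriv v R)" if v: "v \<in> I" for v
  proof (cases "v \<in> \<iota> ` B0")
    case True
    then obtain b where b: "b \<in> B0" "v = \<iota> b" by blast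
    have "(\<Sum>i\<in>J. (a' i / \<beta> i) * ?r (log_deriv v (wvar i - Q i))) = a' v"
      unfolding b(2) a'0[OF b(1)] sum_negf[symmetric]
    proof (intro sum.cong refl)
      fix i assume "i \<in> J"
      then have "i \<in> I" "\<iota> b \<noteq> i" using b by (auto simp: J_def)
      then show "a' i / \<beta> i * ?r (log_deriv (\<iota> b) (wvar i - Q i)) = - (a' i * (der b (\<beta> i) / \<beta> i))"
        unfolding log_deriv_diff log_deriv_wvar by (simp add: res_simps Q(2)[OF _ b(1)])
    qed
    then show ?thesis unfolding rR by simp
  next
    case False
    have "(\<Sum>i\<in>J. (a' i / \<beta> i) * ?r (log_deriv v (wvar i - Q i))) = (\<Sum>i\<in>J. if i = v then a' v else 0)"
    proof (intro sum.cong refl)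
      fix i assume "i \<in> J"
      then have i: "i \<in> I" by (simp add: J_def)
      have pz: "log_deriv v (Q i) = 0" by (rule Q(3)[OF i False])
      have "?r (wvar v) = \<beta> v" using v by (simp add: res_single cutv_def wcomp0_simps)
      then show "a' i / \<beta> i * ?r (log_deriv v (wvar i - Q i)) = (if i = v then a' v else 0)"
        unfolding log_deriv_diff pz log_deriv_wvar using I(2)[OF v] by (auto simp: res_simps)
    qed
    also have "\<dots> = a' v" using v False I(1) by (simp add: J_def)
    finally show ?thesis unfolding rR by simp
  qed
  show ?thesis
  proof (intro exI[of _ "\<lambda>i. x0 i + - a' i"] exI[of _ "Pg + R"] ballI)
    fix i assume i: "i \<in> I"
    show "a i = (x0 i + - a' i) ^ p - (x0 i + - a' i) + ?r (log_deriv i (Pg + R))"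
      unfolding log_deriv_add ringmap_add[OF ringmap_res] ringmap_add[OF ringmap_pth_power]
        ringmap_uminus[OF ringmap_pth_power] a'p[OF i, symmetric]
      by (simp add: a'_def s_def)
  qed
qed

end

section \<open>Calculus of symbols\<close>

text \<open>On classes this is the embedding of the group of length \<open>k\<close> into that of length \<open>k + 1\<close>.\<close>

definition shift_symbols :: "'a::field symb \<Rightarrow> 'a symb" where
  "shift_symbols = frag_extend (\<lambda>s. sy (verschiebung (fst s)) (snd s))"

definition supp_units :: "'a::field symb set" where
  "supp_units = {x. \<forall>s\<in>Poly_Mapping.keys x. snd s \<noteq> 0}"

lemma shift_symbols_sy [simp]: "shift_symbols (sy w b) = sy (verschiebung w) b"
  by (simp add: shift_symbols_def)

lemma shift_symbols_zero [simp]: "shift_symbols 0 = 0"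
  and shift_symbols_add: "shift_symbols (x + y) = shift_symbols x + shift_symbols y"
  and shift_symbols_diff: "shift_symbols (x - y) = shift_symbols x - shift_symbols y"
  and shift_symbols_uminus: "shift_symbols (- x) = - shift_symbols x"
  by (simp_all add: shift_symbols_def frag_extend_add frag_extend_diff frag_extend_minus)

lemma shift_symbols_sum: "shift_symbols (sum f S) = (\<Sum>i\<in>S. shift_symbols (f i))"
  by (induction S rule: infinite_finite_induct) (simp_all add: shift_symbols_add)

lemma supp_units_zero: "0 \<in> supp_units"
  and supp_units_sy: "b \<noteq> 0 \<Longrightarrow> sy w b \<in> supp_units"
  by (simp_all add: supp_units_def)

lemma supp_units_add: "x \<in> supp_units \<Longrightarrow> y \<in> supp_units \<Longrightarrow> x + y \<in> supp_units"
  unfolding supp_units_def using keys_add[of x y] by blast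

lemma supp_units_sum: "(\<And>i. i \<in> S \<Longrightarrow> f i \<in> supp_units) \<Longrightarrow> sum f S \<in> supp_units"
  by (induction S rule: infinite_finite_induct) (simp_all add: supp_units_zero supp_units_add)

lemma Rel_diff: "x \<in> Rel k \<Longrightarrow> y \<in> Rel k \<Longrightarrow> x - y \<in> Rel k"
  using Rel_add[of x k "- y"] Rel_uminus[of y k] by simp

lemma Rel_sum: "(\<And>i. i \<in> S \<Longrightarrow> f i \<in> Rel k) \<Longrightarrow> sum f S \<in> Rel k"
  by (induction S rule: infinite_finite_induct) (simp_all add: Rel_zero Rel_add)

lemma Rel_trans: "x - y \<in> Rel k \<Longrightarrow> y - z \<in> Rel k \<Longrightarrow> x - z \<in> Rel k"
  using Rel_add[of "x - y" k "y - z"] by simp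

lemma Rel_sym: "x - y \<in> Rel k \<Longrightarrow> y - x \<in> Rel k"
  using Rel_uminus[of "x - y" k] by simp

lemma Rel_cong: "x - y \<in> Rel k \<Longrightarrow> x \<in> Rel k \<longleftrightarrow> y \<in> Rel k"
  using Rel_add[of "x - y" k y] Rel_diff[of x k "x - y"] by auto

lemma Rel_sum_cong: "(\<And>i. i \<in> S \<Longrightarrow> f i - g i \<in> Rel k) \<Longrightarrow> sum f S - sum g S \<in> Rel k"
  by (simp flip: sum_subtractf add: Rel_sum)

lemma sy_add: "b \<noteq> 0 \<Longrightarrow> sy (w + w') b - (sy w b + sy w' b) \<in> Rel k"
  using Rel_left[of b w w' k] by (simp add: diff_diff_eq)

lemma sy_zero: "b \<noteq> 0 \<Longrightarrow> sy 0 b \<in> Rel k"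
  using Rel_uminus[OF Rel_left[of b 0 0 k]] by simp

lemma sy_uminus: "b \<noteq> 0 \<Longrightarrow> sy (- w) b - (- sy w b) \<in> Rel k"
  using Rel_diff[OF sy_zero[of b k] Rel_left[of b "- w" w k]] by (simp add: algebra_simps)

lemma sy_diff: "b \<noteq> 0 \<Longrightarrow> sy (w - w') b - (sy w b - sy w' b) \<in> Rel k"
  using Rel_add[OF sy_add[of b w "- w'" k] sy_uminus[of b w' k]] by (simp add: algebra_simps)

lemma sy_sum: "b \<noteq> 0 \<Longrightarrow> sy (sum f S) b - (\<Sum>i\<in>S. sy (f i) b) \<in> Rel k"
proof (induction S rule: infinite_finite_induct)
  case (insert i S)
  have "sy (f i + sum f S) b - (sy (f i) b + sy (sum f S) b) \<in> Rel k" by (rule sy_add[OF insert(4)])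
  then have "(sy (f i + sum f S) b - (sy (f i) b + sy (sum f S) b)) + (sy (sum f S) b - (\<Sum>i\<in>S. sy (f i) b)) \<in> Rel k"
    using insert by (intro Rel_add) auto
  then show ?case using insert by (simp add: algebra_simps)
qed (simp_all add: sy_zero)

lemma sy_mult: "b \<noteq> 0 \<Longrightarrow> b' \<noteq> 0 \<Longrightarrow> sy w (b * b') - (sy w b + sy w b') \<in> Rel k"
  using Rel_right[of b b' w k] by (simp add: diff_diff_eq)

lemma sy_one: "sy w 1 \<in> Rel k"
  using Rel_uminus[OF Rel_right[of 1 1 w k]] by simp

lemma sy_inverse: "b \<noteq> 0 \<Longrightarrow> sy w (inverse b) - (- sy w b) \<in> Rel k"
  using Rel_diff[OF sy_one[of w k] Rel_right[of "inverse b" b w k]] by (simp add: algebra_simps)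

lemma sy_of_nat: "b \<noteq> 0 \<Longrightarrow> sy (of_nat n * w) b - frag_cmul (int n) (sy w b) \<in> Rel k"
proof (induction n)
  case (Suc n)
  have "(sy (w + of_nat n * w) b - (sy w b + sy (of_nat n * w) b)) + (sy (of_nat n * w) b - frag_cmul (int n) (sy w b)) \<in> Rel k"
    using Suc by (intro Rel_add sy_add) auto
  then show ?case by (simp add: algebra_simps frag_cmul_distrib)
qed (simp add: sy_zero)

lemma sy_power: "b \<noteq> 0 \<Longrightarrow> sy w (b ^ n) - frag_cmul (int n) (sy w b) \<in> Rel k"
proof (induction n)
  case (Suc n)
  have "(sy w (b * b ^ n) - (sy w b + sy w (b ^ n))) + (sy w (b ^ n) - frag_cmul (int n) (sy w b)) \<in> Rel k"
    using Suc by (intro Rel_add sy_mult) auto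
  then show ?case by (simp add: algebra_simps frag_cmul_distrib)
qed (simp add: sy_one)

lemma sy_power_of_nat: "b \<noteq> 0 \<Longrightarrow> sy w (b ^ n) - sy (of_nat n * w) b \<in> Rel k"
  by (rule Rel_trans[OF sy_power Rel_sym[OF sy_of_nat]])

lemma sy_prod: "(\<And>i. i \<in> S \<Longrightarrow> f i \<noteq> 0) \<Longrightarrow> sy w (prod f S) - (\<Sum>i\<in>S. sy w (f i)) \<in> Rel k"
proof (induction S rule: infinite_finite_induct)
  case (insert i S)
  have "(sy w (f i * prod f S) - (sy w (f i) + sy w (prod f S))) + (sy w (prod f S) - (\<Sum>i\<in>S. sy w (f i))) \<in> Rel k"
    using insert by (intro Rel_add sy_mult) (auto simp: prod_zero_iff)
  then show ?case using insert by (simp add: algebra_simps)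
qed (simp_all add: sy_one)

lemma frag_cmul_diff: "frag_cmul c (x - y) = frag_cmul c x - frag_cmul c y"
  by (rule poly_mapping_eqI) (simp add: lookup_minus algebra_simps)

lemma frag_cmul_Rel: "x \<in> Rel k \<Longrightarrow> frag_cmul (int n) x \<in> Rel k"
  by (induction n) (simp_all add: frag_cmul_distrib Rel_zero Rel_add)

text \<open>Negative coefficients are absorbed by the bilinearity.\<close>

lemma supp_units_rep:
  assumes "x \<in> supp_units"
  shows "\<exists>(r :: nat) \<omega> \<beta>. (\<forall>i<r. \<beta> i \<noteq> 0) \<and> (\<forall>k. x - (\<Sum>i<r. sy (\<omega> i) (\<beta> i)) \<in> Rel k)"
proof -
  have "Poly_Mapping.keys x \<subseteq> {s. snd s \<noteq> 0}" using assms by (auto simp: supp_units_def)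
  then show ?thesis
  proof (induction x rule: frag_induction)
    case zero
    show ?case by (rule exI[of _ 0]) (simp add: Rel_zero)
  next
    case (one s)
    show ?case
      by (rule exI[of _ 1], rule exI[of _ "\<lambda>_. fst s"], rule exI[of _ "\<lambda>_. snd s"]) (use one in \<open>simp add: Rel_zero\<close>)
  next
    case (diff x y)
    then obtain r r' :: nat and \<omega> \<beta> \<omega>' \<beta>' where
      1: "\<forall>i<r. \<beta> i \<noteq> 0" "\<And>k. x - (\<Sum>i<r. sy (\<omega> i) (\<beta> i)) \<in> Rel k" and
      2: "\<forall>i<r'. \<beta>' i \<noteq> 0" "\<And>k. y - (\<Sum>i<r'. sy (\<omega>' i) (\<beta>' i)) \<in> Rel k" by blast
    let ?\<omega> = "\<lambda>i. if i < r then \<omega> i else - \<omega>' (i - r)"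
    let ?\<beta> = "\<lambda>i. if i < r then \<beta> i else \<beta>' (i - r)"
    show ?case
    proof (intro exI[of _ "r + r'"] exI[of _ ?\<omega>] exI[of _ ?\<beta>] conjI allI)
      fix k
      have s: "(\<Sum>i<r + r'. sy (?\<omega> i) (?\<beta> i)) = (\<Sum>i<r. sy (\<omega> i) (\<beta> i)) + (\<Sum>i<r'. sy (- \<omega>' i) (\<beta>' i))"
        by (induction r') simp_all
      have "(\<Sum>i<r'. sy (- \<omega>' i) (\<beta>' i)) - (\<Sum>i<r'. - sy (\<omega>' i) (\<beta>' i)) \<in> Rel k"
        using 2(1) by (intro Rel_sum_cong sy_uminus) auto
      then have "(x - (\<Sum>i<r. sy (\<omega> i) (\<beta> i))) - (y - (\<Sum>i<r'. sy (\<omega>' i) (\<beta>' i)))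
          - ((\<Sum>i<r'. sy (- \<omega>' i) (\<beta>' i)) - (\<Sum>i<r'. - sy (\<omega>' i) (\<beta>' i))) \<in> Rel k"
        by (rule Rel_diff[OF Rel_diff[OF 1(2) 2(2)]])
      then show "x - y - (\<Sum>i<r + r'. sy (?\<omega> i) (?\<beta> i)) \<in> Rel k"
        unfolding s by (simp add: sum_negf algebra_simps)
    qed (use 1 2 in auto)
  qed
qed

context char_p
begin

lemma shift_symbols_Rel: "x \<in> Rel k \<Longrightarrow> shift_symbols x \<in> Rel (Suc k)" for x :: "'a symb"
proof (induction rule: Rel.induct)
  case (Rel_left b w w')
  then show ?case using Rel.Rel_left[of b "verschiebung w" "verschiebung w'" "Suc k"]
    by (simp add: shift_symbols_diff verschiebung_add)
next
  case (Rel_right b b' w)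
  then show ?case by (simp add: shift_symbols_diff Rel.Rel_right)
next
  case (Rel_self b i)
  then show ?case using Rel.Rel_self[of b "Suc i" "Suc k"] by simp
next
  case (Rel_frobenius b w)
  then show ?case using Rel.Rel_frobenius[of b "verschiebung w" "Suc k"]
    by (simp add: verschiebung_diff frobenius_verschiebung)
next
  case (Rel_trunc b w)
  then show ?case using Rel.Rel_trunc[of b "Suc k" w] by simp
qed (simp_all add: Rel_zero Rel_add Rel_uminus shift_symbols_add shift_symbols_uminus)

lemma shift_symbols_funpow_Rel: "x \<in> Rel k \<Longrightarrow> (shift_symbols ^^ d) x \<in> Rel (k + d)" for x :: "'a symb"
  by (induction d) (simp_all add: shift_symbols_Rel)

lemma sy_p: "b \<noteq> 0 \<Longrightarrow> sy (of_nat p * w) b - sy (verschiebung w) b \<in> Rel k" for b :: 'a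
proof -
  assume b: "b \<noteq> 0"
  have "(sy (frobenius (verschiebung w)) b - sy (verschiebung w) b) - sy (frobenius (verschiebung w) - verschiebung w) b \<in> Rel k"
    by (rule Rel_sym[OF sy_diff[OF b]])
  from Rel_add[OF this Rel_frobenius[OF b, of "verschiebung w"]] show ?thesis
    by (simp add: frobenius_verschiebung verschiebung_frobenius)
qed

text \<open>Multiplication by \<open>p\<close> is the shift, since \<open>p w = F V w\<close> and the Frobenius acts trivially on
  symbols.\<close>

lemma sy_p_power: "b \<noteq> 0 \<Longrightarrow> frag_cmul (int (p ^ j)) (sy w b) - sy ((verschiebung ^^ j) w) b \<in> Rel k" for b :: 'a
proof (induction j)
  case (Suc j)
  have "frag_cmul (int p) (frag_cmul (int (p ^ j)) (sy w b) - sy ((verschiebung ^^ j) w) b) \<in> Rel k"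
    using Suc by (intro frag_cmul_Rel) auto
  then have "frag_cmul (int p) (frag_cmul (int (p ^ j)) (sy w b)) - frag_cmul (int p) (sy ((verschiebung ^^ j) w) b) \<in> Rel k"
    by (simp only: frag_cmul_diff)
  moreover have "frag_cmul (int p) (sy ((verschiebung ^^ j) w) b) - sy ((verschiebung ^^ Suc j) w) b \<in> Rel k"
    using Rel_trans[OF Rel_sym[OF sy_of_nat[of b p "(verschiebung ^^ j) w" k]] sy_p] Suc.prems by simp
  ultimately have "frag_cmul (int p) (frag_cmul (int (p ^ j)) (sy w b)) - sy ((verschiebung ^^ Suc j) w) b \<in> Rel k"
    by (rule Rel_trans)
  then show ?case by simp
qed (simp add: Rel_zero)

lemma frag_cmul_p_power:
  assumes "\<And>i. i \<in> I \<Longrightarrow> \<beta> i \<noteq> (0 :: 'a)"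
  shows "frag_cmul (int (p ^ j)) (\<Sum>i\<in>I. sy (\<omega> i) (\<beta> i)) - (\<Sum>i\<in>I. sy ((verschiebung ^^ j) (\<omega> i)) (\<beta> i)) \<in> Rel k"
  unfolding frag_cmul_sum by (intro Rel_sum_cong sy_p_power assms)

text \<open>The \<open>p\<close>-basis is chosen to contain a maximal \<open>p\<close>-independent subset of the \<open>\<beta> i\<close>.\<close>

lemma trivial_family_exists:
  fixes \<beta> :: "'v \<Rightarrow> 'a"
  assumes I: "finite I" "\<And>i. i \<in> I \<Longrightarrow> \<beta> i \<noteq> 0" and n: "n > 0"
    and rel: "(\<Sum>i\<in>I. sy ((verschiebung ^^ (n - 1)) (teich (a i))) (\<beta> i)) \<in> Rel n"
  shows "\<exists>x P. \<forall>i\<in>I. a i = x i ^ p - x i + res (cutv I \<beta>) (Suc 0) (log_deriv i P)"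
proof -
  obtain B0 where B0: "B0 \<subseteq> \<beta> ` I" "pindep B0" "\<beta> ` I \<subseteq> pgen B0"
    using pindep_subset_exists[of "\<beta> ` I"] I(1) by auto
  obtain B where B: "B0 \<subseteq> B" "p_basis p B" using p_basis_exists[OF B0(2)] by blast
  interpret L: p_basis_level p ty B n
    using B(2) n by (simp add: p_basis_level_def p_basis_level_axioms_def)
  obtain \<theta> g where "finite {b. \<theta> b \<noteq> 0}"
    "\<forall>b\<in>B. (\<Sum>i\<in>I. a i * (L.der b (\<beta> i) / \<beta> i)) = \<theta> b ^ p - \<theta> b + L.der b g"
    using L.log_form_trivial[OF order_refl n I(2) rel] by blast
  then show ?thesis
    using L.trivial_family[OF I B(1) B0(1) B0(3)] by blast
qed

lemma card_reduced_in:
  assumes "finite I" shows "finite (reduced_in I)" "card (reduced_in I) = p ^ card I"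
proof -
  let ?f = "\<lambda>e. restrict (Poly_Mapping.lookup e) I"
  have "bij_betw ?f (reduced_in I) (I \<rightarrow>\<^sub>E {..<p})"
  proof (rule bij_betwI')
    fix d e assume d: "d \<in> reduced_in I" and e: "e \<in> reduced_in I"
    show "?f d = ?f e \<longleftrightarrow> d = e"
    proof
      assume eq: "?f d = ?f e"
      show "d = e"
      proof (rule poly_mapping_eqI)
        fix v show "Poly_Mapping.lookup d v = Poly_Mapping.lookup e v"
        proof (cases "v \<in> I")
          case False
          then have "v \<notin> Poly_Mapping.keys d" "v \<notin> Poly_Mapping.keys e"
            using d e by (auto simp: reduced_in_def)
          then show ?thesis by (simp add: in_keys_iff)
        qed (use fun_cong[OF eq, of v] in simp)
      qed
    qed simp
  next
    fix h assume h: "h \<in> I \<rightarrow>\<^sub>E {..<p}"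
    define e where "e = Abs_poly_mapping (\<lambda>v. if v \<in> I then h v else 0)"
    have "finite {v. (if v \<in> I then h v else 0) \<noteq> 0}"
      by (rule finite_subset[OF _ assms]) auto
    then have l: "Poly_Mapping.lookup e v = (if v \<in> I then h v else 0)" for v by (simp add: e_def)
    show "\<exists>e\<in>reduced_in I. h = ?f e"
    proof (rule bexI[of _ e])
      show "e \<in> reduced_in I" using h p_gt_0 by (auto simp: reduced_in_def in_keys_iff l split: if_splits)
      show "h = ?f e" using h by (auto simp: l restrict_def PiE_def extensional_def)
    qed
  qed (auto simp: reduced_in_def)
  then show "finite (reduced_in I)" "card (reduced_in I) = p ^ card I"
    using assms by (auto simp: bij_betw_finite finite_PiE bij_betw_same_card card_PiE)
qed

text \<open>From \<open>[c^p \<gamma>] \<otimes> c^p \<gamma> = 0\<close> one gets \<open>[c^p \<gamma>] \<otimes> \<gamma> = - p [c^p \<gamma>] \<otimes> c\<close>, and multiplication by \<open>p\<close>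
  is the shift. For \<open>c = 0\<close> both sides are trivial, and the second entry just has to be a unit.\<close>

lemma monomial_symbol:
  assumes "\<gamma> \<noteq> (0 :: 'a)"
  shows "sy (teich (c ^ p * \<gamma>)) \<gamma> - sy (verschiebung (teich (c ^ p * \<gamma>))) (if c = 0 then 1 else inverse c) \<in> Rel k"
proof (cases "c = 0")
  case True
  then show ?thesis using assms sy_zero[of \<gamma> k] sy_one[of 0 k] by (auto simp: zero_power intro: Rel_diff)
next
  case False
  let ?t = "teich (c ^ p * \<gamma>)"
  have "sy ?t (c ^ p * \<gamma>) \<in> Rel k" using Rel_self[of "c ^ p * \<gamma>" 0 k] False assms by simp
  moreover have "sy ?t (c ^ p * \<gamma>) - (sy ?t (c ^ p) + sy ?t \<gamma>) \<in> Rel k" using False assms by (intro sy_mult) auto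
  ultimately have 1: "sy ?t (c ^ p) + sy ?t \<gamma> \<in> Rel k" using Rel_cong by blast
  have 2: "sy ?t (c ^ p) - sy (verschiebung ?t) c \<in> Rel k"
    using Rel_trans[OF sy_power_of_nat sy_p] False by blast
  have 3: "sy (verschiebung ?t) (inverse c) - (- sy (verschiebung ?t) c) \<in> Rel k" by (rule sy_inverse[OF False])
  have "(sy ?t (c ^ p) + sy ?t \<gamma>) - (sy ?t (c ^ p) - sy (verschiebung ?t) c) - (sy (verschiebung ?t) (inverse c) - (- sy (verschiebung ?t) c)) \<in> Rel k"
    by (intro Rel_diff 1 2 3)
  then show ?thesis using False by (simp add: algebra_simps)
qed

text \<open>Each Witt vector \<open>\<omega> i\<close> is split according to the description of its first component: \<open>v i\<close> is
  of Artin-Schreier type, \<open>s i\<close> is a combination of the \<open>t e\<close>, and the rest is a Verschiebung.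
  Summed over \<open>i\<close>, the contributions of \<open>t e\<close> combine to the symbol of a monomial, which is a
  shift by \<open>monomial_symbol\<close>.\<close>

lemma shifted_representative:
  fixes \<beta> :: "'v \<Rightarrow> 'a"
  assumes I: "finite I" "\<And>i. i \<in> I \<Longrightarrow> \<beta> i \<noteq> 0" and n: "n > 0"
    and rel: "(\<Sum>i\<in>I. sy ((verschiebung ^^ (n - 1)) (teich (wcomp (\<omega> i) 0))) (\<beta> i)) \<in> Rel n"
  shows "\<exists>w E t u. E \<subseteq> reduced_in I - {0} \<and> (\<forall>e\<in>E. u e \<noteq> 0) \<and>
    (\<forall>k. (\<Sum>i\<in>I. sy (\<omega> i) (\<beta> i)) - shift_symbols ((\<Sum>i\<in>I. sy (w i) (\<beta> i)) + (\<Sum>e\<in>E. sy (t e) (u e))) \<in> Rel k)"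
proof -
  obtain x P where xP: "\<And>i. i \<in> I \<Longrightarrow> wcomp (\<omega> i) 0 = x i ^ p - x i + res (cutv I \<beta>) (Suc 0) (log_deriv i P)"
    using trivial_family_exists[OF I n rel] by blast
  let ?E0 = "emod p ` Poly_Mapping.keys P \<inter> reduced_in I"
  obtain c where c: "\<And>i. res (cutv I \<beta>) (Suc 0) (log_deriv i P) = (\<Sum>e\<in>?E0. of_nat (Poly_Mapping.lookup e i) * (c e ^ p * mon \<beta> e))"
    using res_reduced[of I \<beta> P] by blast
  \<comment> \<open>The exponent \<open>0\<close> has coefficient \<open>0\<close> everywhere and is dropped; this is the \<open>-1\<close> in the bound.\<close>
  define E where "E = ?E0 - {0}"
  have finE: "finite E" by (simp add: E_def)
  have c: "res (cutv I \<beta>) (Suc 0) (log_deriv i P) = (\<Sum>e\<in>E. of_nat (Poly_Mapping.lookup e i) * (c e ^ p * mon \<beta> e))" for i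
    unfolding c E_def by (intro sum.mono_neutral_right) auto
  define t where "t = (\<lambda>e. teich (c e ^ p * mon \<beta> e))"
  define u where "u = (\<lambda>e. if c e = 0 then 1 else inverse (c e))"
  define v where "v = (\<lambda>i. frobenius (teich (x i)) - teich (x i))"
  define s where "s = (\<lambda>i. \<Sum>e\<in>E. of_nat (Poly_Mapping.lookup e i) * t e)"
  define w where "w = (\<lambda>i. witt_tail (\<omega> i - v i - s i))"
  have w: "\<omega> i = v i + s i + verschiebung (w i)" if "i \<in> I" for i
  proof -
    have "wcomp (\<omega> i - v i - s i) 0 = 0"
      by (simp add: wcomp0_simps xP[OF that] v_def s_def t_def wcomp_teich c)
    then have "\<omega> i - v i - s i = verschiebung (w i)" unfolding w_def by (rule wcomp0_eq_zero)
    then show ?thesis by (simp add: algebra_simps)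
  qed
  have \<gamma>: "mon \<beta> e = (\<Prod>i\<in>I. \<beta> i ^ Poly_Mapping.lookup e i)" if "e \<in> E" for e
    using that I(1) by (intro mon_superset) (auto simp: E_def reduced_in_def)
  then have \<gamma>0: "mon \<beta> e \<noteq> 0" if "e \<in> E" for e using that I by simp
  have "(\<Sum>i\<in>I. sy (\<omega> i) (\<beta> i)) - shift_symbols ((\<Sum>i\<in>I. sy (w i) (\<beta> i)) + (\<Sum>e\<in>E. sy (t e) (u e))) \<in> Rel k" for k
  proof -
    have 1: "sy (\<omega> i) (\<beta> i) - ((\<Sum>e\<in>E. sy (t e) (\<beta> i ^ Poly_Mapping.lookup e i)) + sy (verschiebung (w i)) (\<beta> i)) \<in> Rel k"
      if i: "i \<in> I" for i
    proof -
      note b = I(2)[OF i]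
      have a1: "sy (v i + s i + verschiebung (w i)) (\<beta> i) - (sy (v i + s i) (\<beta> i) + sy (verschiebung (w i)) (\<beta> i)) \<in> Rel k"
        by (rule sy_add[OF b])
      have a2: "sy (v i + s i) (\<beta> i) - (sy (v i) (\<beta> i) + sy (s i) (\<beta> i)) \<in> Rel k" by (rule sy_add[OF b])
      have a3: "sy (v i) (\<beta> i) \<in> Rel k" unfolding v_def by (rule Rel_frobenius[OF b])
      have a4: "sy (s i) (\<beta> i) - (\<Sum>e\<in>E. sy (of_nat (Poly_Mapping.lookup e i) * t e) (\<beta> i)) \<in> Rel k"
        unfolding s_def by (rule sy_sum[OF b])
      have a5: "(\<Sum>e\<in>E. sy (of_nat (Poly_Mapping.lookup e i) * t e) (\<beta> i)) - (\<Sum>e\<in>E. sy (t e) (\<beta> i ^ Poly_Mapping.lookup e i)) \<in> Rel k"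
        by (intro Rel_sum_cong Rel_sym[OF sy_power_of_nat] b)
      from Rel_add[OF a1 Rel_add[OF a2 Rel_add[OF a3 Rel_add[OF a4 a5]]]] show ?thesis
        by (simp add: w[OF i] algebra_simps)
    qed
    have 2: "(\<Sum>i\<in>I. sy (\<omega> i) (\<beta> i)) - (\<Sum>i\<in>I. (\<Sum>e\<in>E. sy (t e) (\<beta> i ^ Poly_Mapping.lookup e i)) + sy (verschiebung (w i)) (\<beta> i)) \<in> Rel k"
      by (intro Rel_sum_cong 1)
    have 3: "(\<Sum>i\<in>I. sy (t e) (\<beta> i ^ Poly_Mapping.lookup e i)) - sy (verschiebung (t e)) (u e) \<in> Rel k" if e: "e \<in> E" for e
    proof (rule Rel_trans)
      show "(\<Sum>i\<in>I. sy (t e) (\<beta> i ^ Poly_Mapping.lookup e i)) - sy (t e) (mon \<beta> e) \<in> Rel k"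
        unfolding \<gamma>[OF e] using I by (intro Rel_sym[OF sy_prod]) auto
      show "sy (t e) (mon \<beta> e) - sy (verschiebung (t e)) (u e) \<in> Rel k"
        unfolding t_def u_def by (rule monomial_symbol[OF \<gamma>0[OF e]])
    qed
    have "(\<Sum>e\<in>E. \<Sum>i\<in>I. sy (t e) (\<beta> i ^ Poly_Mapping.lookup e i)) - (\<Sum>e\<in>E. sy (verschiebung (t e)) (u e)) \<in> Rel k"
      by (intro Rel_sum_cong 3)
    from Rel_add[OF 2 this] show ?thesis
      using sum.swap[of "\<lambda>i e. sy (t e) (\<beta> i ^ Poly_Mapping.lookup e i)" E I]
      by (simp add: shift_symbols_add shift_symbols_sum sum.distrib algebra_simps)
  qed
  moreover have "E \<subseteq> reduced_in I - {0}" "\<forall>e\<in>E. u e \<noteq> 0" by (auto simp: E_def u_def)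
  ultimately show ?thesis by blast
qed

text \<open>After \<open>n\<close> shifts only the first component is visible in length \<open>n + 1\<close>.\<close>

lemma first_components:
  assumes I: "\<And>i. i \<in> I \<Longrightarrow> \<beta> i \<noteq> (0 :: 'a)"
    and rel: "(\<Sum>i\<in>I. sy ((verschiebung ^^ n) (\<omega> i)) (\<beta> i)) \<in> Rel (Suc n)"
  shows "(\<Sum>i\<in>I. sy ((verschiebung ^^ n) (teich (wcomp (\<omega> i) 0))) (\<beta> i)) \<in> Rel (Suc n)"
proof -
  have "sy ((verschiebung ^^ n) (\<omega> i)) (\<beta> i) - sy ((verschiebung ^^ n) (teich (wcomp (\<omega> i) 0))) (\<beta> i) \<in> Rel (Suc n)"
    if "i \<in> I" for i
  proof -
    note b = I[OF that]
    have "(verschiebung ^^ n) (\<omega> i) = (verschiebung ^^ n) (teich (wcomp (\<omega> i) 0)) + (verschiebung ^^ Suc n) (witt_tail (\<omega> i))"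
    proof -
      have "(verschiebung ^^ n) (\<omega> i) = (verschiebung ^^ n) (teich (wcomp (\<omega> i) 0) + verschiebung (witt_tail (\<omega> i)))"
        using witt_split[of "\<omega> i"] by simp
      then show ?thesis by (simp only: verschiebung_funpow_add funpow_Suc_right comp_apply)
    qed
    then have "sy ((verschiebung ^^ n) (\<omega> i)) (\<beta> i) -
       (sy ((verschiebung ^^ n) (teich (wcomp (\<omega> i) 0))) (\<beta> i) + sy ((verschiebung ^^ Suc n) (witt_tail (\<omega> i))) (\<beta> i)) \<in> Rel (Suc n)"
      by (simp only: sy_add[OF b])
    from Rel_add[OF this Rel_trunc[OF b, of "Suc n" "witt_tail (\<omega> i)"]] show ?thesis by (simp add: algebra_simps)
  qed
  then have "(\<Sum>i\<in>I. sy ((verschiebung ^^ n) (\<omega> i)) (\<beta> i)) -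
      (\<Sum>i\<in>I. sy ((verschiebung ^^ n) (teich (wcomp (\<omega> i) 0))) (\<beta> i)) \<in> Rel (Suc n)"
    by (rule Rel_sum_cong)
  from Rel_cong[OF this] rel show ?thesis by simp
qed

text \<open>By induction on the length. If \<open>shift^d x\<close> is trivial in length \<open>j + 1 + d\<close>, then so is its
  multiple by \<open>p^j\<close>, which only involves the first components of \<open>x\<close>. Hence \<open>x\<close> is a shift, say
  of \<open>y\<close>, and \<open>y\<close> is trivial in length \<open>j\<close> by the induction hypothesis. The exponent \<open>d\<close> is
  needed for the induction, in which it grows while \<open>j\<close> decreases.\<close>

lemma shift_symbols_funpow_injective:
  assumes "(x :: 'a symb) \<in> supp_units" "(shift_symbols ^^ d) x \<in> Rel (j + d)" shows "x \<in> Rel j"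
  using assms
proof (induction j arbitrary: x d)
  case 0
  obtain r :: nat and \<omega> \<beta> where x: "\<forall>i<r. \<beta> i \<noteq> 0" "\<And>k. x - (\<Sum>i<r. sy (\<omega> i) (\<beta> i)) \<in> Rel k"
    using supp_units_rep[OF 0(1)] by blast
  have "(\<Sum>i<r. sy (\<omega> i) (\<beta> i)) \<in> Rel 0"
  proof (rule Rel_sum)
    fix i assume "i \<in> {..<r}"
    then show "sy (\<omega> i) (\<beta> i) \<in> Rel 0" using x(1) Rel_trunc[of "\<beta> i" 0 "\<omega> i"] by simp
  qed
  then show ?case using Rel_cong[OF x(2)] by blast
next
  case (Suc j)
  obtain r :: nat and \<omega> \<beta> where x: "\<forall>i<r. \<beta> i \<noteq> 0" "\<And>k. x - (\<Sum>i<r. sy (\<omega> i) (\<beta> i)) \<in> Rel k"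
    using supp_units_rep[OF Suc.prems(1)] by blast
  \<comment> \<open>The multiple by \<open>p^j\<close> leaves the first components only.\<close>
  let ?n = "j + d"
  have sd: "(shift_symbols ^^ d) (x - y) = (shift_symbols ^^ d) x - (shift_symbols ^^ d) y" for x y :: "'a symb" and d
    by (induction d) (simp_all add: shift_symbols_diff)
  have ss: "(shift_symbols ^^ d) (\<Sum>i<r. sy (\<omega> i) (\<beta> i)) = (\<Sum>i<r. sy ((verschiebung ^^ d) (\<omega> i)) (\<beta> i))" for d
    by (induction d) (simp_all add: shift_symbols_sum)
  have "(shift_symbols ^^ d) x - (\<Sum>i<r. sy ((verschiebung ^^ d) (\<omega> i)) (\<beta> i)) \<in> Rel (Suc ?n)"
    using shift_symbols_funpow_Rel[OF x(2)[of "Suc j"], of d] unfolding sd ss by simp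
  then have "(\<Sum>i<r. sy ((verschiebung ^^ d) (\<omega> i)) (\<beta> i)) \<in> Rel (Suc ?n)"
    using Rel_cong Suc.prems(2) by fastforce
  then have "frag_cmul (int (p ^ j)) (\<Sum>i<r. sy ((verschiebung ^^ d) (\<omega> i)) (\<beta> i)) \<in> Rel (Suc ?n)"
    by (rule frag_cmul_Rel)
  then have "(\<Sum>i<r. sy ((verschiebung ^^ j) ((verschiebung ^^ d) (\<omega> i))) (\<beta> i)) \<in> Rel (Suc ?n)"
    using Rel_cong[OF frag_cmul_p_power[of "{..<r}" \<beta> j "\<lambda>i. (verschiebung ^^ d) (\<omega> i)" "Suc ?n"]] x(1) by simp
  then have "(\<Sum>i<r. sy ((verschiebung ^^ ?n) (\<omega> i)) (\<beta> i)) \<in> Rel (Suc ?n)"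
    by (simp add: funpow_add)
  then have "(\<Sum>i<r. sy ((verschiebung ^^ ?n) (teich (wcomp (\<omega> i) 0))) (\<beta> i)) \<in> Rel (Suc ?n)"
    by (intro first_components) (use x(1) in auto)
  then have "(\<Sum>i<r. sy ((verschiebung ^^ (Suc ?n - 1)) (teich (wcomp (\<omega> i) 0))) (\<beta> i)) \<in> Rel (Suc ?n)"
    by simp
  from shifted_representative[OF finite_lessThan _ zero_less_Suc this] x(1)
  have "\<exists>w E t u. E \<subseteq> reduced_in {..<r} - {0} \<and> (\<forall>e\<in>E. u e \<noteq> 0) \<and>
    (\<forall>k. (\<Sum>i<r. sy (\<omega> i) (\<beta> i)) - shift_symbols ((\<Sum>i<r. sy (w i) (\<beta> i)) + (\<Sum>e\<in>E. sy (t e) (u e))) \<in> Rel k)"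
    by simp
  then obtain w E t u where "E \<subseteq> reduced_in {..<r} - {0} \<and> (\<forall>e\<in>E. u e \<noteq> 0) \<and>
    (\<forall>k. (\<Sum>i<r. sy (\<omega> i) (\<beta> i)) - shift_symbols ((\<Sum>i<r. sy (w i) (\<beta> i)) + (\<Sum>e\<in>E. sy (t e) (u e))) \<in> Rel k)"
    by (elim exE) (rule that)
  then have E: "\<And>e. e \<in> E \<Longrightarrow> u e \<noteq> 0"
    and y: "\<And>k. (\<Sum>i<r. sy (\<omega> i) (\<beta> i)) - shift_symbols ((\<Sum>i<r. sy (w i) (\<beta> i)) + (\<Sum>e\<in>E. sy (t e) (u e))) \<in> Rel k"
    by simp_all
  define y where "y = (\<Sum>i<r. sy (w i) (\<beta> i)) + (\<Sum>e\<in>E. sy (t e) (u e))"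
  have xy: "x - shift_symbols y \<in> Rel k" for k unfolding y_def by (rule Rel_trans[OF x(2) y])
  have "y \<in> supp_units"
    unfolding y_def using x(1) E by (intro supp_units_add supp_units_sum supp_units_sy) auto
  moreover have "(shift_symbols ^^ Suc d) y \<in> Rel (j + Suc d)"
  proof -
    have "(shift_symbols ^^ d) x - (shift_symbols ^^ d) (shift_symbols y) \<in> Rel (Suc j + d)"
      using shift_symbols_funpow_Rel[OF xy[of "Suc j"], of d] by (simp add: sd)
    then have "(shift_symbols ^^ d) (shift_symbols y) \<in> Rel (Suc j + d)" using Rel_cong Suc.prems(2) by blast
    then show ?thesis by (simp add: funpow_swap1)
  qed
  ultimately have "y \<in> Rel j" by (rule Suc.IH)
  then show ?case using Rel_cong[OF xy] shift_symbols_Rel by blast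
qed

end

section \<open>The groups of symbols as quotients of free abelian groups\<close>

text \<open>The last part will be used to show that a formal sum with trivial class satisfies the
  relations.\<close>

lemma quotient_by_generated:
  assumes G: "comm_group G" and S: "S \<subseteq> carrier G"
  defines "q \<equiv> (\<lambda>x. generate G S #>\<^bsub>G\<^esub> x)"
  shows "comm_group (G Mod generate G S)"
    and "q \<in> hom G (G Mod generate G S)"
    and "carrier (G Mod generate G S) = q ` carrier G"
    and "\<And>s. s \<in> S \<Longrightarrow> q s = \<one>\<^bsub>G Mod generate G S\<^esub>"
    and "\<And>T x. subgroup T G \<Longrightarrow> S \<subseteq> T \<Longrightarrow> x \<in> carrier G \<Longrightarrow> q x = \<one>\<^bsub>G Mod generate G S\<^esub> \<Longrightarrow> x \<in> T"
proof -
  interpret G: comm_group G by (rule G)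
  have sub: "subgroup (generate G S) G" by (rule G.generate_is_subgroup[OF S])
  interpret N: normal "generate G S" G by (rule G.subgroup_imp_normal[OF sub])
  show "comm_group (G Mod generate G S)" by (rule G.abelian_FactGroup[OF sub])
  show "q \<in> hom G (G Mod generate G S)" unfolding q_def by (rule N.r_coset_hom_Mod)
  show "carrier (G Mod generate G S) = q ` carrier G" unfolding q_def by (rule carrier_FactGroup)
  show "q s = \<one>\<^bsub>G Mod generate G S\<^esub>" if "s \<in> S" for s
    unfolding q_def one_FactGroup using that S by (intro G.coset_join2[OF _ sub]) (auto intro: generate.incl)
  show "x \<in> T" if T: "subgroup T G" "S \<subseteq> T" "x \<in> carrier G" "q x = \<one>\<^bsub>G Mod generate G S\<^esub>" for T x
  proof -
    have "x \<in> generate G S" using T(3,4) unfolding q_def one_FactGroup by (intro G.coset_join1[OF _ _ sub]) auto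
    then show ?thesis using G.generate_subgroup_incl[OF T(2,1)] by blast
  qed
qed

lemma field_units_simps [simp]:
  "carrier (ring_of_type_algebra :: 'a::field ring) = UNIV"
  "monoid.mult (ring_of_type_algebra :: 'a::field ring) = (*)"
  "\<zero>\<^bsub>(ring_of_type_algebra :: 'a::field ring)\<^esub> = 0"
  by (auto simp: ring_of_type_algebra_def)

lemma vfil_iff_wcomp: "x - y \<in> vfil k \<longleftrightarrow> (\<forall>i<k. wcomp x i = wcomp y i)"
  using wcomp_eq_if_vfil vfil_if_wcomp_eq by metis

definition wtrunc :: "nat \<Rightarrow> 'a::comm_ring_1 witt \<Rightarrow> 'a list" where
  "wtrunc k w = map (wcomp w) [0..<k]"

text \<open>Entries beyond the length of \<open>\<omega>\<close> are unspecified, so that \<open>wpad \<omega>\<close> is meaningful modulo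
  \<open>vfil (length \<omega>)\<close> only.\<close>

definition wpad :: "'a::comm_ring_1 list \<Rightarrow> 'a witt" where
  "wpad \<omega> = mkW ((!) \<omega>)"

lemma length_wtrunc [simp]: "length (wtrunc k w) = k"
  by (simp add: wtrunc_def)

lemma wtrunc_wpad [simp]: "length \<omega> = k \<Longrightarrow> wtrunc k (wpad \<omega>) = \<omega>"
  by (auto simp: wtrunc_def wpad_def intro: nth_equalityI)

lemma wtrunc_eq_iff: "wtrunc k x = wtrunc k y \<longleftrightarrow> x - y \<in> vfil k"
  by (auto simp: wtrunc_def vfil_iff_wcomp)

lemma wpad_wtrunc: "wpad (wtrunc k w) - w \<in> vfil k"
  by (simp flip: wtrunc_eq_iff)

lemma witt_ring_simps [simp]:
  "carrier (witt_ring p k) = {\<omega>. length \<omega> = k}"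
  "add (witt_ring p k) = witt_op p k (+)"
  "\<zero>\<^bsub>witt_ring p k\<^esub> = replicate k 0"
  by (simp_all add: witt_ring_def)

context char_p
begin

lemma witt_op_wtrunc: "witt_op p k (+) (wtrunc k x) (wtrunc k y) = wtrunc k (x + y :: 'a witt)"
proof -
  have "witt_op p k (+) \<omega> \<eta> = wtrunc k (wpad \<omega> + wpad \<eta>)" for \<omega> \<eta> :: "'a list"
    by (simp add: witt_op_def wtrunc_def wpad_def plus_witt.abs_eq wprime_eq wop_def)
  moreover have "(wpad (wtrunc k x) + wpad (wtrunc k y)) - (x + y) \<in> vfil k"
    using vfil_add[OF wpad_wtrunc[of k x] wpad_wtrunc[of k y]] by (simp add: algebra_simps)
  ultimately show ?thesis by (simp add: wtrunc_eq_iff)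
qed

lemma replicate_eq_wtrunc: "replicate k 0 = wtrunc k (0 :: 'a witt)"
  by (auto simp: wtrunc_def intro: nth_equalityI)

lemma wtrunc_teich: "i < k \<Longrightarrow> (replicate k 0)[i := \<beta>] = wtrunc k ((verschiebung ^^ i) (teich (\<beta> :: 'a)))"
  by (rule nth_equalityI) (auto simp: wtrunc_def verschiebung_funpow_comp wcomp_teich nth_list_update)

lemma list_eq_wtrunc: "length \<omega> = k \<Longrightarrow> \<exists>w. \<omega> = wtrunc k (w :: 'a witt)"
  using wtrunc_wpad by metis

lemma comm_group_witt_group: "comm_group (witt_group p k :: 'a list monoid)"
proof (rule comm_groupI)
  fix x y z :: "'a list"
  assume "x \<in> carrier (witt_group p k)" "y \<in> carrier (witt_group p k)" "z \<in> carrier (witt_group p k)"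
  then have "length x = k" "length y = k" "length z = k" by simp_all
  then obtain u v w :: "'a witt" where xyz: "x = wtrunc k u" "y = wtrunc k v" "z = wtrunc k w"
    using list_eq_wtrunc by metis
  show "x \<otimes>\<^bsub>witt_group p k\<^esub> y \<otimes>\<^bsub>witt_group p k\<^esub> z = x \<otimes>\<^bsub>witt_group p k\<^esub> (y \<otimes>\<^bsub>witt_group p k\<^esub> z)"
    by (simp add: xyz witt_op_wtrunc add.assoc)
next
  fix x y :: "'a list"
  assume "x \<in> carrier (witt_group p k)" "y \<in> carrier (witt_group p k)"
  then have "length x = k" "length y = k" by simp_all
  then obtain u v :: "'a witt" where xy: "x = wtrunc k u" "y = wtrunc k v"
    using list_eq_wtrunc by metis
  show "x \<otimes>\<^bsub>witt_group p k\<^esub> y \<in> carrier (witt_group p k)" by (simp add: xy witt_op_wtrunc)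
  show "x \<otimes>\<^bsub>witt_group p k\<^esub> y = y \<otimes>\<^bsub>witt_group p k\<^esub> x" by (simp add: xy witt_op_wtrunc add.commute)
next
  fix x :: "'a list"
  assume "x \<in> carrier (witt_group p k)"
  then have "length x = k" by simp
  then obtain u :: "'a witt" where x: "x = wtrunc k u"
    using list_eq_wtrunc by metis
  show "\<one>\<^bsub>witt_group p k\<^esub> \<otimes>\<^bsub>witt_group p k\<^esub> x = x"
    by (simp add: x witt_op_wtrunc replicate_eq_wtrunc)
  show "\<exists>y\<in>carrier (witt_group p k). y \<otimes>\<^bsub>witt_group p k\<^esub> x = \<one>\<^bsub>witt_group p k\<^esub>"
    by (rule bexI[of _ "wtrunc k (- u)"]) (simp_all add: x witt_op_wtrunc replicate_eq_wtrunc)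
qed (simp add: replicate_eq_wtrunc)

lemma witt_ring_minus:
  "wtrunc k x \<ominus>\<^bsub>witt_ring p k\<^esub> wtrunc k y = wtrunc k (x - y :: 'a witt)"
proof -
  interpret W: comm_group "witt_group p k :: 'a list monoid" by (rule comm_group_witt_group)
  have "inv\<^bsub>witt_group p k\<^esub> wtrunc k y = wtrunc k (- y)"
    by (rule W.inv_equality) (simp_all add: witt_op_wtrunc replicate_eq_wtrunc)
  then have "\<ominus>\<^bsub>witt_ring p k\<^esub> wtrunc k y = wtrunc k (- y)" by (simp add: a_inv_def)
  then show ?thesis by (simp add: a_minus_def witt_op_wtrunc)
qed

lemma wtrunc_frobenius: "map (\<lambda>x. x ^ p) (wtrunc k w) = wtrunc k (frobenius w :: 'a witt)"
  by (simp add: wtrunc_def)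

abbreviation FA :: "nat \<Rightarrow> ('a list \<times> 'a \<Rightarrow>\<^sub>0 int) monoid" where
  "FA k \<equiv> free_Abelian_group (carrier (witt_group p k) \<times> carrier field_units)"

text \<open>The two quotient maps in the definition of the group of symbols, in one step from the free
  abelian group.\<close>

definition qclass :: "nat \<Rightarrow> ('a list \<times> 'a \<Rightarrow>\<^sub>0 int) \<Rightarrow> 'a tensor set" where
  "qclass k x = H2_subgroup p k #>\<^bsub>witt_tensor_group p k\<^esub>
     (bilinear_subgroup (witt_group p k) field_units #>\<^bsub>FA k\<^esub> x)"

lemma carrier_FA: "x \<in> carrier (FA k) \<longleftrightarrow> (\<forall>s\<in>Poly_Mapping.keys x. length (fst s) = k \<and> snd s \<noteq> 0)"
  by auto

lemma bilinear_relations_subset: "bilinear_relations (witt_group p k) field_units \<subseteq> carrier (FA k)"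
proof
  fix x :: "'a list \<times> 'a \<Rightarrow>\<^sub>0 int"
  have *: "frag_of a - frag_of b - frag_of c \<in> carrier (FA k)"
    if "length (fst a) = k" "length (fst b) = k" "length (fst c) = k" "snd a \<noteq> 0" "snd b \<noteq> 0" "snd c \<noteq> 0" for a b c
  proof -
    have "Poly_Mapping.keys (frag_of a - frag_of b - frag_of c) \<subseteq> {a, b, c}"
      using keys_diff[of "frag_of a - frag_of b" "frag_of c"] keys_diff[of "frag_of a" "frag_of b"] by (auto simp: keys_frag_of)
    then show ?thesis unfolding carrier_FA using that by blast
  qed
  assume "x \<in> bilinear_relations (witt_group p k) field_units"
  then consider (l) a a' b where "length a = k" "length a' = k" "b \<noteq> 0"
      "x = frag_of (witt_op p k (+) a a', b) - frag_of (a, b) - frag_of (a', b)"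
    | (r) a b b' where "length a = k" "b \<noteq> 0" "b' \<noteq> 0" "x = frag_of (a, b * b') - frag_of (a, b) - frag_of (a, b')"
    unfolding bilinear_relations_def by auto
  then show "x \<in> carrier (FA k)"
  proof cases
    case l
    then show ?thesis unfolding l(4) by (intro *) (simp_all add: witt_op_def)
  next
    case r
    then show ?thesis unfolding r(4) by (intro *) simp_all
  qed
qed

lemmas tensor_quotient = quotient_by_generated[OF abelian_free_Abelian_group bilinear_relations_subset,
    folded bilinear_subgroup_def, folded tensor_group_def]

lemma witt_tensor_in_carrier: "length \<omega> = k \<Longrightarrow> \<beta> \<noteq> 0 \<Longrightarrow> witt_tensor p k \<omega> (\<beta> :: 'a) \<in> carrier (witt_tensor_group p k)"
  unfolding pure_tensor_def tensor_quotient(3) by (intro imageI) simp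

lemma H2_relations_subset: "(H2_relations p k :: 'a tensor set) \<subseteq> carrier (witt_tensor_group p k)"
proof
  fix x :: "'a tensor" assume "x \<in> H2_relations p k"
  then consider (a) i \<beta> where "i < k" "\<beta> \<noteq> 0" "x = witt_tensor p k ((replicate k 0)[i := \<beta>]) \<beta>"
    | (b) \<omega> \<beta> where "length \<omega> = k" "\<beta> \<noteq> 0" "x = witt_tensor p k (map (\<lambda>x. x ^ p) \<omega> \<ominus>\<^bsub>witt_ring p k\<^esub> \<omega>) \<beta>"
    unfolding H2_relations_def by auto
  then show "x \<in> carrier (witt_tensor_group p k)"
  proof cases
    case a
    show ?thesis unfolding a(3) by (rule witt_tensor_in_carrier) (simp_all add: a)
  next
    case b
    obtain w :: "'a witt" where w: "\<omega> = wtrunc k w" using list_eq_wtrunc[OF b(1)] by blast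
    show ?thesis
      unfolding b(3) w wtrunc_frobenius witt_ring_minus by (rule witt_tensor_in_carrier) (simp_all add: b)
  qed
qed

lemmas H2_quotient = quotient_by_generated[OF tensor_quotient(1) H2_relations_subset,
    folded H2_subgroup_def, folded H2_def]

lemma comm_group_H2: "comm_group (H2 p k :: 'a tensor set monoid)"
  by (rule H2_quotient(1))

lemma qclass_hom: "qclass k \<in> hom (FA k) (H2 p k)"
  using hom_compose[OF tensor_quotient(2) H2_quotient(2)] unfolding qclass_def comp_def .

lemma qclass_surj: "carrier (H2 p k) = qclass k ` carrier (FA k)"
  unfolding H2_quotient(3) tensor_quotient(3) qclass_def image_image ..

lemma symbol_eq_qclass: "symbol p k \<omega> \<beta> = qclass k (frag_of (\<omega>, \<beta>))"
  unfolding symbol_def pure_tensor_def qclass_def ..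

lemma qclass_one_if_relation:
  assumes "x \<in> bilinear_relations (witt_group p k) field_units"
  shows "qclass k x = \<one>\<^bsub>H2 p k\<^esub>"
proof -
  interpret T: comm_group "witt_tensor_group p k :: 'a tensor monoid" by (rule tensor_quotient(1))
  interpret h: group_hom "witt_tensor_group p k" "H2 p k :: 'a tensor set monoid"
    "\<lambda>x. H2_subgroup p k #>\<^bsub>witt_tensor_group p k\<^esub> x"
    unfolding group_hom_def group_hom_axioms_def
    by (intro conjI T.is_group H2_quotient(2) comm_group.axioms(2)[OF comm_group_H2])
  show ?thesis unfolding qclass_def tensor_quotient(4)[OF assms] by (rule h.hom_one)
qed

lemma sy_cong_vfil:
  assumes "b \<noteq> (0 :: 'a)" "w - w' \<in> vfil k" shows "sy w b - sy w' b \<in> Rel k"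
proof -
  obtain u where "w - w' = (verschiebung ^^ k) u" using assms(2) vfil_iff by blast
  then have "sy (w - w') b \<in> Rel k" using Rel_trunc[OF assms(1)] by simp
  then show ?thesis using Rel_cong[OF sy_diff[OF assms(1), of w w' k]] by blast
qed

definition pad_sum :: "('a list \<times> 'a \<Rightarrow>\<^sub>0 int) \<Rightarrow> 'a symb" where
  "pad_sum = frag_extend (\<lambda>s. sy (wpad (fst s)) (snd s))"

definition trunc_sum :: "nat \<Rightarrow> 'a symb \<Rightarrow> ('a list \<times> 'a \<Rightarrow>\<^sub>0 int)" where
  "trunc_sum k = frag_extend (\<lambda>s. frag_of (wtrunc k (fst s), snd s))"

lemma pad_sum_simps: "pad_sum (frag_of (\<omega>, \<beta>)) = sy (wpad \<omega>) \<beta>" "pad_sum 0 = 0" "pad_sum (x + y) = pad_sum x + pad_sum y"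
  "pad_sum (x - y) = pad_sum x - pad_sum y" "pad_sum (- x) = - pad_sum x"
  by (simp_all add: pad_sum_def frag_extend_add frag_extend_diff frag_extend_minus)

lemma trunc_sum_simps: "trunc_sum k (sy w \<beta>) = frag_of (wtrunc k w, \<beta>)" "trunc_sum k 0 = 0" "trunc_sum k (x + y) = trunc_sum k x + trunc_sum k y"
  "trunc_sum k (x - y) = trunc_sum k x - trunc_sum k y" "trunc_sum k (- x) = - trunc_sum k x"
  by (simp_all add: trunc_sum_def frag_extend_add frag_extend_diff frag_extend_minus)

lemma trunc_sum_carrier: "x \<in> supp_units \<Longrightarrow> trunc_sum k x \<in> carrier (FA k)"
  unfolding trunc_sum_def carrier_FA using keys_frag_extend[of "\<lambda>s. frag_of (wtrunc k (fst s), snd s)" x]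
  by (fastforce simp: supp_units_def keys_frag_of)

text \<open>The sums whose padding satisfies \<open>Rel k\<close> form a subgroup that contains the bilinear relations,
  and its image in the tensor product contains the relations defining the group of symbols.\<close>

lemma qclass_one_imp_Rel:
  assumes x: "x \<in> carrier (FA k)" and one: "qclass k x = \<one>\<^bsub>H2 p k\<^esub>"
  shows "pad_sum x \<in> Rel k"
proof -
  interpret F: comm_group "FA k" by (rule abelian_free_Abelian_group)
  interpret T: comm_group "witt_tensor_group p k :: 'a tensor monoid" by (rule tensor_quotient(1))
  let ?q = "\<lambda>x. bilinear_subgroup (witt_group p k) field_units #>\<^bsub>FA k\<^esub> x"
  interpret q: group_hom "FA k" "witt_tensor_group p k :: 'a tensor monoid" ?q
    unfolding group_hom_def group_hom_axioms_def
    by (intro conjI F.is_group T.is_group tensor_quotient(2))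
  define S where "S = {x \<in> carrier (FA k). pad_sum x \<in> Rel k}"
  have S: "subgroup S (FA k)"
  proof (rule F.subgroupI)
    show "S \<noteq> {}" by (rule ex_in_conv[THEN iffD1], rule exI[of _ 0]) (simp add: S_def pad_sum_simps Rel_zero)
    fix a assume a: "a \<in> S"
    then have "inv\<^bsub>FA k\<^esub> a = - a" by (simp add: S_def)
    then show "inv\<^bsub>FA k\<^esub> a \<in> S" using a by (simp add: S_def pad_sum_simps Rel_uminus)
    fix b assume b: "b \<in> S"
    have "a \<otimes>\<^bsub>FA k\<^esub> b \<in> carrier (FA k)" using a b by (intro F.m_closed) (auto simp: S_def)
    then show "a \<otimes>\<^bsub>FA k\<^esub> b \<in> S" using a b by (simp add: S_def pad_sum_simps Rel_add)
  qed (auto simp: S_def)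
  have bil: "bilinear_relations (witt_group p k) field_units \<subseteq> S"
  proof
    fix y :: "'a list \<times> 'a \<Rightarrow>\<^sub>0 int"
    assume y: "y \<in> bilinear_relations (witt_group p k) field_units"
    have "pad_sum y \<in> Rel k"
    proof -
      from y consider (l) a a' b where "length a = k" "length a' = k" "b \<noteq> 0"
          "y = frag_of (witt_op p k (+) a a', b) - frag_of (a, b) - frag_of (a', b)"
        | (r) a b b' where "b \<noteq> 0" "b' \<noteq> 0" "y = frag_of (a, b * b') - frag_of (a, b) - frag_of (a, b')"
        unfolding bilinear_relations_def by auto
      then show ?thesis
      proof cases
        case l
        have "witt_op p k (+) a a' = wtrunc k (wpad a + wpad a')"
          using witt_op_wtrunc[of k "wpad a" "wpad a'"] l by simp
        then have "sy (wpad (witt_op p k (+) a a')) b - sy (wpad a + wpad a') b \<in> Rel k"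
          using wpad_wtrunc[of k "wpad a + wpad a'"] by (intro sy_cong_vfil l) simp
        from Rel_add[OF this sy_add[OF l(3), of "wpad a" "wpad a'" k]] show ?thesis
          unfolding l pad_sum_simps by (simp add: algebra_simps)
      next
        case r
        then show ?thesis unfolding r pad_sum_simps by (intro Rel_right)
      qed
    qed
    then show "y \<in> S" using y bilinear_relations_subset unfolding S_def by blast
  qed
  have tensor: "witt_tensor p k (wtrunc k w) \<beta> \<in> ?q ` S" if "\<beta> \<noteq> 0" "sy w \<beta> \<in> Rel k" for w and \<beta> :: 'a
  proof -
    have "sy (wpad (wtrunc k w)) \<beta> \<in> Rel k"
      using Rel_cong[OF sy_cong_vfil[OF that(1) wpad_wtrunc]] that(2) by blast
    then have "frag_of (wtrunc k w, \<beta>) \<in> S" using that(1) by (simp add: S_def pad_sum_simps)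
    then show ?thesis unfolding pure_tensor_def by blast
  qed
  have rel: "H2_relations p k \<subseteq> ?q ` S"
  proof
    fix y :: "'a tensor" assume "y \<in> H2_relations p k"
    then consider (a) i \<beta> where "i < k" "\<beta> \<noteq> 0" "y = witt_tensor p k ((replicate k 0)[i := \<beta>]) \<beta>"
      | (b) \<omega> \<beta> where "length \<omega> = k" "\<beta> \<noteq> 0" "y = witt_tensor p k (map (\<lambda>x. x ^ p) \<omega> \<ominus>\<^bsub>witt_ring p k\<^esub> \<omega>) \<beta>"
      unfolding H2_relations_def by auto
    then show "y \<in> ?q ` S"
    proof cases
      case a
      show ?thesis unfolding a(3) wtrunc_teich[OF a(1)] by (rule tensor[OF a(2) Rel_self[OF a(2)]])
    next
      case b
      obtain w :: "'a witt" where w: "\<omega> = wtrunc k w" using list_eq_wtrunc[OF b(1)] by blast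
      show ?thesis
        unfolding b(3) w wtrunc_frobenius witt_ring_minus by (rule tensor[OF b(2) Rel_frobenius[OF b(2)]])
    qed
  qed
  have "?q x \<in> ?q ` S"
  proof (rule H2_quotient(5)[OF _ rel])
    show "subgroup (?q ` S) (witt_tensor_group p k)" by (rule q.subgroup_img_is_subgroup[OF S])
    show "?q x \<in> carrier (witt_tensor_group p k)" using x by (rule q.hom_closed)
    show "H2_subgroup p k #>\<^bsub>witt_tensor_group p k\<^esub> ?q x = \<one>\<^bsub>H2 p k\<^esub>"
      using one unfolding qclass_def .
  qed
  then obtain y where y: "y \<in> S" "?q x = ?q y" by blast
  have yc: "y \<in> carrier (FA k)" using y(1) by (simp add: S_def)
  have "?q (x \<otimes>\<^bsub>FA k\<^esub> inv\<^bsub>FA k\<^esub> y) = \<one>\<^bsub>witt_tensor_group p k\<^esub>"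
    using x yc y(2) by (metis F.inv_closed T.r_inv q.hom_closed q.hom_inv q.hom_mult)
  then have "x \<otimes>\<^bsub>FA k\<^esub> inv\<^bsub>FA k\<^esub> y \<in> S"
    by (intro tensor_quotient(5)[OF S bil] F.m_closed F.inv_closed x yc)
  then have "(x \<otimes>\<^bsub>FA k\<^esub> inv\<^bsub>FA k\<^esub> y) \<otimes>\<^bsub>FA k\<^esub> y \<in> S"
    using y(1) by (rule subgroup.m_closed[OF S])
  then have "x \<in> S" using x yc by (simp add: F.m_assoc)
  then show ?thesis by (simp add: S_def)
qed

end

section \<open>The dictionary between classes and formal sums of symbols\<close>

context char_p
begin

lemma group_hom_qclass: "group_hom (FA k) (H2 p k) (qclass k)"
  unfolding group_hom_def group_hom_axioms_def
  by (intro conjI qclass_hom comm_group.axioms(2)[OF comm_group_H2]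
      comm_group.axioms(2)[OF abelian_free_Abelian_group])

definition H2_class :: "nat \<Rightarrow> 'a symb \<Rightarrow> 'a tensor set" where
  "H2_class k x = qclass k (trunc_sum k x)"

lemma supp_units_uminus: "x \<in> supp_units \<Longrightarrow> - x \<in> supp_units"
  by (simp add: supp_units_def)

lemma supp_units_diff: "x \<in> supp_units \<Longrightarrow> y \<in> supp_units \<Longrightarrow> x - y \<in> supp_units"
  using supp_units_add[of x "- y"] supp_units_uminus[of y] by simp

lemma supp_units_frag_cmul: "x \<in> supp_units \<Longrightarrow> frag_cmul (int n) x \<in> supp_units"
  by (induction n) (simp_all add: frag_cmul_distrib supp_units_zero supp_units_add)

lemma supp_units_induct [consumes 1, case_names zero sy diff]:
  assumes "x \<in> supp_units" and "P 0" and "\<And>w b. b \<noteq> 0 \<Longrightarrow> P (sy w b)"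
    and "\<And>x y. x \<in> supp_units \<Longrightarrow> y \<in> supp_units \<Longrightarrow> P x \<Longrightarrow> P y \<Longrightarrow> P (x - y)"
  shows "P x"
proof -
  have "Poly_Mapping.keys x \<subseteq> {s. snd s \<noteq> 0}" using assms(1) by (auto simp: supp_units_def)
  then have "x \<in> supp_units \<and> P x"
  proof (induction rule: frag_induction)
    case (one s)
    then show ?case using assms(3)[of "snd s" "fst s"] supp_units_sy[of "snd s" "fst s"] by simp
  qed (use assms(2,4) supp_units_zero supp_units_diff in auto)
  then show ?thesis ..
qed

lemma H2_class_closed: "x \<in> supp_units \<Longrightarrow> H2_class k x \<in> carrier (H2 p k)"
  unfolding H2_class_def by (intro group_hom.hom_closed[OF group_hom_qclass] trunc_sum_carrier)

lemma H2_class_zero: "H2_class k 0 = \<one>\<^bsub>H2 p k\<^esub>"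
  using group_hom.hom_one[OF group_hom_qclass] by (simp add: H2_class_def trunc_sum_simps)

lemma H2_class_add: "x \<in> supp_units \<Longrightarrow> y \<in> supp_units \<Longrightarrow> H2_class k (x + y) = H2_class k x \<otimes>\<^bsub>H2 p k\<^esub> H2_class k y"
  using group_hom.hom_mult[OF group_hom_qclass trunc_sum_carrier trunc_sum_carrier]
  by (simp add: H2_class_def trunc_sum_simps)

lemma H2_class_uminus: "x \<in> supp_units \<Longrightarrow> H2_class k (- x) = inv\<^bsub>H2 p k\<^esub> H2_class k x"
  using group_hom.hom_inv[OF group_hom_qclass trunc_sum_carrier, of x k] trunc_sum_carrier[of x k]
  by (simp add: H2_class_def trunc_sum_simps)

lemma H2_class_diff: "x \<in> supp_units \<Longrightarrow> y \<in> supp_units \<Longrightarrow>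
    H2_class k (x - y) = H2_class k x \<otimes>\<^bsub>H2 p k\<^esub> inv\<^bsub>H2 p k\<^esub> H2_class k y"
  using H2_class_add[of x "- y" k] by (simp add: H2_class_uminus supp_units_uminus)

lemma H2_class_sy: "H2_class k (sy w b) = symbol p k (wtrunc k w) b"
  by (simp add: H2_class_def trunc_sum_simps symbol_eq_qclass)

lemma H2_class_frag_cmul: "x \<in> supp_units \<Longrightarrow> H2_class k (frag_cmul (int n) x) = H2_class k x [^]\<^bsub>H2 p k\<^esub> n"
proof (induction n)
  case (Suc n)
  interpret H: comm_group "H2 p k :: 'a tensor set monoid" by (rule comm_group_H2)
  have "H2_class k (frag_cmul (int (Suc n)) x) = H2_class k (frag_cmul (int n) x) \<otimes>\<^bsub>H2 p k\<^esub> H2_class k x"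
    using Suc by (simp add: frag_cmul_distrib H2_class_add supp_units_frag_cmul H.m_comm H2_class_closed)
  then show ?case using Suc by simp
qed (simp add: H2_class_zero)

lemma finprod_H2_class:
  "finite S \<Longrightarrow> (\<And>i. i \<in> S \<Longrightarrow> f i \<in> supp_units) \<Longrightarrow> finprod (H2 p k) (\<lambda>i. H2_class k (f i)) S = H2_class k (sum f S)"
proof (induction S rule: finite_induct)
  case (insert i S)
  interpret H: comm_group "H2 p k :: 'a tensor set monoid" by (rule comm_group_H2)
  have "finprod (H2 p k) (\<lambda>i. H2_class k (f i)) (insert i S) = H2_class k (f i) \<otimes>\<^bsub>H2 p k\<^esub> finprod (H2 p k) (\<lambda>i. H2_class k (f i)) S"
    using insert by (intro H.finprod_insert) (auto simp: H2_class_closed)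
  then show ?case using insert by (simp add: H2_class_add supp_units_sum)
next
  case empty
  interpret H: comm_group "H2 p k :: 'a tensor set monoid" by (rule comm_group_H2)
  show ?case by (simp add: H2_class_zero)
qed

lemma wtrunc_zero_symbol: "b \<noteq> 0 \<Longrightarrow> H2_class k (sy 0 b) = \<one>\<^bsub>H2 p k\<^esub>"
proof -
  assume b: "b \<noteq> 0"
  interpret H: comm_group "H2 p k :: 'a tensor set monoid" by (rule comm_group_H2)
  let ?o = "wtrunc k (0 :: 'a witt)"
  have "witt_op p k (+) ?o ?o = ?o" by (simp add: witt_op_wtrunc)
  then have "frag_of (?o, b) - frag_of (?o, b) - frag_of (?o, b) \<in> bilinear_relations (witt_group p k) field_units"
    unfolding bilinear_relations_def using b by (intro UnI1 CollectI exI[of _ ?o] exI[of _ b]) simp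
  then have "qclass k (- frag_of (?o, b)) = \<one>\<^bsub>H2 p k\<^esub>" using qclass_one_if_relation by fastforce
  then have "H2_class k (- sy 0 b) = \<one>\<^bsub>H2 p k\<^esub>" by (simp add: H2_class_def trunc_sum_simps)
  then have "inv\<^bsub>H2 p k\<^esub> H2_class k (sy 0 b) = \<one>\<^bsub>H2 p k\<^esub>" using b by (simp add: H2_class_uminus supp_units_sy)
  then show ?thesis using H.inv_inv[OF H2_class_closed[OF supp_units_sy[OF b, of 0]]] by simp
qed

lemma H2_class_sy_vfil: "b \<noteq> 0 \<Longrightarrow> w \<in> vfil k \<Longrightarrow> H2_class k (sy w b) = \<one>\<^bsub>H2 p k\<^esub>"
proof -
  assume b: "b \<noteq> 0" and "w \<in> vfil k"
  then have "wtrunc k w = wtrunc k 0" by (simp add: wtrunc_eq_iff)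
  then have "H2_class k (sy w b) = H2_class k (sy 0 b)" by (simp add: H2_class_sy)
  then show ?thesis using wtrunc_zero_symbol[OF b] by simp
qed

lemma symbol_one_if_relation:
  assumes "witt_tensor p k \<omega> (\<beta> :: 'a) \<in> H2_relations p k" shows "symbol p k \<omega> \<beta> = \<one>\<^bsub>H2 p k\<^esub>"
  unfolding symbol_def by (rule H2_quotient(4)[OF assms])

text \<open>A symbol \<open>V^i [b] \<otimes> b\<close> with \<open>i \<ge> k\<close>, like the symbols in \<open>Rel_trunc\<close>, has the zero vector as
  truncation.\<close>

lemma H2_class_Rel: "x \<in> Rel k \<Longrightarrow> x \<in> supp_units \<and> H2_class k x = \<one>\<^bsub>H2 p k\<^esub>"
proof (induction rule: Rel.induct)
  case Rel_zero
  then show ?case by (simp add: supp_units_zero H2_class_zero)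
next
  case (Rel_add x y)
  interpret H: comm_group "H2 p k :: 'a tensor set monoid" by (rule comm_group_H2)
  show ?case using Rel_add by (simp add: H2_class_add supp_units_add)
next
  case (Rel_uminus x)
  interpret H: comm_group "H2 p k :: 'a tensor set monoid" by (rule comm_group_H2)
  show ?case using Rel_uminus by (simp add: H2_class_uminus supp_units_uminus)
next
  case (Rel_left b w w')
  have "trunc_sum k (sy (w + w') b - sy w b - sy w' b) \<in> bilinear_relations (witt_group p k) field_units"
    unfolding bilinear_relations_def trunc_sum_simps
    using Rel_left by (intro UnI1 CollectI exI[of _ "wtrunc k w"] exI[of _ "wtrunc k w'"] exI[of _ b]) (simp add: witt_op_wtrunc)
  then show ?case using Rel_left
    by (simp add: H2_class_def qclass_one_if_relation supp_units_diff supp_units_sy)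
next
  case (Rel_right b b' w)
  have "trunc_sum k (sy w (b * b') - sy w b - sy w b') \<in> bilinear_relations (witt_group p k) field_units"
    unfolding bilinear_relations_def trunc_sum_simps
    using Rel_right by (intro UnI2 CollectI exI[of _ "wtrunc k w"] exI[of _ b] exI[of _ b']) simp
  then show ?case using Rel_right
    by (simp add: H2_class_def qclass_one_if_relation supp_units_diff supp_units_sy)
next
  case (Rel_self b i)
  show ?case
  proof (cases "i < k")
    case True
    have "witt_tensor p k (wtrunc k ((verschiebung ^^ i) (teich b))) b \<in> H2_relations p k"
      unfolding H2_relations_def wtrunc_teich[OF True, symmetric] using True Rel_self by auto
    then show ?thesis using Rel_self by (simp add: H2_class_sy symbol_one_if_relation supp_units_sy)
  next
    case False
    have "(verschiebung ^^ i) (teich b) \<in> vfil k"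
      using False vfil_mono[of k i] vfil_iff by (metis linorder_not_less)
    then show ?thesis using Rel_self by (simp add: H2_class_sy_vfil supp_units_sy)
  qed
next
  case (Rel_frobenius b w)
  have "map (\<lambda>x. x ^ p) (wtrunc k w) \<ominus>\<^bsub>witt_ring p k\<^esub> wtrunc k w = wtrunc k (frobenius w - w)"
    unfolding wtrunc_frobenius witt_ring_minus ..
  then have "witt_tensor p k (wtrunc k (frobenius w - w)) b \<in> H2_relations p k"
    unfolding H2_relations_def using Rel_frobenius
    by (intro UnI2 CollectI exI[of _ "wtrunc k w"] exI[of _ b]) simp
  then show ?case using Rel_frobenius by (simp add: H2_class_sy symbol_one_if_relation supp_units_sy)
next
  case (Rel_trunc b w)
  then show ?case by (simp add: H2_class_sy_vfil supp_units_sy vfil_iff exI[of _ w])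
qed

lemma pad_sum_trunc_sum: "x \<in> supp_units \<Longrightarrow> pad_sum (trunc_sum k x) - x \<in> Rel k"
proof (induction rule: supp_units_induct)
  case (sy w b)
  then show ?case by (simp add: trunc_sum_simps pad_sum_simps sy_cong_vfil wpad_wtrunc)
next
  case (diff x y)
  then show ?case using Rel_diff[of "pad_sum (trunc_sum k x) - x" k "pad_sum (trunc_sum k y) - y"]
    by (simp add: trunc_sum_simps pad_sum_simps algebra_simps)
qed (simp add: trunc_sum_simps pad_sum_simps Rel_zero)

lemma H2_class_one_iff: "x \<in> supp_units \<Longrightarrow> H2_class k x = \<one>\<^bsub>H2 p k\<^esub> \<longleftrightarrow> x \<in> Rel k"
  using H2_class_Rel[of x k] qclass_one_imp_Rel[OF trunc_sum_carrier, of x k] Rel_cong[OF pad_sum_trunc_sum, of x k]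
  by (auto simp: H2_class_def)

lemma H2_class_eq_iff: "x \<in> supp_units \<Longrightarrow> y \<in> supp_units \<Longrightarrow> H2_class k x = H2_class k y \<longleftrightarrow> x - y \<in> Rel k"
proof -
  assume xy: "x \<in> supp_units" "y \<in> supp_units"
  interpret H: comm_group "H2 p k :: 'a tensor set monoid" by (rule comm_group_H2)
  have "H2_class k x = H2_class k y \<longleftrightarrow> H2_class k (x - y) = \<one>\<^bsub>H2 p k\<^esub>"
    using xy H2_class_closed[of x k] H2_class_closed[of y k] unfolding H2_class_diff[OF xy]
    by (metis H.inv_closed H.inv_equality H.inv_inv H.r_inv)
  then show ?thesis using H2_class_one_iff supp_units_diff[OF xy] by simp
qed

lemma H2_class_surj: "carrier (H2 p k) = H2_class k ` supp_units"
proof (intro equalityI subsetI)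
  fix C :: "'a tensor set"
  assume "C \<in> carrier (H2 p k)"
  then obtain y where y: "y \<in> carrier (FA k)" "C = qclass k y" unfolding qclass_surj by blast
  have "Poly_Mapping.keys y \<subseteq> {s. length (fst s) = k \<and> snd s \<noteq> 0}" using y(1) unfolding carrier_FA by blast
  then have "pad_sum y \<in> supp_units \<and> trunc_sum k (pad_sum y) = y"
  proof (induction rule: frag_induction)
    case (one s)
    then show ?case using pad_sum_simps(1)[of "fst s" "snd s"] by (simp add: trunc_sum_simps supp_units_sy)
  qed (simp_all add: pad_sum_simps trunc_sum_simps supp_units_zero supp_units_diff)
  then show "C \<in> H2_class k ` supp_units" unfolding y(2) H2_class_def by (metis image_eqI)
qed (auto simp: H2_class_closed)

lemma shift_symbols_supp_units: "x \<in> supp_units \<Longrightarrow> shift_symbols x \<in> supp_units" for x :: "'a symb"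
  by (induction rule: supp_units_induct)
    (simp_all add: supp_units_zero supp_units_sy shift_symbols_diff supp_units_diff)

lemma Cons_wtrunc: "0 # wtrunc k w = wtrunc (k + 1) (verschiebung (w :: 'a witt))"
  by (rule nth_equalityI) (auto simp: wtrunc_def nth_Cons simp del: upt_Suc split: nat.split)

text \<open>The relations are stable under the shift, so it defines a homomorphism; and a homomorphism with
  the prescribed values on symbols is unique as these generate.\<close>

lemma H2_shift_H2_class:
  assumes "x \<in> supp_units"
  shows "H2_shift p k (H2_class k x) = H2_class (k + 1) (shift_symbols (x :: 'a symb))"
proof -
  define P :: "('a tensor set \<Rightarrow> 'a tensor set) \<Rightarrow> bool" where
    "P f \<longleftrightarrow> f \<in> hom (H2 p k) (H2 p (k + 1)) \<inter> extensional (carrier (H2 p k)) \<and>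
        (\<forall>\<omega>\<in>carrier (witt_ring p k). \<forall>\<beta>\<in>carrier field_units.
           f (symbol p k \<omega> \<beta>) = symbol p (k + 1) (0 # \<omega>) \<beta>)" for f
  interpret H: comm_group "H2 p k :: 'a tensor set monoid" by (rule comm_group_H2)
  interpret H': comm_group "H2 p (k + 1) :: 'a tensor set monoid" by (rule comm_group_H2)
  have shift_cong: "H2_class (k + 1) (shift_symbols y) = H2_class (k + 1) (shift_symbols z)"
    if "y \<in> supp_units" "z \<in> supp_units" "H2_class k y = H2_class k z" for y z
  proof -
    have "shift_symbols (y - z) \<in> Rel (k + 1)" using that shift_symbols_Rel[of "y - z" k] by (simp add: H2_class_eq_iff)
    then show ?thesis using that by (simp add: H2_class_eq_iff shift_symbols_supp_units shift_symbols_diff)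
  qed
  define f where "f = restrict (\<lambda>C. H2_class (k + 1) (shift_symbols (SOME y. y \<in> supp_units \<and> H2_class k y = C))) (carrier (H2 p k))"
  have f: "f (H2_class k y) = H2_class (k + 1) (shift_symbols y)" if "y \<in> supp_units" for y
  proof -
    let ?z = "SOME z. z \<in> supp_units \<and> H2_class k z = H2_class k y"
    have "?z \<in> supp_units \<and> H2_class k ?z = H2_class k y" by (rule someI[of _ y]) (simp add: that)
    then have "H2_class (k + 1) (shift_symbols ?z) = H2_class (k + 1) (shift_symbols y)" using that shift_cong by blast
    then show ?thesis using that by (simp add: f_def H2_class_closed)
  qed
  have "P f" unfolding P_def
  proof (intro conjI IntI ballI)
    show "f \<in> hom (H2 p k) (H2 p (k + 1))"
    proof (rule homI)
      fix C :: "'a tensor set" assume "C \<in> carrier (H2 p k)"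
      then show "f C \<in> carrier (H2 p (k + 1))"
        unfolding H2_class_surj[of k] using f H2_class_closed shift_symbols_supp_units by auto
      fix D :: "'a tensor set" assume "D \<in> carrier (H2 p k)"
      with \<open>C \<in> carrier (H2 p k)\<close> obtain y z where yz: "y \<in> supp_units" "z \<in> supp_units" "C = H2_class k y" "D = H2_class k z"
        unfolding H2_class_surj by blast
      have "f (H2_class k (y + z)) = f (H2_class k y) \<otimes>\<^bsub>H2 p (k + 1)\<^esub> f (H2_class k z)"
        using yz by (simp only: f supp_units_add shift_symbols_add H2_class_add[of "shift_symbols y" "shift_symbols z"] shift_symbols_supp_units)
      then show "f (C \<otimes>\<^bsub>H2 p k\<^esub> D) = f C \<otimes>\<^bsub>H2 p (k + 1)\<^esub> f D" using yz by (simp only: H2_class_add)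
    qed
    show "f \<in> extensional (carrier (H2 p k))" by (simp add: f_def)
    fix \<omega> :: "'a list" and \<beta> :: 'a
    assume "\<omega> \<in> carrier (witt_ring p k)" and "\<beta> \<in> carrier field_units"
    then have "length \<omega> = k" "\<beta> \<noteq> 0" by simp_all
    then show "f (symbol p k \<omega> \<beta>) = symbol p (k + 1) (0 # \<omega>) \<beta>"
      using f[of "sy (wpad \<omega>) \<beta>"] Cons_wtrunc[of k "wpad \<omega>"] by (simp add: H2_class_sy supp_units_sy)
  qed
  \<comment> \<open>Uniqueness: the values on symbols determine the values on all classes.\<close>
  have P_H2_class: "g (H2_class k y) = H2_class (k + 1) (shift_symbols y)" if "P g" and "y \<in> supp_units" for g y
  proof -
    interpret g: group_hom "H2 p k" "H2 p (k + 1)" g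
      using \<open>P g\<close> H.is_group H'.is_group by (simp add: P_def group_hom_def group_hom_axioms_def)
    show ?thesis using \<open>y \<in> supp_units\<close>
    proof (induction rule: supp_units_induct)
      case zero
      show ?case using g.hom_one by (simp only: H2_class_zero shift_symbols_zero)
    next
      case (sy w b)
      have "g (symbol p k (wtrunc k w) b) = symbol p (k + 1) (0 # wtrunc k w) b"
        using \<open>P g\<close> sy by (simp add: P_def)
      then show ?case by (simp only: H2_class_sy shift_symbols_sy Cons_wtrunc)
    next
      case (diff y z)
      have "g (H2_class k (y - z)) = g (H2_class k y) \<otimes>\<^bsub>H2 p (k + 1)\<^esub> inv\<^bsub>H2 p (k + 1)\<^esub> g (H2_class k z)"
        using diff by (simp only: H2_class_diff g.hom_mult g.hom_inv H.inv_closed H2_class_closed)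
      then show ?case using diff by (simp only: shift_symbols_diff H2_class_diff shift_symbols_supp_units)
    qed
  qed
  have "g = f" if "P g" for g
  proof (rule extensionalityI[of _ "carrier (H2 p k)"])
    show "g \<in> extensional (carrier (H2 p k))" using that by (simp add: P_def)
    show "f \<in> extensional (carrier (H2 p k))" by (simp add: f_def)
    show "g C = f C" if "C \<in> carrier (H2 p k)" for C :: "'a tensor set"
      using that P_H2_class[OF \<open>P g\<close>] P_H2_class[OF \<open>P f\<close>] unfolding H2_class_surj by auto
  qed
  then have "(THE f. P f) = f" using \<open>P f\<close> by (intro the_equality)
  moreover have "H2_shift p k = (THE f. P f)" unfolding H2_shift_def P_def ..
  ultimately show ?thesis using f[OF assms] by simp
qed

text \<open>The inverse makes sense because the shift is injective.\<close>

lemma the_inv_into_H2_shift: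
  assumes "x \<in> supp_units"
  shows "the_inv_into (carrier (H2 p k)) (H2_shift p k) (H2_class (k + 1) (shift_symbols x)) = H2_class k (x :: 'a symb)"
proof (rule the_inv_into_f_eq)
  show "H2_shift p k (H2_class k x) = H2_class (k + 1) (shift_symbols x)" by (rule H2_shift_H2_class[OF assms])
  show "H2_class k x \<in> carrier (H2 p k)" by (rule H2_class_closed[OF assms])
  show "inj_on (H2_shift p k :: 'a tensor set \<Rightarrow> _) (carrier (H2 p k))"
  proof (rule inj_onI)
    fix C D :: "'a tensor set"
    assume "C \<in> carrier (H2 p k)" "D \<in> carrier (H2 p k)" and eq: "H2_shift p k C = H2_shift p k D"
    then obtain y z where yz: "y \<in> supp_units" "z \<in> supp_units" "C = H2_class k y" "D = H2_class k z"
      unfolding H2_class_surj by blast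
    have "(shift_symbols ^^ 1) (y - z) \<in> Rel (k + 1)"
      using eq yz by (simp add: H2_shift_H2_class H2_class_eq_iff shift_symbols_supp_units shift_symbols_diff)
    then have "y - z \<in> Rel k" using shift_symbols_funpow_injective[OF supp_units_diff[OF yz(1,2)]] by blast
    then show "C = D" using yz by (simp add: H2_class_eq_iff)
  qed
qed

lemma symbol_length_le:
  assumes K: "finite K" and b: "\<And>i. i \<in> K \<Longrightarrow> b i \<noteq> (0 :: 'a)"
  shows "symbol_length p k (H2_class k (\<Sum>i\<in>K. sy (w i) (b i))) \<le> card K"
proof -
  obtain h where h: "bij_betw h {..<card K} K"
    using ex_bij_betw_nat_finite[OF K] by (auto simp: atLeast0LessThan)
  define s where "s n = H2_class k (sy (w (h n)) (b (h n)))" for n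
  have hK: "h n \<in> K" if "n < card K" for n using bij_betwE[OF h] that by blast
  have "is_symbol p k (s n)" if "n < card K" for n
    unfolding is_symbol_def s_def H2_class_sy
    by (rule bexI[of _ "wtrunc k (w (h n))"], rule bexI[of _ "b (h n)"]) (simp_all add: b hK that)
  moreover have "H2_class k (\<Sum>i\<in>K. sy (w i) (b i)) = finprod (H2 p k) s {..<card K}"
  proof -
    have "finprod (H2 p k) s {..<card K} = H2_class k (\<Sum>n<card K. sy (w (h n)) (b (h n)))"
      unfolding s_def by (rule finprod_H2_class) (simp_all add: supp_units_sy b hK)
    also have "(\<Sum>n<card K. sy (w (h n)) (b (h n))) = (\<Sum>i\<in>K. sy (w i) (b i))"
      by (rule sum.reindex_bij_betw[OF h])
    finally show ?thesis ..
  qed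
  ultimately show ?thesis unfolding symbol_length_def by (intro Least_le) blast
qed

end

theorem theorem4p1:
  fixes p r m :: nat
    and \<omega> :: "nat \<Rightarrow> 'a::field list"
    and \<beta> :: "nat \<Rightarrow> 'a"
    and A :: "'a tensor set"
  assumes "Factorial_Ring.prime p" and "CHAR('a) = p"
    and "r \<ge> 1" and "m \<ge> 2"
    and "\<And>i. i \<in> {1..r} \<Longrightarrow> \<omega> i \<in> carrier (witt_ring p m)"
    and "\<And>i. i \<in> {1..r} \<Longrightarrow> \<beta> i \<in> carrier field_units"
    and "A = finprod (H2 p m) (\<lambda>i. symbol p m (\<omega> i) (\<beta> i)) {1..r}"
    and "group.ord (H2 p m) A dvd p ^ (m - 1)"
  shows "symbol_length_of_preimage p (m - 1) A \<le> p ^ r + r - 1"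
proof -
  interpret char_p p "TYPE('a)" by unfold_locales (use assms(1,2) in auto)
  interpret H: comm_group "H2 p m :: 'a tensor set monoid" by (rule comm_group_H2)
  obtain n where m: "m = Suc n" using assms(4) by (cases m) auto
  let ?I = "{1..r}"
  define x where "x = (\<Sum>i\<in>?I. sy (wpad (\<omega> i)) (\<beta> i))"
  have \<beta>: "\<beta> i \<noteq> 0" if "i \<in> ?I" for i using assms(6)[OF that] by simp
  have x: "x \<in> supp_units" unfolding x_def by (intro supp_units_sum supp_units_sy \<beta>)
  have "H2_class m x = finprod (H2 p m) (\<lambda>i. H2_class m (sy (wpad (\<omega> i)) (\<beta> i))) ?I"
    unfolding x_def by (rule finprod_H2_class[symmetric]) (simp_all add: supp_units_sy \<beta>)
  also have "\<dots> = A" unfolding assms(7)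
  proof (rule H.finprod_cong')
    have eq: "H2_class m (sy (wpad (\<omega> i)) (\<beta> i)) = symbol p m (\<omega> i) (\<beta> i)" if "i \<in> ?I" for i
      using assms(5)[OF that] by (simp add: H2_class_sy)
    show "H2_class m (sy (wpad (\<omega> i)) (\<beta> i)) = symbol p m (\<omega> i) (\<beta> i)" if "i \<in> ?I" for i
      by (rule eq[OF that])
    show "(\<lambda>i. symbol p m (\<omega> i) (\<beta> i)) \<in> ?I \<rightarrow> carrier (H2 p m)"
      by (rule Pi_I, subst eq[symmetric]) (assumption, intro H2_class_closed supp_units_sy \<beta>)
  qed simp
  finally have A: "A = H2_class m x" ..
  have "A [^]\<^bsub>H2 p m\<^esub> (p ^ n) = \<one>\<^bsub>H2 p m\<^esub>"
    using assms(8) H.pow_eq_id[of A "p ^ n"] H2_class_closed[OF x] by (simp add: A m)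
  then have "frag_cmul (int (p ^ n)) x \<in> Rel m"
    unfolding A H2_class_frag_cmul[OF x, symmetric] by (rule H2_class_one_iff[OF supp_units_frag_cmul[OF x], THEN iffD1])
  then have "(\<Sum>i\<in>?I. sy ((verschiebung ^^ n) (wpad (\<omega> i))) (\<beta> i)) \<in> Rel (Suc n)"
    using Rel_cong[OF frag_cmul_p_power[where I = ?I and \<beta> = \<beta> and j = n and \<omega> = "\<lambda>i. wpad (\<omega> i)" and k = m, OF \<beta>]] unfolding x_def m by blast
  then have first: "(\<Sum>i\<in>?I. sy ((verschiebung ^^ (m - 1)) (teich (wcomp (wpad (\<omega> i)) 0))) (\<beta> i)) \<in> Rel m"
    using first_components[where I = ?I and \<beta> = \<beta> and n = n and \<omega> = "\<lambda>i. wpad (\<omega> i)", OF \<beta>]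
    unfolding m diff_Suc_1 by blast
  have "m > 0" by (simp add: m)
  have "\<exists>w E t u. E \<subseteq> reduced_in ?I - {0} \<and> (\<forall>e\<in>E. u e \<noteq> 0) \<and>
      (\<forall>k. x - shift_symbols ((\<Sum>i\<in>?I. sy (w i) (\<beta> i)) + (\<Sum>e\<in>E. sy (t e) (u e))) \<in> Rel k)"
    unfolding x_def by (rule shifted_representative[OF finite_atLeastAtMost _ \<open>m > 0\<close> first]) (rule \<beta>)
  then obtain w E t u where "E \<subseteq> reduced_in ?I - {0} \<and> (\<forall>e\<in>E. u e \<noteq> 0) \<and>
      (\<forall>k. x - shift_symbols ((\<Sum>i\<in>?I. sy (w i) (\<beta> i)) + (\<Sum>e\<in>E. sy (t e) (u e))) \<in> Rel k)"
    by (elim exE) (rule that)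
  then have E: "E \<subseteq> reduced_in ?I - {0}" "\<forall>e\<in>E. u e \<noteq> 0"
    and Y: "\<forall>k. x - shift_symbols ((\<Sum>i\<in>?I. sy (w i) (\<beta> i)) + (\<Sum>e\<in>E. sy (t e) (u e))) \<in> Rel k"
    by blast+
  have finE: "finite E" and cardE: "card E \<le> p ^ r - 1"
  proof -
    have fin: "finite (reduced_in ?I)" by (rule card_reduced_in) simp
    show "finite E" using E(1) fin by (meson finite_Diff finite_subset)
    have "0 \<in> reduced_in ?I" by (simp add: reduced_in_def prime_gt_0_nat prime_p)
    then have "card (reduced_in ?I - {0}) = p ^ r - 1" using card_reduced_in(2)[of ?I] by (simp add: card_Diff_singleton)
    then show "card E \<le> p ^ r - 1" using card_mono[OF _ E(1)] fin by simp
  qed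
  \<comment> \<open>The preimage of \<open>A\<close>, indexed by a disjoint union so that the number of its symbols can be
     counted.\<close>
  define Y where "Y = (\<Sum>s\<in>?I <+> E. sy (case_sum w t s) (case_sum \<beta> u s))"
  have Y_eq: "Y = (\<Sum>i\<in>?I. sy (w i) (\<beta> i)) + (\<Sum>e\<in>E. sy (t e) (u e))"
    unfolding Y_def using finE by (subst sum.Plus) auto
  have nz: "case_sum \<beta> u s \<noteq> 0" if "s \<in> ?I <+> E" for s using that \<beta> E(2) by auto
  have Ys: "Y \<in> supp_units" unfolding Y_def by (intro supp_units_sum supp_units_sy nz)
  have "x - shift_symbols Y \<in> Rel m" unfolding Y_eq using Y by blast
  then have "A = H2_class (n + 1) (shift_symbols Y)" unfolding A by (simp add: m H2_class_eq_iff x Ys shift_symbols_supp_units)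
  then have "symbol_length_of_preimage p (m - 1) A = symbol_length p n (H2_class n Y)"
    unfolding symbol_length_of_preimage_def m using the_inv_into_H2_shift[OF Ys, of n] by simp
  also have "\<dots> \<le> card (?I <+> E)" unfolding Y_def by (rule symbol_length_le) (use finE nz in auto)
  also have "\<dots> \<le> r + (p ^ r - 1)" using finE cardE by (simp add: card_Plus)
  also have "\<dots> = p ^ r + r - 1" using prime_gt_0_nat[OF prime_p] by (simp add: Suc_leI)
  finally show ?thesis .
qed

end
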